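(* Let $d$ be a non-zero square-free integer and let $E^d/\mathbb{Q}: y^2=x^3-4320d^2x+96768d^3$, an elliptic curve with complex multiplication by $\mathbb{Z}[\sqrt{-2}]$ (so $j(E^d)=8000$). Up to conjugation in $\mathrm{GL}(2,\mathbb{Z}_2)$ there are exactly $5$ possible $2$-adic images $G_{E^d,2^\infty}$, and $G_{E^d,2^\infty}$ is conjugate in $\mathrm{GL}(2,\mathbb{Z}_2)$ to: \begin{itemize} \item $\langle G^{2,3},c_1\rangle$ if $d=2$; \item $\langle G^{2,4},c_1\rangle$ if $d=1$; \item $\langle G^{2,3},c_{-1}\rangle$ if $d=-1$; \item $\langle G^{2,4},c_{-1}\rangle$ if $d=-2$; \item the full group $\mathcal{N}_{-2,0}(2^\infty)$ if $d\notin\pm(\mathbb{Q}^\times)^2$ and $d\notin\pm2(\mathbb{Q}^\times)^2$. \end{itemize}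
   Context: For an elliptic curve $E/\mathbb{Q}$, $G_{E,2^\infty}\subseteq \mathrm{GL}(2,\mathbb{Z}_2)$ denotes the image of the representation of $\mathrm{Gal}(\overline{\mathbb{Q}}/\mathbb{Q})$ on the $2$-adic Tate module $T_2(E)$, after a choice of $\mathbb{Z}_2$-basis. Let $$\mathcal{C}_{-2,0}(2^\infty)=\left\{\begin{pmatrix} a&b\\-2b&a\end{pmatrix}: a,b\in\mathbb{Z}_2,\ a^2+2b^2\in\mathbb{Z}_2^\times\right\},$$ for $\varepsilon\in\{\pm1\}$ let $c_\varepsilon=\begin{pmatrix}\varepsilon&0\\0&-\varepsilon\end{pmatrix}$, and set $\mathcal{N}_{-2,0}(2^\infty)=\langle\mathcal{C}_{-2,0}(2^\infty),c_1\rangle$. Here $\langle\cdots\rangle$ denotes the closed subgroup of $\mathrm{GL}(2,\mathbb{Z}_2)$ (topologically) generated by the listed elements or subgroups. Define $$G^{2,3}=\left\langle 3\,\mathrm{Id},\begin{pmatrix}1&1\\-2&1\end{pmatrix}\right\rangle,\qquad G^{2,4}=\left\langle 3\,\mathrm{Id},\begin{pmatrix}-1&-1\\2&-1\end{pmatrix}\right\rangle.$$ *)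

theory Defs
  imports
    "HOL-Analysis.Analysis"
    "HOL-Algebra.Algebraic_Closure_Type"
    "HOL-Computational_Algebra.Squarefree"
begin

section \<open>The ring of 2-adic integers\<close>

text \<open>
  The inverse limit of the rings of integers modulo \<open>2 ^ n\<close>; a residue class is represented
  by its member of \<open>{0..<2 ^ n}\<close>.
\<close>

typedef z2 = "{f :: nat \<Rightarrow> int. \<forall>n. f n \<in> {0..<2 ^ n} \<and> f (Suc n) mod 2 ^ n = f n}"
  morphisms z2_residue Abs_z2
  by (rule exI[of _ "\<lambda>_. 0"]) simp

setup_lifting type_definition_z2

lemma z2_residue_mod [simp]: "z2_residue x n mod 2 ^ n = z2_residue x n"
  using z2_residue[of x] by (auto intro: mod_pos_pos_trivial)

lemma z2_residue_0 [simp]: "z2_residue x 0 = 0"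
  using z2_residue_mod[of x 0] by (simp del: z2_residue_mod)

lemma z2_compatible:
  fixes a b :: int
  assumes "b mod 2 ^ n = a mod 2 ^ n"
  shows "a mod 2 ^ n \<in> {0..<2 ^ n} \<and> b mod 2 ^ Suc n mod 2 ^ n = a mod 2 ^ n"
  using assms by (simp add: mod_mod_cancel)

instantiation z2 :: comm_ring_1
begin

lift_definition zero_z2 :: z2 is "\<lambda>n. 0 mod 2 ^ n"
  by simp

lift_definition one_z2 :: z2 is "\<lambda>n. 1 mod 2 ^ n"
  by (rule z2_compatible) simp

lift_definition plus_z2 :: "z2 \<Rightarrow> z2 \<Rightarrow> z2" is "\<lambda>f g n. (f n + g n) mod 2 ^ n"
  by (rule z2_compatible) (metis mod_add_eq)

lift_definition minus_z2 :: "z2 \<Rightarrow> z2 \<Rightarrow> z2" is "\<lambda>f g n. (f n - g n) mod 2 ^ n"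
  by (rule z2_compatible) (metis mod_diff_eq)

lift_definition uminus_z2 :: "z2 \<Rightarrow> z2" is "\<lambda>f n. (- f n) mod 2 ^ n"
  by (rule z2_compatible) (metis mod_minus_eq)

lift_definition times_z2 :: "z2 \<Rightarrow> z2 \<Rightarrow> z2" is "\<lambda>f g n. (f n * g n) mod 2 ^ n"
  by (rule z2_compatible) (metis mod_mult_eq)

instance
proof
  fix a b c :: z2
  show "a + b + c = a + (b + c)"
    by transfer (simp add: mod_simps add.assoc)
  show "a + b = b + a"
    by transfer (simp add: add.commute)
  show "0 + a = a"
    by (rule z2_residue_inject[THEN iffD1], rule ext) (simp add: plus_z2.rep_eq zero_z2.rep_eq)
  show "- a + a = 0"
    by transfer (simp add: mod_simps)
  show "a - b = a + - b"
    by transfer (simp add: mod_simps)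
  show "a * b * c = a * (b * c)"
    by transfer (simp add: mod_simps mult.assoc)
  show "a * b = b * a"
    by transfer (simp add: mult.commute)
  show "1 * a = a"
    by (rule z2_residue_inject[THEN iffD1], rule ext)
      (simp add: times_z2.rep_eq one_z2.rep_eq mod_simps)
  show "(a + b) * c = a * c + b * c"
    by transfer (simp add: mod_simps distrib_right)
  show "(0 :: z2) \<noteq> 1"
  proof
    assume "(0 :: z2) = 1"
    then have "z2_residue 0 1 = z2_residue 1 1"
      by simp
    then show False
      by (simp add: zero_z2.rep_eq one_z2.rep_eq)
  qed
qed

end

text \<open>The inverse limit topology: the classes modulo \<open>2 ^ n\<close> are the basic open sets.\<close>

instantiation z2 :: topological_space
begin

definition open_z2 :: "z2 set \<Rightarrow> bool" where
  "open_z2 U \<longleftrightarrow> (\<forall>x\<in>U. \<exists>n. \<forall>y. z2_residue y n = z2_residue x n \<longrightarrow> y \<in> U)"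

lemma z2_residue_le:
  assumes "m \<le> n" "z2_residue x n = z2_residue y n"
  shows "z2_residue x m = z2_residue y m"
  using assms
proof (induction rule: dec_induct)
  case (step n)
  then show ?case
    using z2_residue[of x] z2_residue[of y] by (metis (mono_tags, lifting) mem_Collect_eq)
qed

instance
proof
  show "open (UNIV :: z2 set)"
    by (simp add: open_z2_def)
next
  fix S T :: "z2 set"
  assume S: "open S" and T: "open T"
  show "open (S \<inter> T)"
    unfolding open_z2_def
  proof
    fix x assume "x \<in> S \<inter> T"
    then obtain m n where
      "\<forall>y. z2_residue y m = z2_residue x m \<longrightarrow> y \<in> S"
      "\<forall>y. z2_residue y n = z2_residue x n \<longrightarrow> y \<in> T"
      using S T unfolding open_z2_def by blast
    then have "\<forall>y. z2_residue y (max m n) = z2_residue x (max m n) \<longrightarrow> y \<in> S \<inter> T"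
      by (meson IntI max.cobounded1 max.cobounded2 z2_residue_le)
    then show "\<exists>n. \<forall>y. z2_residue y n = z2_residue x n \<longrightarrow> y \<in> S \<inter> T"
      by blast
  qed
next
  fix K :: "z2 set set"
  assume "\<forall>S\<in>K. open S"
  then show "open (\<Union>K)"
    unfolding open_z2_def by (meson Union_iff)
qed

end


section \<open>Closed subgroups of \<open>GL(2, \<int>\<^sub>2)\<close>\<close>

definition GL2_Z2 :: "(z2^2^2) monoid" where
  "GL2_Z2 = \<lparr>carrier = {A. invertible A}, mult = (**), one = mat 1\<rparr>"

lemma group_GL2_Z2: "group GL2_Z2"
proof (rule groupI)
  fix x y assume "x \<in> carrier GL2_Z2" "y \<in> carrier GL2_Z2"
  then obtain x' y' where
    x: "x ** x' = mat 1" "x' ** x = mat 1" and y: "y ** y' = mat 1" "y' ** y = mat 1"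
    by (auto simp: GL2_Z2_def invertible_def)
  have "(x ** y) ** (y' ** x') = x ** (y ** y') ** x'"
    by (simp only: matrix_mul_assoc)
  moreover have "(y' ** x') ** (x ** y) = y' ** (x' ** x) ** y"
    by (simp only: matrix_mul_assoc)
  ultimately have "invertible (x ** y)"
    unfolding invertible_def using x y by (intro exI[of _ "y' ** x'"]) simp
  then show "x \<otimes>\<^bsub>GL2_Z2\<^esub> y \<in> carrier GL2_Z2"
    by (simp add: GL2_Z2_def)
next
  fix x assume "x \<in> carrier GL2_Z2"
  then obtain y where "x ** y = mat 1" "y ** x = mat 1"
    by (auto simp: GL2_Z2_def invertible_def)
  then show "\<exists>y\<in>carrier GL2_Z2. y \<otimes>\<^bsub>GL2_Z2\<^esub> x = \<one>\<^bsub>GL2_Z2\<^esub>"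
    by (auto simp: GL2_Z2_def invertible_def)
qed (auto simp: GL2_Z2_def matrix_mul_assoc invertible_def)

definition mat2 :: "z2 \<Rightarrow> z2 \<Rightarrow> z2 \<Rightarrow> z2 \<Rightarrow> z2^2^2" where
  "mat2 a b c d = vector [vector [a, b], vector [c, d]]"

definition closed_subgroup_generated :: "(z2^2^2) set \<Rightarrow> (z2^2^2) set" where
  "closed_subgroup_generated S =
     \<Inter>{H. subgroup H GL2_Z2 \<and> closedin (top_of_set (carrier GL2_Z2)) H \<and> S \<subseteq> H}"

definition conjugacy_class :: "(z2^2^2) set \<Rightarrow> (z2^2^2) set set" where
  "conjugacy_class H =
     {(\<lambda>h. g \<otimes>\<^bsub>GL2_Z2\<^esub> h \<otimes>\<^bsub>GL2_Z2\<^esub> inv\<^bsub>GL2_Z2\<^esub> g) ` H | g. g \<in> carrier GL2_Z2}"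

definition conjugate_in_GL2 :: "(z2^2^2) set \<Rightarrow> (z2^2^2) set \<Rightarrow> bool" where
  "conjugate_in_GL2 H K \<longleftrightarrow> H \<in> conjugacy_class K"

definition cartan :: "(z2^2^2) set" where
  "cartan = {mat2 a b (- 2 * b) a | a b. a\<^sup>2 + 2 * b\<^sup>2 dvd 1}"

definition c_mat :: "z2 \<Rightarrow> z2^2^2" where
  "c_mat \<epsilon> = mat2 \<epsilon> 0 0 (- \<epsilon>)"

definition normalizer_cartan :: "(z2^2^2) set" where
  "normalizer_cartan = closed_subgroup_generated (insert (c_mat 1) cartan)"

definition G23 :: "(z2^2^2) set" where
  "G23 = closed_subgroup_generated {mat2 3 0 0 3, mat2 1 1 (- 2) 1}"

definition G24 :: "(z2^2^2) set" where
  "G24 = closed_subgroup_generated {mat2 3 0 0 3, mat2 (- 1) (- 1) 2 (- 1)}"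


section \<open>Elliptic curves in short Weierstrass form\<close>

definition ec_discriminant :: "'a::field \<Rightarrow> 'a \<Rightarrow> 'a" where
  "ec_discriminant A B = - 16 * (4 * A ^ 3 + 27 * B\<^sup>2)"

definition ec_j_invariant :: "'a::field \<Rightarrow> 'a \<Rightarrow> 'a" where
  "ec_j_invariant A B = - 1728 * (4 * A) ^ 3 / ec_discriminant A B"

datatype 'a ec_point = Infinity | Affine 'a 'a

text \<open>
  The chord-and-tangent law on \<open>y\<^sup>2 = x\<^sup>3 + A x + B\<close>; as usual, the formulas do not involve \<open>B\<close>.
  They are meant for fields of characteristic different from 2 and 3.
\<close>

fun ec_add :: "'a::field \<Rightarrow> 'a ec_point \<Rightarrow> 'a ec_point \<Rightarrow> 'a ec_point" where
  "ec_add A Infinity Q = Q"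
| "ec_add A P Infinity = P"
| "ec_add A (Affine x1 y1) (Affine x2 y2) =
     (if x1 = x2 \<and> y1 = - y2 then Infinity
      else
        let l = (if x1 = x2 then (3 * x1\<^sup>2 + A) / (2 * y1) else (y2 - y1) / (x2 - x1));
            x3 = l\<^sup>2 - x1 - x2
        in Affine x3 (l * (x1 - x3) - y1))"

definition ec_group :: "'a::field \<Rightarrow> 'a \<Rightarrow> 'a ec_point monoid" where
  "ec_group A B =
     \<lparr>carrier = insert Infinity {Affine x y | x y. y\<^sup>2 = x ^ 3 + A * x + B},
      mult = ec_add A,
      one = Infinity\<rparr>"


section \<open>The 2-adic Galois representation\<close>

type_synonym qbar = "rat alg_closure"

text \<open>
  Throughout, \<open>A\<close> and \<open>B\<close> are rational, and points have coordinates in the algebraic closure.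
\<close>

abbreviation ec_qbar :: "rat \<Rightarrow> rat \<Rightarrow> qbar ec_point monoid" where
  "ec_qbar A B \<equiv> ec_group (to_ac A) (to_ac B)"

definition absolute_galois :: "(qbar \<Rightarrow> qbar) set" where
  "absolute_galois =
     {\<sigma>. bij \<sigma> \<and> (\<forall>x y. \<sigma> (x + y) = \<sigma> x + \<sigma> y) \<and> (\<forall>x y. \<sigma> (x * y) = \<sigma> x * \<sigma> y) \<and>
         (\<forall>q. \<sigma> (to_ac q) = to_ac q)}"

definition tate_module :: "rat \<Rightarrow> rat \<Rightarrow> (nat \<Rightarrow> qbar ec_point) set" where
  "tate_module A B =
     {t. \<forall>n. t n \<in> carrier (ec_qbar A B) \<and>
             t n [^]\<^bsub>ec_qbar A B\<^esub> (2 ^ n :: nat) = \<one>\<^bsub>ec_qbar A B\<^esub> \<and>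
             t (Suc n) [^]\<^bsub>ec_qbar A B\<^esub> (2 :: nat) = t n}"

definition tate_add ::
  "rat \<Rightarrow> rat \<Rightarrow> (nat \<Rightarrow> qbar ec_point) \<Rightarrow> (nat \<Rightarrow> qbar ec_point) \<Rightarrow> (nat \<Rightarrow> qbar ec_point)" where
  "tate_add A B s t = (\<lambda>n. s n \<otimes>\<^bsub>ec_qbar A B\<^esub> t n)"

definition tate_scale ::
  "rat \<Rightarrow> rat \<Rightarrow> z2 \<Rightarrow> (nat \<Rightarrow> qbar ec_point) \<Rightarrow> (nat \<Rightarrow> qbar ec_point)" where
  "tate_scale A B a t = (\<lambda>n. t n [^]\<^bsub>ec_qbar A B\<^esub> nat (z2_residue a n))"

definition tate_comb ::
  "rat \<Rightarrow> rat \<Rightarrow> (nat \<Rightarrow> qbar ec_point) \<Rightarrow> (nat \<Rightarrow> qbar ec_point) \<Rightarrow> z2 \<Rightarrow> z2 \<Rightarrow>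
   (nat \<Rightarrow> qbar ec_point)" where
  "tate_comb A B e1 e2 a b = tate_add A B (tate_scale A B a e1) (tate_scale A B b e2)"

definition tate_basis ::
  "rat \<Rightarrow> rat \<Rightarrow> (nat \<Rightarrow> qbar ec_point) \<Rightarrow> (nat \<Rightarrow> qbar ec_point) \<Rightarrow> bool" where
  "tate_basis A B e1 e2 \<longleftrightarrow>
     e1 \<in> tate_module A B \<and> e2 \<in> tate_module A B \<and>
     (\<forall>t\<in>tate_module A B. \<exists>!(a, b). t = tate_comb A B e1 e2 a b)"

definition galois_act ::
  "(qbar \<Rightarrow> qbar) \<Rightarrow> (nat \<Rightarrow> qbar ec_point) \<Rightarrow> (nat \<Rightarrow> qbar ec_point)" where
  "galois_act \<sigma> t = (\<lambda>n. map_ec_point \<sigma> (t n))"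

text \<open>
  Matrices act on column vectors: the columns of the matrix of \<open>\<sigma>\<close> are the coordinates of the
  images of the basis vectors. The convention matters, since a closed
  subgroup need not be conjugate to its transpose.
\<close>

definition galois_image ::
  "rat \<Rightarrow> rat \<Rightarrow> (nat \<Rightarrow> qbar ec_point) \<Rightarrow> (nat \<Rightarrow> qbar ec_point) \<Rightarrow> (z2^2^2) set" where
  "galois_image A B e1 e2 =
     {M. \<exists>\<sigma>\<in>absolute_galois.
           galois_act \<sigma> e1 = tate_comb A B e1 e2 (M $ 1 $ 1) (M $ 2 $ 1) \<and>
           galois_act \<sigma> e2 = tate_comb A B e1 e2 (M $ 1 $ 2) (M $ 2 $ 2)}"


section \<open>The quadratic twists with CM by \<open>\<int>[\<surd>-2]\<close>\<close>

definition Ed_A :: "int \<Rightarrow> rat" where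
  "Ed_A d = - 4320 * (of_int d)\<^sup>2"

definition Ed_B :: "int \<Rightarrow> rat" where
  "Ed_B d = 96768 * (of_int d) ^ 3"

definition Ed_basis :: "int \<Rightarrow> (nat \<Rightarrow> qbar ec_point) \<Rightarrow> (nat \<Rightarrow> qbar ec_point) \<Rightarrow> bool" where
  "Ed_basis d e1 e2 \<longleftrightarrow> tate_basis (Ed_A d) (Ed_B d) e1 e2"

definition Ed_image ::
  "int \<Rightarrow> (nat \<Rightarrow> qbar ec_point) \<Rightarrow> (nat \<Rightarrow> qbar ec_point) \<Rightarrow> (z2^2^2) set" where
  "Ed_image d e1 e2 = galois_image (Ed_A d) (Ed_B d) e1 e2"

end

theory Submission
  imports Defs
begin

text \<open>
  Let \<open>w = \<surd>-2\<close> act on \<open>E\<^sup>d\<close> by complex multiplication. If \<open>Q\<close> in the Tate module is not divisible by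
  \<open>w\<close>, then \<open>(w Q, Q)\<close> is a basis, in which the Galois image \<open>G\<close> consists of matrices commuting or
  anticommuting with \<open>w\<close>, that is, \<open>G\<close> is a closed subgroup of the normalizer \<open>N\<close> of the Cartan subgroup
  \<open>C\<close>. Three quadratic characters of \<open>N\<close> can be read off from the curve: \<open>\<gamma>\<close> with kernel \<open>C\<close> describes the
  action on \<open>\<surd>-2\<close>; \<open>\<beta>\<close>, the parity of the entry \<open>b\<close>, describes the action on \<open>\<surd>2\<close>, which generates the
  field of the 2-torsion; and dividing \<open>(0, 0)\<close> four times by \<open>w\<close> produces \<open>\<surd>(2 d)\<close>, on which the
  action is \<open>\<chi> \<gamma>\<close> for a character \<open>\<chi>\<close> of the units modulo \<open>w\<^sup>5\<close>. If \<open>d\<close> is one of \<open>\<plusminus>1\<close> and \<open>\<plusminus>2\<close>, then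
  \<open>\<surd>(2 d)\<close> is a rational multiple of a product of \<open>\<surd>2\<close> and \<open>\<surd>-2\<close>, which confines \<open>G\<close> to a subgroup of
  index 2 in \<open>N\<close>. That subgroup is topologically generated by any of its elements of \<open>C\<close> with \<open>b\<close> odd
  together with any of its elements outside \<open>C\<close>, so \<open>G\<close> is all of it. For other \<open>d\<close> the three square
  roots are independent and the same argument gives \<open>G = N\<close>. The subgroups of index 2 are told apart,
  up to conjugation, by the matrices \<open>\<plusminus>1 \<plusminus> w\<close> and \<open>c\<^sub>\<epsilon>\<close> that they contain.
\<close>

text \<open>The danger is a Galois image smaller than expected, and excluding it takes little Galois
  theory: apart from the identity and limits, the automorphisms used only have to change signs of
  square roots of integers. Two or three of them supply generators, the image is closed because the
  Galois group is compact, and generation inside the normalizer does the rest. It is within reach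
  because \<open>Z_2[w]\<close>, with \<open>w^2 = -2\<close>, has a residue field of two elements:
  each step of the filtration of its units by powers of \<open>w\<close> needs a single new element.

  The modulus \<open>w^5\<close> comes from the 16 units modulo \<open>w^5\<close>: they are the
  product of \<open>{1, -1}\<close> and the subgroup of order 8 generated by \<open>1 + w\<close>
  and \<open>1 - w\<close>. The coordinate function \<open>kappa\<close>, whose value is a square
  root of \<open>2 d\<close>, is odd and unchanged under \<open>1 + w\<close> and
  \<open>1 - w\<close>, so the units act on it through the projection \<open>chi\<close> to
  \<open>{1, -1}\<close>. The computational core is the invariance under \<open>1 + w\<close>; that
  under \<open>1 - w\<close> follows by exchanging \<open>w\<close> and \<open>-w\<close>. As
  \<open>chi\<close> is \<open>-1\<close> at \<open>-1\<close>, the four subgroups of index 2 miss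
  the scalar \<open>-1\<close>, which keeps them from being conjugate to the normalizer.\<close>

no_notation fps_nth (infixl "$" 75)
hide_const (open) UnivPoly.coeff UnivPoly.monom Polynomials.degree Polynomials.lead_coeff Module.smult

declare ec_add.simps(3) [simp del]

section \<open>The group law of a short Weierstrass curve\<close>

lemma ec_add_minus [simp]:
  "ec_add A (Affine x y) (Affine x (- y)) = Infinity"
  "ec_add A (Affine x (- y)) (Affine x y) = Infinity"
  by (simp_all add: ec_add.simps(3))

locale weierstrass =
  fixes A B :: "'a::field_char_0"
  assumes nonsingular: "4 * A ^ 3 + 27 * B\<^sup>2 \<noteq> 0"
begin

fun on_curve :: "'a ec_point \<Rightarrow> bool" where
  "on_curve Infinity = True"
| "on_curve (Affine x y) = (y\<^sup>2 = x ^ 3 + A * x + B)"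

fun neg :: "'a ec_point \<Rightarrow> 'a ec_point" where
  "neg Infinity = Infinity"
| "neg (Affine x y) = Affine x (- y)"

abbreviation add :: "'a ec_point \<Rightarrow> 'a ec_point \<Rightarrow> 'a ec_point" where
  "add \<equiv> ec_add A"

text \<open>The line \<open>y = l x + n\<close> meets the curve in the three given points, with multiplicity: the
  \<open>x\<^sub>i\<close> are the roots of \<open>x\<^sup>3 + A x + B - (l x + n)\<^sup>2\<close>.\<close>

definition line3 :: "'a \<Rightarrow> 'a \<Rightarrow> 'a \<times> 'a \<Rightarrow> 'a \<times> 'a \<Rightarrow> 'a \<times> 'a \<Rightarrow> bool" where
  "line3 l n P Q R \<longleftrightarrow>
     snd P = l * fst P + n \<and> snd Q = l * fst Q + n \<and> snd R = l * fst R + n \<and>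
     fst P + fst Q + fst R = l\<^sup>2 \<and>
     fst P * fst Q + fst P * fst R + fst Q * fst R = A - 2 * l * n \<and>
     fst P * fst Q * fst R = n\<^sup>2 - B"

text \<open>Elimination form: \<open>l\<close>, \<open>n\<close>, \<open>x1\<close>,
  \<open>x2\<close> stay free and all other quantities are polynomials in them, so rewriting turns
  claims about collinear points into polynomial identities.\<close>

lemma line3_param:
  assumes "line3 l n (x1, y1) (x2, y2) (x3, y3)"
  shows "y1 = l * x1 + n" "y2 = l * x2 + n" "y3 = l * x3 + n"
    "B = n\<^sup>2 - x1 * x2 * x3" "A = x1 * x2 + x1 * x3 + x2 * x3 + 2 * l * n"
    "x3 = l\<^sup>2 - x1 - x2"
  using assms by (auto simp: line3_def algebra_simps)

lemma line3_swap12: "line3 l n P Q R \<Longrightarrow> line3 l n Q P R"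
  by (auto simp: line3_def algebra_simps)

lemma line3_rotate: "line3 l n P Q R \<Longrightarrow> line3 l n Q R P"
  by (auto simp: line3_def algebra_simps)

lemma line3_neg:
  "line3 l n (x1, y1) (x2, y2) (x3, y3) \<Longrightarrow>
   line3 (- l) (- n) (x1, - y1) (x2, - y2) (x3, - y3)"
  by (auto simp: line3_def)

lemma line3_on_curve:
  assumes "line3 l n (x1, y1) (x2, y2) (x3, y3)"
  shows "y1\<^sup>2 = x1 ^ 3 + A * x1 + B"
  unfolding line3_param(1,4,5,6)[OF assms] by Groebner_Basis.algebra

text \<open>The product \<open>(x - x1) * (x - x2) * (x - x3)\<close> equals
  \<open>x^3 + A * x + B - (l * x + n)^2\<close>.\<close>

lemma line3_root:
  assumes "line3 l n (x1, y1) (x2, y2) (x3, y3)" "y = l * x + n" "y\<^sup>2 = x ^ 3 + A * x + B"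
  shows "x = x1 \<or> x = x2 \<or> x = x3"
proof -
  note p = line3_param[OF assms(1)]
  have "(x - x1) * (x - x2) * (x - x3) = 0"
    using assms(3) unfolding assms(2) p by Groebner_Basis.algebra
  then show ?thesis by simp
qed

text \<open>A double root of \<open>x^3 + A * x + B - (l * x + n)^2\<close> is also a zero of its
  derivative.\<close>

lemma line3_tangent:
  assumes "line3 l n (x1, y1) (x1, y2) (x3, y3)"
  shows "3 * x1\<^sup>2 + A = 2 * l * y1" "y2 = y1"
  unfolding line3_param(1,2,5,6)[OF assms] by (Groebner_Basis.algebra, rule refl)

lemma no_singular_point:
  assumes "x ^ 3 + A * x + B = 0" "3 * x\<^sup>2 + A = 0"
  shows False
proof -
  have "A = - 3 * x\<^sup>2"
    using assms(2) by Groebner_Basis.algebra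
  moreover have "B = 2 * x ^ 3"
    using assms by Groebner_Basis.algebra
  ultimately show False
    using nonsingular by (simp add: power_mult_distrib flip: power_mult)
qed

lemma line3_add:
  assumes T: "line3 l n (x1, y1) (x2, y2) (x3, y3)"
  shows "add (Affine x1 y1) (Affine x2 y2) = Affine x3 (- y3)"
proof (cases "x1 = x2")
  case True
  have tan: "3 * x1\<^sup>2 + A = 2 * l * y1" and y2: "y2 = y1"
    using line3_tangent T True by auto
  \<comment> \<open>With \<open>y1 = 0\<close> the tangent condition becomes
    \<open>3 * x1^2 + A = 0\<close>, and the point would be singular.\<close>
  have y1: "y1 \<noteq> 0"
    using no_singular_point[of x1] line3_on_curve[OF T] tan by auto
  then have "(3 * x1\<^sup>2 + A) / (2 * y1) = l"
    using tan by (simp add: field_simps)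
  moreover have "l\<^sup>2 - x1 - x1 = x3"
    using line3_param(6)[OF T] True by simp
  moreover have "l * (x1 - x3) - y1 = - y3"
    using line3_param(1,3)[OF T] by (simp add: algebra_simps)
  ultimately show ?thesis
    using True y1 y2 eq_neg_iff_add_eq_0[of y1 y1] by (simp only: ec_add.simps(3) Let_def) simp
next
  case False
  have "(y2 - y1) / (x2 - x1) = l"
    using T False unfolding line3_def by (auto simp: field_simps)
  moreover have "l\<^sup>2 - x1 - x2 = x3"
    using line3_param(6)[OF T] by simp
  moreover have "l * (x1 - x3) - y1 = - y3"
    using line3_param(1,3)[OF T] by (simp add: algebra_simps)
  ultimately show ?thesis
    using False by (simp only: ec_add.simps(3) Let_def) simp
qed

lemma line3_exists:
  assumes P: "y1\<^sup>2 = x1 ^ 3 + A * x1 + B" and Q: "y2\<^sup>2 = x2 ^ 3 + A * x2 + B"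
    and ne: "\<not> (x1 = x2 \<and> y1 = - y2)"
  obtains l n x3 y3 where "line3 l n (x1, y1) (x2, y2) (x3, y3)"
proof (cases "x1 = x2")
  case True
  then have "y1\<^sup>2 = y2\<^sup>2" and "y1 \<noteq> - y2"
    using P Q ne by auto
  then have y2: "y2 = y1"
    by (auto simp: power2_eq_iff)
  then have y1: "y1 \<noteq> 0"
    using \<open>y1 \<noteq> - y2\<close> by auto
  define l where "l = (3 * x1\<^sup>2 + A) / (2 * y1)"
  have l: "2 * l * y1 = 3 * x1\<^sup>2 + A"
    using y1 by (simp add: l_def)
  define n where "n = y1 - l * x1"
  define x3 where "x3 = l\<^sup>2 - x1 - x2"
  have "line3 l n (x1, y1) (x2, y2) (x3, l * x3 + n)"
    unfolding line3_def fst_conv snd_conv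
  proof (intro conjI)
    show "y1 = l * x1 + n" "y2 = l * x2 + n" "l * x3 + n = l * x3 + n" "x1 + x2 + x3 = l\<^sup>2"
      using True y2 by (auto simp: n_def x3_def)
    show "x1 * x2 + x1 * x3 + x2 * x3 = A - 2 * l * n"
      using l True unfolding n_def x3_def by Groebner_Basis.algebra
    show "x1 * x2 * x3 = n\<^sup>2 - B"
      using l True P unfolding n_def x3_def by Groebner_Basis.algebra
  qed
  then show ?thesis by (rule that)
next
  case False
  define l where "l = (y2 - y1) / (x2 - x1)"
  have l: "l * (x2 - x1) = y2 - y1"
    using False by (simp add: l_def)
  define n where "n = y1 - l * x1"
  define x3 where "x3 = l\<^sup>2 - x1 - x2"
  have y1: "y1 = l * x1 + n" and y2: "y2 = l * x2 + n"
    using l by (auto simp: n_def algebra_simps)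
  have "(x2 - x1) * (x1 * x2 + x1 * x3 + x2 * x3 - (A - 2 * l * n)) = 0"
    using P Q y1 y2 unfolding x3_def by Groebner_Basis.algebra
  then have e2: "x1 * x2 + x1 * x3 + x2 * x3 = A - 2 * l * n"
    using False by auto
  have "x1 * x2 * x3 = n\<^sup>2 - B"
    using e2 P y1 unfolding x3_def by Groebner_Basis.algebra
  then have "line3 l n (x1, y1) (x2, y2) (x3, l * x3 + n)"
    unfolding line3_def fst_conv snd_conv using y1 y2 e2 by (auto simp: x3_def)
  then show ?thesis by (rule that)
qed

text \<open>The third point of the line carries \<open>- y3\<close>, so that \<open>(x3, y3)\<close>
  is the sum itself. Later arguments on sums of affine points split along these two cases.\<close>

lemma add_affine_cases:
  assumes "on_curve (Affine x1 y1)" "on_curve (Affine x2 y2)"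
  obtains "Affine x1 y1 = neg (Affine x2 y2)" "add (Affine x1 y1) (Affine x2 y2) = Infinity"
  | l n x3 y3 where "line3 l n (x1, y1) (x2, y2) (x3, - y3)"
      "add (Affine x1 y1) (Affine x2 y2) = Affine x3 y3" "on_curve (Affine x3 y3)"
      "\<not> (x1 = x2 \<and> y1 = - y2)"
proof (cases "x1 = x2 \<and> y1 = - y2")
  case True
  then show ?thesis using that(1) by (auto simp: ec_add.simps(3))
next
  case False
  have "y1\<^sup>2 = x1 ^ 3 + A * x1 + B" "y2\<^sup>2 = x2 ^ 3 + A * x2 + B"
    using assms by simp_all
  from line3_exists[OF this False] obtain l n x3 y3
    where T: "line3 l n (x1, y1) (x2, y2) (x3, y3)" .
  have "line3 l n (x1, y1) (x2, y2) (x3, - (- y3))"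
    using T by simp
  moreover have "on_curve (Affine x3 (- y3))"
    using line3_on_curve[OF line3_rotate[OF line3_rotate[OF T]]] by simp
  ultimately show ?thesis
    using that(2) line3_add[OF T] False by blast
qed

lemma add_Infinity [simp]: "add P Infinity = P"
  by (cases P) auto

lemma on_curve_neg [simp]: "on_curve (neg P) = on_curve P"
  by (cases P) auto

lemma neg_neg [simp]: "neg (neg P) = P"
  by (cases P) auto

lemma on_curve_add:
  assumes "on_curve P" "on_curve Q"
  shows "on_curve (add P Q)"
proof (cases P; cases Q)
  fix x1 y1 x2 y2
  assume PQ: "P = Affine x1 y1" "Q = Affine x2 y2"
  show ?thesis
    using assms unfolding PQ by (cases rule: add_affine_cases) auto
qed (use assms in auto)

lemma add_commute:
  assumes "on_curve P" "on_curve Q"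
  shows "add P Q = add Q P"
proof (cases P; cases Q)
  fix x1 y1 x2 y2
  assume PQ: "P = Affine x1 y1" "Q = Affine x2 y2"
  show ?thesis
    using assms unfolding PQ
  proof (cases rule: add_affine_cases)
    case (2 l n x3 y3)
    then show "add (Affine x1 y1) (Affine x2 y2) = add (Affine x2 y2) (Affine x1 y1)"
      using line3_add[OF line3_swap12[OF 2(1)]] by simp
  qed auto
qed auto

lemma add_neg [simp]: "add P (neg P) = Infinity" "add (neg P) P = Infinity"
  by (cases P; simp add: ec_add.simps(3))+

text \<open>Reflecting the line through \<open>Q\<close>, \<open>R\<close> and
  \<open>-(Q + R)\<close> in the x-axis gives a line through \<open>-Q\<close>, \<open>Q + R\<close>
  and \<open>-R\<close>.\<close>

lemma add_neg_cancel:
  assumes "on_curve Q" "on_curve R"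
  shows "add (neg Q) (add Q R) = R"
proof (cases Q; cases R)
  fix x1 y1 x2 y2
  assume QR: "Q = Affine x1 y1" "R = Affine x2 y2"
  show ?thesis
    using assms unfolding QR
  proof (cases rule: add_affine_cases)
    case (2 l n x3 y3)
    have "line3 (- l) (- n) (x1, - y1) (x3, y3) (x2, - y2)"
      using line3_swap12[OF line3_rotate[OF line3_rotate[OF line3_neg[OF 2(1)]]]] by simp
    from line3_add[OF this] show "add (neg (Affine x1 y1)) (add (Affine x1 y1) (Affine x2 y2)) = Affine x2 y2"
      using 2 by simp
  qed auto
qed auto

text \<open>The product of the two lines through \<open>-U\<close> and \<open>U\<close>, with slopes \<open>l1\<close> and \<open>l2\<close>, divided by
  \<open>x - x\<^sub>U\<close>. If \<open>P + Q = U\<close> and \<open>U + R = S\<close>, its divisor is \<open>P + Q + R - S - 4 \<infinity>\<close>, where the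
  minus sign in front of \<open>S\<close> is that of the group law.\<close>

definition chord :: "'a \<Rightarrow> 'a \<Rightarrow> 'a \<Rightarrow> 'a \<Rightarrow> 'a \<Rightarrow> 'a \<Rightarrow> 'a" where
  "chord xU yU l1 l2 x y =
     x\<^sup>2 + xU * x + xU\<^sup>2 + A + l1 * l2 * (x - xU) + yU * (l1 - l2) - (l1 + l2) * y"

lemma chord_zero1:
  assumes T: "line3 l1 n1 (x, y) (xQ, yQ) (xU, - yU)"
  shows "chord xU yU l1 l2 x y = 0"
proof -
  have "yU = - (l1 * xU + n1)"
    using line3_param(3)[OF T] by Groebner_Basis.algebra
  then show ?thesis
    using line3_param(1,5,6)[OF T] unfolding chord_def by Groebner_Basis.algebra
qed

lemma chord_zero2:
  assumes T: "line3 l2 n2 (xU, yU) (x, y) (xQ, yQ)"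
  shows "chord xU yU l1 l2 x y = 0"
  using line3_param(1,2,5,6)[OF T] unfolding chord_def by Groebner_Basis.algebra

text \<open>Write the function as \<open>x^2 + a x + b - c y\<close>. The abscissas of its four
  zeros add up to \<open>c^2 - 2 a\<close>; three zeros are shared, so the fourth abscissas agree,
  and \<open>c \<noteq> 0\<close> then recovers the ordinate.\<close>

lemma chord_determines_sum:
  assumes lin: "line3 l1 n1 (xP, yP) (xQ, yQ) (xU, - yU)" "line3 l2 n2 (xU, yU) (xR, yR) (xS, - yS)"
    "line3 l3 n3 (xQ, yQ) (xR, yR) (xV, - yV)" "line3 l4 n4 (xP, yP) (xV, yV) (xW, - yW)"
    and eq: "\<And>x y. chord xU yU l1 l2 x y = chord xV yV l3 l4 x y"
    and c: "l1 + l2 \<noteq> 0"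
  shows "xS = xW \<and> yS = yW"
proof -
  let ?h = "chord xU yU l1 l2"
  have S: "?h xS (- yS) = 0"
    by (rule chord_zero2[OF line3_swap12[OF line3_rotate[OF line3_rotate[OF lin(2)]]]])
  have W: "?h xW (- yW) = 0"
    unfolding eq by (rule chord_zero2[OF line3_rotate[OF lin(4)]])
  have 0: "?h 0 0 = chord xV yV l3 l4 0 0" "?h 1 0 = chord xV yV l3 l4 1 0" "?h 0 1 = chord xV yV l3 l4 0 1"
    using eq by blast+
  have cc: "l1 + l2 = l3 + l4"
    using 0 unfolding chord_def by Groebner_Basis.algebra
  have aa: "xU + l1 * l2 = xV + l3 * l4"
    using 0 unfolding chord_def by Groebner_Basis.algebra
  have "xP + xQ + xR + xS = (l1 + l2)\<^sup>2 - 2 * (xU + l1 * l2)"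
    using lin(1,2) unfolding line3_def fst_conv snd_conv by Groebner_Basis.algebra
  moreover have "xP + xQ + xR + xW = (l3 + l4)\<^sup>2 - 2 * (xV + l3 * l4)"
    using lin(3,4) unfolding line3_def fst_conv snd_conv by Groebner_Basis.algebra
  ultimately have x: "xS = xW"
    using cc aa by Groebner_Basis.algebra
  have "(l1 + l2) * (yS - yW) = 0"
    using S W unfolding x chord_def by Groebner_Basis.algebra
  then show ?thesis using c x by simp
qed

text \<open>The functions attached to the two bracketings both vanish at \<open>P\<close>,
  \<open>Q\<close>, \<open>R\<close>, and their difference is linear. If it involves
  \<open>y\<close>, then \<open>R\<close> lies on the line through \<open>P\<close> and
  \<open>Q\<close> and so equals \<open>-(P + Q)\<close>, which is excluded; otherwise it vanishes
  at distinct abscissas and is zero. Likewise \<open>l1 + l2 = 0\<close> would leave a quadratic in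
  \<open>x\<close> with three distinct roots.\<close>

lemma assoc_distinct:
  assumes lin: "line3 l1 n1 (xP, yP) (xQ, yQ) (xU, - yU)" "line3 l2 n2 (xU, yU) (xR, yR) (xS, - yS)"
    "line3 l3 n3 (xQ, yQ) (xR, yR) (xV, - yV)" "line3 l4 n4 (xP, yP) (xV, yV) (xW, - yW)"
    and UR: "\<not> (xU = xR \<and> yU = - yR)"
    and ne: "xP \<noteq> xQ" "xP \<noteq> xR" "xQ \<noteq> xR"
  shows "xS = xW \<and> yS = yW"
proof -
  let ?h = "chord xU yU l1 l2" and ?h' = "chord xV yV l3 l4"
  have h: "?h xP yP = 0" "?h xQ yQ = 0" "?h xR yR = 0"
    using chord_zero1[OF lin(1)] chord_zero1[OF line3_swap12[OF lin(1)]] chord_zero2[OF lin(2)]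
    by auto
  have h': "?h' xP yP = 0" "?h' xQ yQ = 0" "?h' xR yR = 0"
    using chord_zero1[OF lin(3)] chord_zero1[OF line3_swap12[OF lin(3)]]
      chord_zero2[OF line3_swap12[OF lin(4)]] by auto
  define g where "g = (l3 + l4) - (l1 + l2)"
  define a where "a = xU + l1 * l2 - (xV + l3 * l4)"
  define b where "b = ?h 0 0 - ?h' 0 0"
  have diff: "?h x y - ?h' x y = a * x + g * y + b" for x y
    unfolding a_def b_def g_def chord_def by Groebner_Basis.algebra
  have z: "a * xP + g * yP + b = 0" "a * xQ + g * yQ + b = 0" "a * xR + g * yR + b = 0"
    using diff h h' by (metis diff_self)+
  have l1: "yP = l1 * xP + n1" "yQ = l1 * xQ + n1"
    using lin(1) unfolding line3_def by auto
  have "g = 0"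
  proof (rule ccontr)
    assume g: "g \<noteq> 0"
    have "(xP - xQ) * (a + g * l1) = 0"
      using z l1 by Groebner_Basis.algebra
    then have al: "a = - g * l1"
      using ne by (auto simp: add_eq_0_iff)
    have "g * (yR - (l1 * xR + n1)) = 0"
      using z al l1 by Groebner_Basis.algebra
    then have yR: "yR = l1 * xR + n1"
      using g by simp
    then have "xR = xU"
      using line3_root[OF lin(1) yR] line3_on_curve[OF line3_rotate[OF lin(2)]] ne by auto
    moreover have "- yU = l1 * xU + n1"
      using lin(1) unfolding line3_def by auto
    ultimately show False
      using yR UR by (metis minus_minus)
  qed
  then have "a * (xP - xQ) = 0"
    using z by Groebner_Basis.algebra
  then have "a = 0" "b = 0"
    using ne z \<open>g = 0\<close> by auto
  then have eq: "?h x y = ?h' x y" for x y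
    using diff[of x y] \<open>g = 0\<close> by simp
  have "l1 + l2 \<noteq> 0"
  proof
    assume c: "l1 + l2 = 0"
    have "(xP - xQ) * (xP + xQ + xU + l1 * l2) = 0" "(xP - xR) * (xP + xR + xU + l1 * l2) = 0"
      using h c unfolding chord_def by Groebner_Basis.algebra+
    then have "xP + xQ + xU + l1 * l2 = 0" "xP + xR + xU + l1 * l2 = 0"
      using ne by auto
    then have "xQ = xR"
      by Groebner_Basis.algebra
    then show False using ne by simp
  qed
  then show ?thesis
    using chord_determines_sum[OF lin eq] by blast
qed

text \<open>The case \<open>P = Q\<close> of \<open>assoc_distinct\<close>. The lost zero is
  replaced by contact of order two: \<open>D\<close> and \<open>D'\<close> say that the derivative
  of either function along the tangent at \<open>P\<close> vanishes.\<close>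

lemma assoc_tangent:
  assumes lin: "line3 l1 n1 (xP, yP) (xP, yP) (xU, - yU)" "line3 l2 n2 (xU, yU) (xR, yR) (xS, - yS)"
    "line3 l3 n3 (xP, yP) (xR, yR) (xV, - yV)" "line3 l4 n4 (xP, yP) (xV, yV) (xW, - yW)"
    and UR: "\<not> (xU = xR \<and> yU = - yR)" and PV: "\<not> (xP = xV \<and> yP = - yV)"
    and ne: "xP \<noteq> xR" "yP \<noteq> 0"
  shows "xS = xW \<and> yS = yW"
proof -
  let ?h = "chord xU yU l1 l2" and ?h' = "chord xV yV l3 l4"
  have h: "?h xP yP = 0" "?h xR yR = 0"
    using chord_zero1[OF lin(1)] chord_zero1[OF line3_swap12[OF lin(1)]] chord_zero2[OF lin(2)]
    by auto
  have h': "?h' xP yP = 0" "?h' xR yR = 0"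
    using chord_zero1[OF lin(3)] chord_zero1[OF line3_swap12[OF lin(3)]]
      chord_zero2[OF line3_swap12[OF lin(4)]] by auto
  have l1: "yP = l1 * xP + n1" "2 * xP + xU = l1\<^sup>2"
    using lin(1) unfolding line3_def by auto
  have D: "2 * xP + xU + l1 * l2 = l1 * (l1 + l2)"
    using l1 by Groebner_Basis.algebra
  have PV': "xP \<noteq> xV"
  proof
    assume xV: "xP = xV"
    then have "yP = - yV"
      using lin(3) unfolding line3_def by auto
    then show False using PV xV by simp
  qed
  have D': "2 * xP + xV + l3 * l4 = l1 * (l3 + l4)"
  proof -
    have P: "yP\<^sup>2 = xP ^ 3 + A * xP + B" and V: "yV\<^sup>2 = xV ^ 3 + A * xV + B"
      using line3_on_curve[OF lin(1)] line3_on_curve[OF line3_rotate[OF lin(4)]] by auto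
    have 3: "yP + yV = l3 * (xP - xV)" and 4: "yP - yV = l4 * (xP - xV)"
      using lin(3,4) unfolding line3_def fst_conv snd_conv by Groebner_Basis.algebra+
    have tan: "3 * xP\<^sup>2 + A = 2 * l1 * yP"
      using line3_tangent[OF lin(1)] by simp
    have "(xP - xV) * ((xP - xV) * (l3 * l4) - (xP\<^sup>2 + xP * xV + xV\<^sup>2 + A)) = 0"
      using P V 3 4 by Groebner_Basis.algebra
    then have "(xP - xV) * (l3 * l4) = xP\<^sup>2 + xP * xV + xV\<^sup>2 + A"
      using PV' by simp
    then have "(xP - xV) * (2 * xP + xV + l3 * l4 - l1 * (l3 + l4)) = 0"
      using 3 4 tan by Groebner_Basis.algebra
    then show ?thesis using PV' by simp
  qed
  define g where "g = (l3 + l4) - (l1 + l2)"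
  define a where "a = xU + l1 * l2 - (xV + l3 * l4)"
  define b where "b = ?h 0 0 - ?h' 0 0"
  have diff: "?h x y - ?h' x y = a * x + g * y + b" for x y
    unfolding a_def b_def g_def chord_def by Groebner_Basis.algebra
  have z: "a * xP + g * yP + b = 0" "a * xR + g * yR + b = 0"
    using diff h h' by (metis diff_self)+
  have al: "a = - g * l1"
    using D D' unfolding a_def g_def by Groebner_Basis.algebra
  have "g = 0"
  proof (rule ccontr)
    assume g: "g \<noteq> 0"
    have "g * (yR - (l1 * xR + n1)) = 0"
      using z al l1 by Groebner_Basis.algebra
    then have yR: "yR = l1 * xR + n1"
      using g by simp
    then have "xR = xU"
      using line3_root[OF lin(1) yR] line3_on_curve[OF line3_rotate[OF lin(2)]] ne by auto
    moreover have "- yU = l1 * xU + n1"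
      using lin(1) unfolding line3_def by auto
    ultimately show False
      using yR UR by (metis minus_minus)
  qed
  then have "a = 0" "b = 0"
    using al z by auto
  then have eq: "?h x y = ?h' x y" for x y
    using diff[of x y] \<open>g = 0\<close> by simp
  have "l1 + l2 \<noteq> 0"
  proof
    assume c: "l1 + l2 = 0"
    have "(xP - xR) * (xP + xR + xU + l1 * l2) = 0"
      using h c unfolding chord_def by Groebner_Basis.algebra
    then have "xP + xR + xU + l1 * l2 = 0"
      using ne by auto
    then have "xP = xR"
      using D c by Groebner_Basis.algebra
    then show False using ne by simp
  qed
  then show ?thesis
    using chord_determines_sum[OF lin eq] by blast
qed

text \<open>Opposite pairs are settled by cancellation first, so equal abscissas mean equal points
  afterwards. Then \<open>P = R\<close> is commutativity, \<open>P = Q\<close> is the tangent case,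
  and \<open>Q = R\<close> is the tangent case read from right to left.\<close>

lemma add_assoc:
  assumes P: "on_curve P" and Q: "on_curve Q" and R: "on_curve R"
  shows "add (add P Q) R = add P (add Q R)"
proof (cases "P = Infinity \<or> Q = Infinity \<or> R = Infinity \<or> P = neg Q \<or> Q = neg R \<or> P = neg R")
  case True
  have "add (add P (neg P)) R = add P (add (neg P) R)"
    using add_neg_cancel[of "neg P" R] P R by simp
  moreover have "add (add P (neg R)) R = add P (add (neg R) R)"
    using add_neg_cancel[of R P] P R add_commute[of P "neg R"]
      add_commute[of R "add P (neg R)"] add_neg_cancel[of "neg R" P]
    by (simp add: on_curve_add)
  moreover have "add (add P Q) (neg P) = add P (add Q (neg P))"
    using add_neg_cancel[of P Q] add_neg_cancel[of "neg P" Q] P Q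
      add_commute[of "add P Q" "neg P"] add_commute[of Q "neg P"]
    by (simp add: on_curve_add)
  ultimately show ?thesis
    using True by (elim disjE) auto
next
  case False
  then obtain xP yP xQ yQ xR yR where
    eqs: "P = Affine xP yP" "Q = Affine xQ yQ" "R = Affine xR yR"
    by (metis on_curve.cases)
  have nPQ: "\<not> (xP = xQ \<and> yP = - yQ)" and nQR: "\<not> (xQ = xR \<and> yQ = - yR)"
    and nPR: "\<not> (xP = xR \<and> yP = - yR)"
    using False by (auto simp: eqs)
  note cP = P[unfolded eqs] and cQ = Q[unfolded eqs] and cR = R[unfolded eqs]
  have y_eq: "y = y' \<or> y = - y'" if "on_curve (Affine x y)" "on_curve (Affine x y')" for x y y'
    using that by (auto simp: power2_eq_iff[symmetric])
  obtain l1 n1 xU yU where 1: "line3 l1 n1 (xP, yP) (xQ, yQ) (xU, - yU)"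
    "add P Q = Affine xU yU" "on_curve (Affine xU yU)"
    using nPQ by (cases rule: add_affine_cases[OF cP cQ]) (auto simp: eqs)
  obtain l3 n3 xV yV where 3: "line3 l3 n3 (xQ, yQ) (xR, yR) (xV, - yV)"
    "add Q R = Affine xV yV" "on_curve (Affine xV yV)"
    using nQR by (cases rule: add_affine_cases[OF cQ cR]) (auto simp: eqs)
  consider "xU = xR \<and> yU = - yR" | "xP = xV \<and> yP = - yV"
    | "\<not> (xU = xR \<and> yU = - yR)" "\<not> (xP = xV \<and> yP = - yV)" by blast
  then show ?thesis
  proof cases
    case eq: 1
    \<comment> \<open>Here \<open>(P + Q) + R\<close> is the neutral element, so the line through
      \<open>P\<close> and \<open>Q\<close> passes through \<open>R\<close>.\<close>
    then have "line3 l1 n1 (xQ, yQ) (xR, yR) (xP, yP)"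
      using line3_rotate[OF 1(1)] by simp
    from line3_add[OF this] show ?thesis
      using 1 eq by (simp add: eqs)
  next
    case 2
    then have "line3 l3 n3 (xP, yP) (xQ, yQ) (xR, yR)"
      using line3_rotate[OF line3_rotate[OF 3(1)]] by simp
    from line3_add[OF this] show ?thesis
      using 3 2 by (simp add: eqs)
  next
    case main: 3
    obtain l2 n2 xS yS where 2: "line3 l2 n2 (xU, yU) (xR, yR) (xS, - yS)"
      "add (add P Q) R = Affine xS yS"
      using main(1) by (cases rule: add_affine_cases[OF 1(3) cR]) (auto simp: eqs 1(2)[unfolded eqs])
    obtain l4 n4 xW yW where 4: "line3 l4 n4 (xP, yP) (xV, yV) (xW, - yW)"
      "add P (add Q R) = Affine xW yW"
      using main(2) by (cases rule: add_affine_cases[OF cP 3(3)]) (auto simp: eqs 3(2)[unfolded eqs])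
    consider "xP = xQ" "xP = xR" | "xP \<noteq> xQ" "xP = xR" | "xP = xQ" "xP \<noteq> xR" | "xP \<noteq> xQ" "xQ = xR"
      | "xP \<noteq> xQ" "xP \<noteq> xR" "xQ \<noteq> xR" by blast
    then show ?thesis
    proof cases
      case 5
      show ?thesis
        using assoc_distinct[OF 1(1) 2(1) 3(1) 4(1) main(1) 5] 2(2) 4(2) by simp
    next
      case PQ: 3
      then have eq: "xQ = xP" "yQ = yP" and "yP \<noteq> 0"
        using y_eq[of xP yP yQ] nPQ cP cQ by auto
      then show ?thesis
        using assoc_tangent[OF 1(1)[unfolded eq] 2(1) 3(1)[unfolded eq] 4(1) main PQ(2)] 2(2) 4(2)
        by simp
    next
      case QR: 4
      then have eq: "xR = xQ" "yR = yQ" and "yQ \<noteq> 0"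
        using y_eq[of xQ yQ yR] nQR cQ cR by auto
      have "xW = xS \<and> yW = yS"
      proof (rule assoc_tangent)
        show "line3 l3 n3 (xQ, yQ) (xQ, yQ) (xV, - yV)"
          using 3(1) eq by simp
        show "line3 l4 n4 (xV, yV) (xP, yP) (xW, - yW)"
          using 4(1) line3_swap12 by blast
        show "line3 l1 n1 (xQ, yQ) (xP, yP) (xU, - yU)"
          using 1(1) line3_swap12 by blast
        show "line3 l2 n2 (xQ, yQ) (xU, yU) (xS, - yS)"
          using 2(1) line3_swap12 eq by blast
        show "\<not> (xV = xP \<and> yV = - yP)"
          using main(2) by (metis minus_minus)
        show "\<not> (xQ = xU \<and> yQ = - yU)"
          using main(1) eq by (metis minus_minus)
        show "xQ \<noteq> xP" "yQ \<noteq> 0"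
          using QR(1) \<open>yQ \<noteq> 0\<close> by simp_all
      qed
      then show ?thesis
        using 2(2) 4(2) by simp
    qed (use y_eq[of xP yP yR] nPR cP cR P Q R add_commute on_curve_add in \<open>auto simp: eqs\<close>)
  qed
qed

lemma comm_group_ec_group: "comm_group (ec_group A B)"
proof -
  have carrier: "x \<in> carrier (ec_group A B) \<longleftrightarrow> on_curve x" for x
    by (cases x) (auto simp: ec_group_def)
  have [simp]: "mult (ec_group A B) = add" "one (ec_group A B) = Infinity"
    by (auto simp: ec_group_def)
  show ?thesis
  proof (rule comm_groupI)
    fix x assume "x \<in> carrier (ec_group A B)"
    then show "\<exists>y\<in>carrier (ec_group A B). y \<otimes>\<^bsub>ec_group A B\<^esub> x = \<one>\<^bsub>ec_group A B\<^esub>"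
      by (intro bexI[of _ "neg x"]) (auto simp: carrier)
  qed (auto simp: carrier on_curve_add add_assoc intro: add_commute)
qed

end

section \<open>The absolute Galois group\<close>

definition subfield_of :: "'a::field set \<Rightarrow> bool" where
  "subfield_of F \<longleftrightarrow> 0 \<in> F \<and> 1 \<in> F \<and> (\<forall>x\<in>F. \<forall>y\<in>F. x + y \<in> F \<and> x * y \<in> F) \<and>
     (\<forall>x\<in>F. - x \<in> F \<and> inverse x \<in> F)"

text \<open>Functions are total with arbitrary values outside \<open>F\<close>;
  \<open>f 1 = 1\<close> rules out the zero map.\<close>

definition field_hom_on :: "'a::field set \<Rightarrow> ('a \<Rightarrow> 'a) \<Rightarrow> bool" where
  "field_hom_on F f \<longleftrightarrow> f 1 = 1 \<and> (\<forall>x\<in>F. \<forall>y\<in>F. f (x + y) = f x + f y \<and> f (x * y) = f x * f y)"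

lemma field_hom_on_0:
  assumes "subfield_of F" "field_hom_on F f"
  shows "f 0 = 0"
proof -
  have "f (0 + 0) = f 0 + f 0"
    using assms unfolding subfield_of_def field_hom_on_def by blast
  then show ?thesis by (metis add_cancel_left_left add_0)
qed

lemma field_hom_on_minus:
  assumes "subfield_of F" "field_hom_on F f" "x \<in> F"
  shows "f (- x) = - f x"
proof -
  have "f (x + - x) = f x + f (- x)"
    using assms unfolding subfield_of_def field_hom_on_def by blast
  then show ?thesis
    using field_hom_on_0[OF assms(1,2)] by (simp add: eq_neg_iff_add_eq_0 add.commute)
qed

lemma field_hom_on_inverse:
  assumes "subfield_of F" "field_hom_on F f" "x \<in> F"
  shows "f (inverse x) = inverse (f x)"
proof (cases "x = 0")
  case False
  have "f (x * inverse x) = f x * f (inverse x)"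
    using assms unfolding subfield_of_def field_hom_on_def by blast
  then show ?thesis
    using False assms(2) unfolding field_hom_on_def by (metis inverse_unique right_inverse)
qed (use field_hom_on_0[OF assms(1,2)] in simp)

lemma coeffs_in_subfield:
  assumes F: "subfield_of F" and "\<forall>i. coeff p i \<in> F" "\<forall>i. coeff q i \<in> F"
  shows "coeff (p + q) i \<in> F" "coeff (p * q) i \<in> F" "coeff (- p) i \<in> F"
proof -
  have sum: "(\<Sum>i\<in>A. g i) \<in> F" if "\<forall>i. g i \<in> F" for g :: "nat \<Rightarrow> 'a" and A
    by (induction A rule: infinite_finite_induct) (use F that in \<open>auto simp: subfield_of_def\<close>)
  show "coeff (p * q) i \<in> F"
    unfolding coeff_mult using assms by (intro sum) (auto simp: subfield_of_def)
qed (use assms in \<open>auto simp: subfield_of_def\<close>)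

lemma map_poly_field_hom:
  assumes F: "subfield_of F" and f: "field_hom_on F f"
    and p: "\<forall>i. coeff p i \<in> F" and q: "\<forall>i. coeff q i \<in> F"
  shows "map_poly f (p + q) = map_poly f p + map_poly f q"
    "map_poly f (p * q) = map_poly f p * map_poly f q"
    "map_poly f (- p) = - map_poly f p"
proof -
  note f0 = field_hom_on_0[OF F f]
  have sum: "f (\<Sum>i\<in>A. g i) = (\<Sum>i\<in>A. f (g i)) \<and> (\<Sum>i\<in>A. g i) \<in> F"
    if "\<forall>i. g i \<in> F" for g :: "nat \<Rightarrow> 'a" and A
  proof (induction A rule: infinite_finite_induct)
    case (insert x A)
    then show ?case
      using F f that unfolding field_hom_on_def subfield_of_def by auto
  qed (use f0 F in \<open>auto simp: subfield_of_def\<close>)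
  show "map_poly f (p + q) = map_poly f p + map_poly f q"
    using f p q f0 by (intro poly_eqI) (auto simp: coeff_map_poly field_hom_on_def)
  show "map_poly f (- p) = - map_poly f p"
    using field_hom_on_minus[OF F f] p f0 by (intro poly_eqI) (auto simp: coeff_map_poly)
  show "map_poly f (p * q) = map_poly f p * map_poly f q"
  proof (rule poly_eqI)
    fix n
    have "f (\<Sum>i\<le>n. coeff p i * coeff q (n - i)) = (\<Sum>i\<le>n. f (coeff p i * coeff q (n - i)))"
      using sum p q F by (simp add: subfield_of_def)
    also have "\<dots> = (\<Sum>i\<le>n. f (coeff p i) * f (coeff q (n - i)))"
      using f p q by (intro sum.cong) (auto simp: field_hom_on_def)
    finally show "coeff (map_poly f (p * q)) n = coeff (map_poly f p * map_poly f q) n"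
      using f0 by (simp add: coeff_map_poly coeff_mult)
  qed
qed

lemma minimal_polynomial_exists:
  assumes F: "subfield_of F" and alg: "p \<noteq> 0" "\<forall>i. coeff p i \<in> F" "poly p a = 0"
  obtains m where "m \<noteq> 0" "\<forall>i. coeff m i \<in> F" "poly m a = 0" "lead_coeff m = 1"
    "\<And>q. q \<noteq> 0 \<Longrightarrow> \<forall>i. coeff q i \<in> F \<Longrightarrow> poly q a = 0 \<Longrightarrow> degree m \<le> degree q"
proof -
  let ?P = "\<lambda>q. q \<noteq> 0 \<and> (\<forall>i. coeff q i \<in> F) \<and> poly q a = 0"
  obtain m where m: "?P m" "\<And>q. ?P q \<Longrightarrow> degree m \<le> degree q"
    using ex_has_least_nat[of ?P p degree] alg by auto
  define m' where "m' = smult (inverse (lead_coeff m)) m"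
  have l: "inverse (lead_coeff m) \<noteq> 0"
    using m(1) by simp
  show ?thesis
  proof (rule that)
    show "m' \<noteq> 0" "poly m' a = 0" "lead_coeff m' = 1"
      using m(1) l by (auto simp: m'_def)
    show "\<forall>i. coeff m' i \<in> F"
      using m(1) F by (auto simp: m'_def subfield_of_def)
    show "degree m' \<le> degree q" if "q \<noteq> 0" "\<forall>i. coeff q i \<in> F" "poly q a = 0" for q
      using m(2) that l by (auto simp: m'_def)
  qed
qed

text \<open>Long division by the minimal polynomial \<open>m\<close>, one monomial multiple
  \<open>t * m\<close> at a time. Such a multiple vanishes at \<open>a\<close>, and its image under
  \<open>f\<close> vanishes at \<open>b\<close>; minimality of \<open>m\<close> lets the division go
  on until nothing is left.\<close>

lemma root_transfer:
  assumes F: "subfield_of F" and f: "field_hom_on F f"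
    and m: "\<forall>i. coeff m i \<in> F" "lead_coeff m = 1" "poly m a = 0"
      "\<And>q. q \<noteq> 0 \<Longrightarrow> \<forall>i. coeff q i \<in> F \<Longrightarrow> poly q a = 0 \<Longrightarrow> degree m \<le> degree q"
    and b: "poly (map_poly f m) b = 0"
    and q: "\<forall>i. coeff q i \<in> F" "poly q a = 0"
  shows "poly (map_poly f q) b = 0"
  using q
proof (induction "degree q" arbitrary: q rule: less_induct)
  case less
  show ?case
  proof (cases "q = 0")
    case True
    then show ?thesis
      using field_hom_on_0[OF F f] by simp
  next
    case False
    then have deg: "degree m \<le> degree q"
      using m(4) less.prems by blast
    define t where "t = monom (lead_coeff q) (degree q - degree m)"
    have t: "\<forall>i. coeff t i \<in> F"
      using less.prems F by (auto simp: t_def subfield_of_def)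
    have tm: "\<forall>i. coeff (t * m) i \<in> F" "\<forall>i. coeff (- (t * m)) i \<in> F"
      using coeffs_in_subfield[OF F t m(1)] coeffs_in_subfield(3)[OF F, of "t * m" 0] F
      by (auto simp: subfield_of_def)
    define r where "r = q + - (t * m)"
    have r: "\<forall>i. coeff r i \<in> F" "poly r a = 0"
      using coeffs_in_subfield(1)[OF F less.prems(1) tm(2)] less.prems m(3) by (auto simp: r_def)
    have "m \<noteq> 0"
      using m(2) by auto
    have "lead_coeff t = lead_coeff q"
      unfolding t_def by (rule Polynomial.lead_coeff_monom)
    then have lc: "lead_coeff (t * m) = lead_coeff q"
      by (simp only: lead_coeff_mult m(2)) simp
    have deg_tm: "degree (t * m) = degree q"
    proof -
      have "t \<noteq> 0"
        using False by (simp add: t_def)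
      moreover have "degree t = degree q - degree m"
        unfolding t_def by (rule Polynomial.degree_monom_eq) (use False in simp)
      ultimately have "degree (t * m) = degree q - degree m + degree m"
        using \<open>m \<noteq> 0\<close> by (simp add: degree_mult_eq)
      then show ?thesis
        using \<open>m \<noteq> 0\<close> deg by (simp add: degree_mult_eq)
    qed
    note lc = lc[unfolded deg_tm] deg_tm
    have "poly (map_poly f r) b = 0"
    \<comment> \<open>In degree 0 the degree of the remainder cannot drop; but then
      \<open>m = 1\<close>, which has no root.\<close>
    proof (cases "degree q = 0")
      case True
      then have "degree m = 0" "degree (t * m) = 0"
        using deg lc by auto
      then have "m = 1"
        using m(2) by (metis monom_0 monom_eq_1 degree_0_id)
      then show ?thesis
        using m(3) by simp
    next
      case deg0: False
      have "degree r < degree q"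
      proof -
        have "degree r \<le> degree q" "coeff r (degree q) = 0"
          using lc by (auto simp: r_def intro: degree_diff_le)
        then show ?thesis
          using deg0 by (metis le_neq_implies_less degree_0 leading_coeff_0_iff)
      qed
      then show ?thesis
        using less.hyps r by blast
    qed
    moreover have "map_poly f r = map_poly f q + - (map_poly f t * map_poly f m)"
      unfolding r_def using map_poly_field_hom[OF F f less.prems(1) tm(2)]
        map_poly_field_hom[OF F f tm(1) tm(1)] map_poly_field_hom[OF F f t m(1)] by simp
    ultimately show ?thesis
      using b by simp
  qed
qed

text \<open>The extension is \<open>F[a]\<close>, the set of values at \<open>a\<close> of
  polynomials over \<open>F\<close>, with \<open>q(a)\<close> sent to the value at \<open>b\<close>
  of the image of \<open>q\<close>. Applied to the difference of two representatives,
  \<open>transfer\<close> makes this well defined.\<close>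

lemma field_hom_adjoin:
  fixes F :: "'a::field set"
  assumes F: "subfield_of F" and f: "field_hom_on F f"
    and alg: "\<And>x. \<exists>p. p \<noteq> 0 \<and> (\<forall>i. coeff p i \<in> F) \<and> poly p x = 0"
    and transfer: "\<And>q. \<forall>i. coeff q i \<in> F \<Longrightarrow> poly q a = 0 \<Longrightarrow> poly (map_poly f q) b = 0"
  obtains F' f' where "subfield_of F'" "field_hom_on F' f'" "F \<subseteq> F'" "a \<in> F'" "\<forall>x\<in>F. f' x = f x"
    "f' a = b"
proof -
  note f0 = field_hom_on_0[OF F f]
  define P where "P = {q. \<forall>i. coeff q i \<in> F}"
  note P_ops = coeffs_in_subfield[OF F] and map_ops = map_poly_field_hom[OF F f]
  define F' where "F' = (\<lambda>q. poly q a) ` P"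
  define f' where "f' = (\<lambda>x. poly (map_poly f (SOME q. q \<in> P \<and> poly q a = x)) b)"
  have f': "f' (poly q a) = poly (map_poly f q) b" if "q \<in> P" for q
  proof -
    define q' where "q' = (SOME q'. q' \<in> P \<and> poly q' a = poly q a)"
    have q': "q' \<in> P" "poly q' a = poly q a"
      using someI[of "\<lambda>q'. q' \<in> P \<and> poly q' a = poly q a" q] that by (auto simp: q'_def)
    have "\<forall>i. coeff (- q) i \<in> F"
      using P_ops(3)[of q q] that by (auto simp: P_def)
    then have "poly (map_poly f (q' + - q)) b = 0"
      using q' P_ops(1)[of q' "- q"] by (intro transfer) (auto simp: P_def)
    moreover have "map_poly f (q' + - q) = map_poly f q' - map_poly f q"
      using map_ops(1)[of q' "- q"] map_ops(3)[of q q] q'(1) that \<open>\<forall>i. coeff (- q) i \<in> F\<close>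
      by (simp add: P_def)
    ultimately show ?thesis
      by (simp add: f'_def q'_def)
  qed
  have P: "p + q \<in> P" "p * q \<in> P" "- p \<in> P" if "p \<in> P" "q \<in> P" for p q
    using that P_ops[of p q] by (auto simp: P_def)
  have const: "[:x:] \<in> P" if "x \<in> F" for x
    using that F by (auto simp: P_def subfield_of_def coeff_pCons split: nat.splits)
  have hom: "field_hom_on F' f'"
    unfolding field_hom_on_def F'_def
  proof (intro conjI ballI; (elim imageE)?)
    have "1 \<in> P"
      using F by (auto simp: P_def subfield_of_def)
    then show "f' 1 = 1"
      using f'[of 1] f f0 by (simp add: field_hom_on_def map_poly_1')
  next
    fix x y q r assume q: "q \<in> P" and r: "r \<in> P" and xy: "x = poly q a" "y = poly r a"
    have "f' (poly (q + r) a) = f' (poly q a) + f' (poly r a)"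
      using map_ops(1)[of q r] f'[OF q] f'[OF r] f'[OF P(1)[OF q r]] q r by (simp add: P_def)
    then show "f' (x + y) = f' x + f' y"
      by (simp add: xy)
    have "f' (poly (q * r) a) = f' (poly q a) * f' (poly r a)"
      using map_ops(2)[of q r] f'[OF q] f'[OF r] f'[OF P(2)[OF q r]] q r by (simp add: P_def)
    then show "f' (x * y) = f' x * f' y"
      by (simp add: xy)
  qed
  have sub: "F \<subseteq> F'"
    using const by (force simp: F'_def)
  have X_in: "[:0, 1:] \<in> P"
    using F by (auto simp: P_def subfield_of_def coeff_pCons split: nat.splits)
  then have a: "a \<in> F'"
    by (force simp: F'_def)
  have ring: "x + y \<in> F'" "x * y \<in> F'" if "x \<in> F'" "y \<in> F'" for x y
    using that P unfolding F'_def by (auto simp flip: poly_add poly_mult)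
  have inv: "inverse x \<in> F'" if "x \<in> F'" for x
  proof (cases "x = 0")
    case True
    then show ?thesis using that by simp
  next
    case False
    \<comment> \<open>Inverses are polynomials: if \<open>m = c + X q\<close> is minimal for
      \<open>x\<close>, then \<open>c \<noteq> 0\<close> and \<open>x * q(x) = - c\<close>.\<close>
    obtain m where m: "m \<noteq> 0" "\<forall>i. coeff m i \<in> F" "poly m x = 0"
      "\<And>q. q \<noteq> 0 \<Longrightarrow> \<forall>i. coeff q i \<in> F \<Longrightarrow> poly q x = 0 \<Longrightarrow> degree m \<le> degree q"
      using minimal_polynomial_exists[OF F] alg[of x] by metis
    obtain c q where cq: "m = pCons c q"
      by (cases m) auto
    have cF: "c \<in> F" and qF: "\<forall>i. coeff q i \<in> F"
      using m(2) unfolding cq by (metis coeff_pCons_0, metis coeff_pCons_Suc)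
    have "c \<noteq> 0"
    proof
      assume "c = 0"
      then have "q \<noteq> 0" "poly q x = 0"
        using m(1,3) False by (auto simp: cq)
      then have "degree m \<le> degree q"
        using m(4) qF by blast
      then show False
        using \<open>q \<noteq> 0\<close> by (simp add: cq)
    qed
    have "x * poly q x = - c"
      using m(3) by (simp add: cq eq_neg_iff_add_eq_0 add.commute)
    then have "x * (- inverse c * poly q x) = 1"
      using \<open>c \<noteq> 0\<close> by (simp add: field_simps)
    then have "inverse x = - inverse c * poly q x"
      by (rule inverse_unique)
    moreover have "- inverse c \<in> F'"
      using cF F sub by (auto simp: subfield_of_def)
    moreover have "poly q x \<in> F'"
      using qF
    proof (induction q)
      case 0
      show ?case using F sub by (auto simp: subfield_of_def)
    next
      case (pCons d q)
      then have "d \<in> F" "\<forall>i. coeff q i \<in> F"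
        by (metis coeff_pCons_0, metis coeff_pCons_Suc)
      then show ?case
        using pCons.IH sub that by (auto intro!: ring)
    qed
    ultimately show ?thesis
      by (metis ring(2))
  qed
  have F': "subfield_of F'"
    unfolding subfield_of_def
  proof (intro conjI ballI)
    show "0 \<in> F'" "1 \<in> F'"
      using F sub by (auto simp: subfield_of_def)
    show "- x \<in> F'" if "x \<in> F'" for x
      using that P(3) unfolding F'_def by (auto simp flip: poly_minus)
  qed (use ring inv in auto)
  show ?thesis
  proof (rule that[OF F' hom sub a])
    show "\<forall>x\<in>F. f' x = f x"
    proof
      fix x assume "x \<in> F"
      then show "f' x = f x"
        using f'[OF const] f0 by (simp add: map_poly_pCons)
    qed
    show "f' a = b"
      using f'[OF X_in] f0 f by (simp add: map_poly_pCons field_hom_on_def)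
  qed
qed

text \<open>As image of \<open>a\<close> any root of the image under \<open>f\<close> of its minimal
  polynomial will do; one exists by algebraic closedness.\<close>

lemma field_hom_extend:
  fixes F :: "'a::alg_closed_field set"
  assumes F: "subfield_of F" and f: "field_hom_on F f"
    and alg: "\<And>x. \<exists>p. p \<noteq> 0 \<and> (\<forall>i. coeff p i \<in> F) \<and> poly p x = 0"
  obtains F' f' where "subfield_of F'" "field_hom_on F' f'" "F \<subseteq> F'" "a \<in> F'" "\<forall>x\<in>F. f' x = f x"
proof -
  obtain m where m: "m \<noteq> 0" "\<forall>i. coeff m i \<in> F" "poly m a = 0" "lead_coeff m = 1"
    "\<And>q. q \<noteq> 0 \<Longrightarrow> \<forall>i. coeff q i \<in> F \<Longrightarrow> poly q a = 0 \<Longrightarrow> degree m \<le> degree q"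
    using minimal_polynomial_exists[OF F] alg[of a] by metis
  have "degree m > 0"
  proof (rule ccontr)
    assume "\<not> degree m > 0"
    then have "m = 1"
      using m(4) by (metis monom_0 monom_eq_1 degree_0_id gr0I)
    then show False using m(3) by simp
  qed
  moreover have "degree (map_poly f m) = degree m"
    using m(4) f by (intro map_poly_degree_eq) (auto simp: field_hom_on_def)
  ultimately obtain b where b: "poly (map_poly f m) b = 0"
    using alg_closed_imp_poly_has_root[of "map_poly f m"] by auto
  have transfer: "poly (map_poly f q) b = 0" if "\<forall>i. coeff q i \<in> F" "poly q a = 0" for q
    using root_transfer[OF F f m(2,4,3) _ b that] m(5) by blast
  show ?thesis
  proof (rule field_hom_adjoin[where a = a and b = b, OF F f alg transfer])
    fix F' f'
    assume "subfield_of F'" "field_hom_on F' f'" "F \<subseteq> F'" "a \<in> F'" "\<forall>x\<in>F. f' x = f x"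
    then show ?thesis by (rule that)
  qed
qed

text \<open>Partial homomorphisms are encoded by their graphs, so that extension is inclusion, the
  union of a chain is a set union, and Zorn's lemma applies to sets.\<close>

definition hom_graph :: "('a::field \<times> 'a) set \<Rightarrow> bool" where
  "hom_graph G \<longleftrightarrow> (1, 1) \<in> G \<and> (\<forall>(x, x')\<in>G. (- x, - x') \<in> G \<and> (inverse x, inverse x') \<in> G) \<and>
     (\<forall>(x, x')\<in>G. \<forall>(y, y')\<in>G. (x + y, x' + y') \<in> G \<and> (x * y, x' * y') \<in> G \<and> (x = y \<longrightarrow> x' = y'))"

lemma hom_graphI:
  assumes "(1, 1) \<in> G"
    and "\<And>x x'. (x, x') \<in> G \<Longrightarrow> (- x, - x') \<in> G \<and> (inverse x, inverse x') \<in> G"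
    and "\<And>x x' y y'. (x, x') \<in> G \<Longrightarrow> (y, y') \<in> G \<Longrightarrow>
      (x + y, x' + y') \<in> G \<and> (x * y, x' * y') \<in> G \<and> (x = y \<longrightarrow> x' = y')"
  shows "hom_graph G"
  unfolding hom_graph_def using assms by blast

lemma hom_graph_of_field_hom:
  assumes "subfield_of F" "field_hom_on F f"
  shows "hom_graph ((\<lambda>x. (x, f x)) ` F)"
  using assms field_hom_on_minus[OF assms] field_hom_on_inverse[OF assms]
  unfolding hom_graph_def subfield_of_def field_hom_on_def by (auto intro!: image_eqI)

lemma field_hom_of_hom_graph:
  assumes G: "hom_graph G"
  obtains f where "subfield_of (fst ` G)" "field_hom_on (fst ` G) f" "\<And>x y. (x, y) \<in> G \<Longrightarrow> f x = y"
proof -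
  define f where "f = (\<lambda>x. THE y. (x, y) \<in> G)"
  have f: "f x = y" if "(x, y) \<in> G" for x y
    using that G unfolding f_def hom_graph_def by (intro the_equality) blast+
  have one: "(1, 1) \<in> G" and un: "\<And>x x'. (x, x') \<in> G \<Longrightarrow> (- x, - x') \<in> G \<and> (inverse x, inverse x') \<in> G"
    and bin: "\<And>x x' y y'. (x, x') \<in> G \<Longrightarrow> (y, y') \<in> G \<Longrightarrow> (x + y, x' + y') \<in> G \<and> (x * y, x' * y') \<in> G"
    using G unfolding hom_graph_def by blast+
  have zero: "(0, 0) \<in> G"
    using bin[OF one conjunct1[OF un[OF one]]] by simp
  have "subfield_of (fst ` G)"
    unfolding subfield_of_def
  proof (intro conjI ballI)
    show "0 \<in> fst ` G" "1 \<in> fst ` G"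
      using zero one by force+
  qed (use un bin in force)+
  moreover have "field_hom_on (fst ` G) f"
    unfolding field_hom_on_def
  proof (intro conjI ballI; (elim imageE)?)
    show "f 1 = 1"
      using f one by blast
  next
    fix x y p q assume "p \<in> G" "q \<in> G" "x = fst p" "y = fst q"
    then have "(x, snd p) \<in> G" "(y, snd q) \<in> G"
      by auto
    from bin[OF this] this show "f (x + y) = f x + f y" "f (x * y) = f x * f y"
      using f by metis+
  qed
  ultimately show ?thesis
    using that f by blast
qed

lemma field_hom_extend_UNIV:
  fixes F :: "'a::alg_closed_field set"
  assumes F: "subfield_of F" and f: "field_hom_on F f"
    and alg: "\<And>x. \<exists>p. p \<noteq> 0 \<and> (\<forall>i. coeff p i \<in> F) \<and> poly p x = 0"
  obtains g where "field_hom_on UNIV g" "\<forall>x\<in>F. g x = f x"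
proof -
  let ?A = "{G. hom_graph G \<and> (\<lambda>x. (x, f x)) ` F \<subseteq> G}"
  have "\<exists>M\<in>?A. \<forall>Z\<in>?A. M \<subseteq> Z \<longrightarrow> Z = M"
  proof (rule subset_Zorn_nonempty)
    show "?A \<noteq> {}"
      using hom_graph_of_field_hom[OF F f] by auto
  next
    fix C assume C: "C \<noteq> {}" "subset.chain ?A C"
    have good: "hom_graph G" "(\<lambda>x. (x, f x)) ` F \<subseteq> G" if "G \<in> C" for G
      using C that by (auto simp: subset.chain_def)
    have comparable: "\<exists>G\<in>C. p \<in> G \<and> q \<in> G" if pq: "p \<in> \<Union>C" "q \<in> \<Union>C" for p q
    proof -
      obtain G H where GH: "G \<in> C" "p \<in> G" "H \<in> C" "q \<in> H"
        using pq by blast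
      then have "G \<subseteq> H \<or> H \<subseteq> G"
        using C(2) by (auto simp: subset_chain_def)
      then show ?thesis
        using GH by blast
    qed
    have one: "(1, 1) \<in> \<Union>C"
      using C(1) good unfolding hom_graph_def by blast
    have un: "(- x, - x') \<in> \<Union>C \<and> (inverse x, inverse x') \<in> \<Union>C" if x: "(x, x') \<in> \<Union>C" for x x'
    proof -
      obtain G where G: "G \<in> C" "(x, x') \<in> G"
        using x by blast
      then have "(- x, - x') \<in> G \<and> (inverse x, inverse x') \<in> G"
        using good(1)[OF G(1)] unfolding hom_graph_def by fast
      then show ?thesis
        using G(1) by blast
    qed
    have bin: "(x + y, x' + y') \<in> \<Union>C \<and> (x * y, x' * y') \<in> \<Union>C \<and> (x = y \<longrightarrow> x' = y')"
      if xy: "(x, x') \<in> \<Union>C" "(y, y') \<in> \<Union>C" for x x' y y'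
    proof -
      obtain G where G: "G \<in> C" "(x, x') \<in> G" "(y, y') \<in> G"
        using comparable[OF xy] by blast
      then have "(x + y, x' + y') \<in> G \<and> (x * y, x' * y') \<in> G \<and> (x = y \<longrightarrow> x' = y')"
        using good(1)[OF G(1)] unfolding hom_graph_def by fast
      then show ?thesis
        using G(1) by blast
    qed
    have "hom_graph (\<Union>C)"
      using one un bin by (rule hom_graphI)
    then show "\<Union>C \<in> ?A"
      using C(1) good(2) by blast
  qed
  then obtain M where M_in: "M \<in> ?A" and M_max: "\<forall>Z\<in>?A. M \<subseteq> Z \<longrightarrow> Z = M"
    by (rule bexE)
  have M: "hom_graph M" "(\<lambda>x. (x, f x)) ` F \<subseteq> M"
    using M_in by simp_all
  have max: "Z = M" if "hom_graph Z" "M \<subseteq> Z" for Z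
    using M_max[rule_format, of Z] M(2) that by auto
  obtain g where g: "subfield_of (fst ` M)" "field_hom_on (fst ` M) g" "\<And>x y. (x, y) \<in> M \<Longrightarrow> g x = y"
    using field_hom_of_hom_graph[OF M(1)] by blast
  have FM: "F \<subseteq> fst ` M"
    using M(2) by force
  have "fst ` M = UNIV"
  proof (rule ccontr)
    assume "fst ` M \<noteq> UNIV"
    then obtain a where a: "a \<notin> fst ` M" by blast
    have algM: "\<exists>p. p \<noteq> 0 \<and> (\<forall>i. coeff p i \<in> fst ` M) \<and> poly p x = 0" for x
      using alg FM by blast
    show False
    proof (rule field_hom_extend[where a = a, OF g(1,2) algM])
      fix F' f'
      assume F': "subfield_of F'" "field_hom_on F' f'" "fst ` M \<subseteq> F'" "a \<in> F'" "\<forall>x\<in>fst ` M. f' x = g x"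
      have "M \<subseteq> (\<lambda>x. (x, f' x)) ` F'"
      proof
        fix p assume p: "p \<in> M"
        then have "fst p \<in> F'" "f' (fst p) = snd p"
          using F'(3,5) g(3)[of "fst p" "snd p"] by auto
        then have "p = (fst p, f' (fst p))"
          by (simp add: prod_eq_iff)
        then show "p \<in> (\<lambda>x. (x, f' x)) ` F'"
          using \<open>fst p \<in> F'\<close> by (rule image_eqI)
      qed
      then have "(\<lambda>x. (x, f' x)) ` F' = M"
        using max hom_graph_of_field_hom[OF F'(1,2)] by blast
      then show False
        using a F'(4) by force
    qed
  qed
  moreover have "g x = f x" if "x \<in> F" for x
    using M(2) g(3) that by blast
  ultimately show ?thesis
    using that g(2) by metis
qed

subsection \<open>Automorphisms of the algebraic closure of the rationals\<close>

lemma qbar_algebraic: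
  fixes x :: qbar
  obtains p where "p \<noteq> 0" "\<forall>i. coeff p i \<in> range to_ac" "poly p x = 0"
proof -
  obtain q :: "rat poly" where q: "q \<noteq> 0" "poly (map_poly to_ac q) x = 0"
    using alg_closure_algebraic by blast
  show ?thesis
  proof (rule that)
    show "map_poly to_ac q \<noteq> 0"
      using q(1) by (simp add: map_poly_eq_0_iff)
    show "\<forall>i. coeff (map_poly to_ac q) i \<in> range to_ac"
      by (simp add: coeff_map_poly)
  qed (rule q(2))
qed

lemma subfield_of_rat: "subfield_of (range (to_ac :: rat \<Rightarrow> qbar))"
  unfolding subfield_of_def
proof (intro conjI ballI; (elim rangeE)?)
  show "0 \<in> range (to_ac :: rat \<Rightarrow> qbar)" "1 \<in> range (to_ac :: rat \<Rightarrow> qbar)"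
    by (metis rangeI to_ac_0, metis rangeI to_ac_1)
qed (metis rangeI to_ac_add, metis rangeI to_ac_mult, metis rangeI to_ac_minus, metis rangeI to_ac_inverse)

lemma field_hom_root:
  fixes g :: "'a::field \<Rightarrow> 'a"
  assumes g: "field_hom_on UNIV g" and p: "\<forall>i. g (coeff p i) = coeff p i" "poly p x = 0"
  shows "poly p (g x) = 0"
proof -
  have g0: "g 0 = 0"
    by (rule field_hom_on_0[OF _ g]) (simp add: subfield_of_def)
  have "poly p (g x) = g (poly p x)"
    using p(1)
  proof (induction p)
    case (pCons c p)
    then have "g c = c" "\<forall>i. g (coeff p i) = coeff p i"
      by (metis coeff_pCons_0, metis coeff_pCons_Suc)
    then show ?case
      using pCons.IH g by (simp add: field_hom_on_def)
  qed (simp add: g0)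
  then show ?thesis
    using p(2) g0 by simp
qed

text \<open>Bijectivity is automatic: a field endomorphism over the rationals is injective and maps
  the finite root set of each rational polynomial into itself, hence onto it.\<close>

lemma absolute_galois_iff:
  "\<sigma> \<in> absolute_galois \<longleftrightarrow> field_hom_on UNIV \<sigma> \<and> (\<forall>q. \<sigma> (to_ac q) = to_ac q)"
proof (intro iffI conjI allI)
  assume "\<sigma> \<in> absolute_galois"
  then show "field_hom_on UNIV \<sigma>" "\<sigma> (to_ac q) = to_ac q" for q
    unfolding absolute_galois_def field_hom_on_def by (auto simp flip: to_ac_1)
next
  assume \<sigma>: "field_hom_on UNIV \<sigma> \<and> (\<forall>q. \<sigma> (to_ac q) = to_ac q)"
  have sub: "subfield_of (UNIV :: qbar set)"
    by (simp add: subfield_of_def)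
  have inj: "inj \<sigma>"
  proof (rule injI)
    fix x y assume "\<sigma> x = \<sigma> y"
    then have "\<sigma> (x + - y) = 0"
      using field_hom_on_minus[OF sub conjunct1[OF \<sigma>], of y] \<sigma> by (simp add: field_hom_on_def del: add_uminus_conv_diff)
    moreover have "x + - y = 0" if "\<sigma> (x + - y) = 0"
      using that field_hom_on_inverse[OF sub conjunct1[OF \<sigma>], of "x + - y"] \<sigma>
      unfolding field_hom_on_def by (metis UNIV_I mult_zero_left right_inverse zero_neq_one)
    ultimately show "x = y" by simp
  qed
  have "y \<in> range \<sigma>" for y
  proof -
    obtain p where p: "p \<noteq> 0" "\<forall>i. coeff p i \<in> range to_ac" "poly p y = 0"
      using qbar_algebraic by blast
    let ?R = "{x. poly p x = 0}"
    have "\<sigma> ` ?R \<subseteq> ?R"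
      using field_hom_root[of \<sigma> p] \<sigma> p(2) by auto (metis rangeE)
    then have "\<sigma> ` ?R = ?R"
      using inj by (intro endo_inj_surj poly_roots_finite p(1)) (auto intro: inj_on_subset)
    then show ?thesis
      using p(3) by blast
  qed
  then show "\<sigma> \<in> absolute_galois"
    using inj \<sigma> unfolding absolute_galois_def field_hom_on_def bij_def by auto
qed

text \<open>A rational polynomial takes conjugate values \<open>u + v \<alpha>\<close> and
  \<open>u - v \<alpha>\<close> at \<open>\<alpha>\<close> and \<open>- \<alpha>\<close>. As
  \<open>\<alpha>\<close> is irrational, a zero at \<open>\<alpha>\<close> forces
  \<open>u = v = 0\<close>, so sending \<open>\<alpha>\<close> to \<open>- \<alpha>\<close> is
  consistent and extends to the closure.\<close>

lemma galois_moves_sqrt: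
  fixes \<alpha> :: qbar
  assumes sq: "\<alpha>\<^sup>2 = to_ac q" and irr: "\<alpha> \<notin> range to_ac"
  obtains \<sigma> where "\<sigma> \<in> absolute_galois" "\<sigma> \<alpha> = - \<alpha>"
proof -
  have id: "field_hom_on (range to_ac) (\<lambda>x :: qbar. x)"
    by (simp add: field_hom_on_def)
  have alg: "\<exists>p. p \<noteq> 0 \<and> (\<forall>i. coeff p i \<in> range to_ac) \<and> poly p x = 0" for x :: qbar
    using qbar_algebraic by metis
  have split: "\<exists>u v. poly p \<alpha> = to_ac u + to_ac v * \<alpha> \<and> poly p (- \<alpha>) = to_ac u - to_ac v * \<alpha>"
    if "\<forall>i. coeff p i \<in> range to_ac" for p
    using that
  proof (induction p)
    case 0
    show ?case by (intro exI[of _ 0]) simp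
  next
    case (pCons c p)
    then obtain w where w: "c = to_ac w" and p: "\<forall>i. coeff p i \<in> range to_ac"
      by (metis coeff_pCons_0 coeff_pCons_Suc rangeE)
    obtain u v where uv: "poly p \<alpha> = to_ac u + to_ac v * \<alpha>" "poly p (- \<alpha>) = to_ac u - to_ac v * \<alpha>"
      using pCons.IH p by blast
    then have "poly (pCons c p) \<alpha> = to_ac (w + v * q) + to_ac u * \<alpha>"
      "poly (pCons c p) (- \<alpha>) = to_ac (w + v * q) - to_ac u * \<alpha>"
      using sq[symmetric] by (simp_all add: w uv algebra_simps power2_eq_square)
    then show ?case by blast
  qed
  have "poly (map_poly (\<lambda>x. x) p) (- \<alpha>) = 0" if p: "\<forall>i. coeff p i \<in> range to_ac" "poly p \<alpha> = 0" for p
  proof -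
    obtain u v where uv: "poly p \<alpha> = to_ac u + to_ac v * \<alpha>" "poly p (- \<alpha>) = to_ac u - to_ac v * \<alpha>"
      using split[OF p(1)] by blast
    have "v = 0"
    proof (rule ccontr)
      assume "v \<noteq> 0"
      then have "\<alpha> = to_ac (- u / v)"
        using uv(1) p(2) by (simp add: field_simps eq_neg_iff_add_eq_0)
      then show False using irr by blast
    qed
    then show ?thesis
      using uv p(2) by simp
  qed
  from field_hom_adjoin[OF subfield_of_rat id alg this] obtain F f where
    F: "subfield_of F" "field_hom_on F f" "range to_ac \<subseteq> F" "\<alpha> \<in> F" "\<forall>x\<in>range to_ac. f x = x" "f \<alpha> = - \<alpha>"
    by blast
  have "\<exists>p. p \<noteq> 0 \<and> (\<forall>i. coeff p i \<in> F) \<and> poly p x = 0" for x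
    using alg F(3) by blast
  from field_hom_extend_UNIV[OF F(1,2) this] obtain \<sigma> where
    "field_hom_on UNIV \<sigma>" "\<forall>x\<in>F. \<sigma> x = f x"
    by blast
  moreover from this have "\<sigma> (to_ac q) = to_ac q" for q
    using F(3,5) by (metis rangeI subsetD)
  ultimately show ?thesis
    using F(4,6) that[of \<sigma>] by (simp add: absolute_galois_iff)
qed

subsection \<open>Compactness\<close>

text \<open>Tychonoff: the sequence lives in a product of finite discrete spaces. If every
  \<open>g\<close> had a basic neighbourhood that the sequence eventually avoids, finitely many of
  these would cover the product and leave no place for a late term.\<close>

lemma pointwise_cluster_function:
  fixes f :: "nat \<Rightarrow> 'a \<Rightarrow> 'b"
  assumes fin: "\<And>x. finite (range (\<lambda>n. f n x))"
  obtains g where "\<And>Z m. finite Z \<Longrightarrow> \<exists>n\<ge>m. \<forall>x\<in>Z. f n x = g x"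
proof (rule ccontr)
  assume no: "\<not> thesis"
  define R where "R = (\<lambda>x. range (\<lambda>n. f n x))"
  define T where "T = product_topology (\<lambda>x. discrete_topology (R x)) UNIV"
  have "\<forall>g. \<exists>Z m. finite Z \<and> (\<forall>n\<ge>m. \<exists>x\<in>Z. f n x \<noteq> g x)"
    using no that by metis
  then obtain Z m where Xm: "\<And>g. finite (Z g)" "\<And>g n. n \<ge> m g \<Longrightarrow> \<exists>x\<in>Z g. f n x \<noteq> g x"
    by metis
  define U where "U = (\<lambda>g. Pi\<^sub>E UNIV (\<lambda>x. if x \<in> Z g then {g x} else R x))"
  have top: "topspace T = Pi\<^sub>E UNIV R"
    by (simp add: T_def)
  have op: "openin T (U g)" if "g \<in> Pi\<^sub>E UNIV R" for g
    unfolding T_def U_def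
  proof (rule product_topology_basis)
    show "openin (discrete_topology (R x)) (if x \<in> Z g then {g x} else R x)" for x
      using that by auto
    show "finite {x. (if x \<in> Z g then {g x} else R x) \<noteq> topspace (discrete_topology (R x))}"
      by (rule finite_subset[OF _ Xm(1)[of g]]) auto
  qed
  have "compact_space T"
    unfolding T_def compact_space_product_topology
    using fin by (auto simp: R_def compact_space_discrete_topology)
  moreover have "Pi\<^sub>E UNIV R \<subseteq> \<Union>(U ` Pi\<^sub>E UNIV R)"
    by (force simp: U_def)
  ultimately obtain \<F> where \<F>: "finite \<F>" "\<F> \<subseteq> U ` Pi\<^sub>E UNIV R" "Pi\<^sub>E UNIV R \<subseteq> \<Union>\<F>"
    unfolding compact_space_def compactin_def top using op
    by (elim conjE allE[of _ "U ` Pi\<^sub>E UNIV R"]) auto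
  then obtain H where H: "finite H" "H \<subseteq> Pi\<^sub>E UNIV R" "\<F> = U ` H"
    by (meson finite_subset_image)
  define N where "N = Max (insert 0 (m ` H))"
  have "f N \<in> Pi\<^sub>E UNIV R"
    by (auto simp: R_def)
  then obtain g where g: "g \<in> H" "f N \<in> U g"
    using \<F>(3) H(3) by blast
  have "m g \<le> N"
    using g(1) H(1) by (auto simp: N_def)
  then obtain x where "x \<in> Z g" "f N x \<noteq> g x"
    using Xm(2) by blast
  then show False
    using g(2) by (auto simp: U_def PiE_iff split: if_splits)
qed

text \<open>A cluster point is enough, because each law of a field homomorphism, and each level of
  the Tate module, involves only finitely many elements at a time.\<close>

lemma absolute_galois_cluster:
  fixes \<sigma> :: "nat \<Rightarrow> qbar \<Rightarrow> qbar"
  assumes \<sigma>: "\<And>n. \<sigma> n \<in> absolute_galois"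
  obtains \<tau> where "\<tau> \<in> absolute_galois" "\<And>Z m. finite Z \<Longrightarrow> \<exists>n\<ge>m. \<forall>x\<in>Z. \<sigma> n x = \<tau> x"
proof -
  have hom: "field_hom_on UNIV (\<sigma> n)" "\<sigma> n (to_ac q) = to_ac q" for n q
    using \<sigma> absolute_galois_iff by blast+
  have "finite (range (\<lambda>n. \<sigma> n x))" for x
  proof -
    obtain p where p: "p \<noteq> 0" "\<forall>i. coeff p i \<in> range to_ac" "poly p x = 0"
      using qbar_algebraic by blast
    have "\<sigma> n (coeff p i) = coeff p i" for n i
      using p(2) hom(2) by (metis rangeE)
    then have "poly p (\<sigma> n x) = 0" for n
      using field_hom_root[OF hom(1)] p(3) by blast
    then have "range (\<lambda>n. \<sigma> n x) \<subseteq> {x. poly p x = 0}"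
      by blast
    then show ?thesis
      using poly_roots_finite[OF p(1)] finite_subset by blast
  qed
  from pointwise_cluster_function[of \<sigma>, OF this] obtain \<tau>
    where \<tau>: "\<And>Z m. finite Z \<Longrightarrow> \<exists>n\<ge>m. \<forall>x\<in>Z. \<sigma> n x = \<tau> x"
    by blast
  have "field_hom_on UNIV \<tau>"
    unfolding field_hom_on_def
  proof (intro conjI ballI)
    show "\<tau> 1 = 1"
      using \<tau>[of "{1}" 0] hom(1) by (auto simp: field_hom_on_def)
    fix x y
    show "\<tau> (x + y) = \<tau> x + \<tau> y"
      using \<tau>[of "{x, y, x + y}" 0] hom(1) by (auto simp: field_hom_on_def)
    show "\<tau> (x * y) = \<tau> x * \<tau> y"
      using \<tau>[of "{x, y, x * y}" 0] hom(1) by (auto simp: field_hom_on_def)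
  qed
  moreover have "\<tau> (to_ac q) = to_ac q" for q
    using \<tau>[of "{to_ac q}" 0] hom(2) by auto
  ultimately show ?thesis
    using that \<tau> by (auto simp: absolute_galois_iff)
qed

section \<open>Two-adic Tate modules of commutative groups\<close>

lemma z2_residue_simps [simp]:
  "z2_residue (a + b) n = (z2_residue a n + z2_residue b n) mod 2 ^ n"
  "z2_residue (a * b) n = (z2_residue a n * z2_residue b n) mod 2 ^ n"
  "z2_residue (a - b) n = (z2_residue a n - z2_residue b n) mod 2 ^ n"
  "z2_residue (- a) n = (- z2_residue a n) mod 2 ^ n"
  "z2_residue 0 n = 0"
  "z2_residue 1 n = 1 mod 2 ^ n"
  by (simp_all add: plus_z2.rep_eq times_z2.rep_eq minus_z2.rep_eq uminus_z2.rep_eq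
      zero_z2.rep_eq one_z2.rep_eq)

lemma z2_residue_range: "0 \<le> z2_residue a n" "z2_residue a n < 2 ^ n"
  using z2_residue[of a] by auto

lemma z2_residue_Suc_mod: "z2_residue a (Suc n) mod 2 ^ n = z2_residue a n"
  using z2_residue[of a] by auto

lemma z2_eqI: "(\<And>n. z2_residue a n = z2_residue b n) \<Longrightarrow> a = b"
  by (metis ext z2_residue_inject)

lemma z2_of_sequence:
  assumes "\<And>n. f n mod 2 ^ n = f (Suc n) mod 2 ^ n"
  obtains a where "\<And>n. z2_residue a n = f n mod 2 ^ n"
proof -
  have "(\<lambda>n. f n mod 2 ^ n) \<in> {f. \<forall>n. f n \<in> {0..<2 ^ n} \<and> f (Suc n) mod 2 ^ n = f n}"
  proof -
    have "f (Suc n) mod 2 ^ Suc n mod 2 ^ n = f n mod 2 ^ n" for n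
      using assms[of n] by (simp add: mod_mod_cancel)
    then show ?thesis by simp
  qed
  from Abs_z2_inverse[OF this] show ?thesis
    by (intro that[of "Abs_z2 (\<lambda>n. f n mod 2 ^ n)"]) simp
qed

lemma mat2_mult_component:
  fixes A B :: "z2^2^2"
  shows "(A ** B) $ i $ j = A $ i $ 1 * B $ 1 $ j + A $ i $ 2 * B $ 2 $ j"
  by (simp add: matrix_matrix_mult_def sum_2)

lemma mat2_eqI:
  fixes A B :: "z2^2^2"
  assumes "A $ 1 $ 1 = B $ 1 $ 1" "A $ 1 $ 2 = B $ 1 $ 2" "A $ 2 $ 1 = B $ 2 $ 1" "A $ 2 $ 2 = B $ 2 $ 2"
  shows "A = B"
  using assms by (simp add: vec_eq_iff forall_2)

context comm_group
begin

text \<open>The Tate module notions for an arbitrary commutative group, which keeps the linear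
  algebra free of curve equations. They repeat the shape of the definitions for curves, natural
  exponents included, so that the instances agree by unfolding.\<close>

definition gtate :: "(nat \<Rightarrow> 'a) set" where
  "gtate = {t. \<forall>n. t n \<in> carrier G \<and> t n [^] (2 ^ n :: nat) = \<one> \<and> t (Suc n) [^] (2 :: nat) = t n}"

definition gcomb :: "(nat \<Rightarrow> 'a) \<Rightarrow> (nat \<Rightarrow> 'a) \<Rightarrow> z2 \<Rightarrow> z2 \<Rightarrow> nat \<Rightarrow> 'a" where
  "gcomb e1 e2 a b = (\<lambda>n. e1 n [^] nat (z2_residue a n) \<otimes> e2 n [^] nat (z2_residue b n))"

definition gbasis :: "(nat \<Rightarrow> 'a) \<Rightarrow> (nat \<Rightarrow> 'a) \<Rightarrow> bool" where
  "gbasis e1 e2 \<longleftrightarrow> e1 \<in> gtate \<and> e2 \<in> gtate \<and> (\<forall>t\<in>gtate. \<exists>!(a, b). t = gcomb e1 e2 a b)"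

definition gmatrix :: "(nat \<Rightarrow> 'a) \<Rightarrow> (nat \<Rightarrow> 'a) \<Rightarrow> ('a \<Rightarrow> 'a) \<Rightarrow> z2^2^2 \<Rightarrow> bool" where
  "gmatrix e1 e2 s M \<longleftrightarrow>
     (\<lambda>n. s (e1 n)) = gcomb e1 e2 (M $ 1 $ 1) (M $ 2 $ 1) \<and>
     (\<lambda>n. s (e2 n)) = gcomb e1 e2 (M $ 1 $ 2) (M $ 2 $ 2)"

lemma gtateD:
  assumes "t \<in> gtate"
  shows "t n \<in> carrier G" "t n [^] (2 ^ n :: int) = \<one>" "t (Suc n) [^] (2 :: int) = t n"
  using assms int_pow_int[of G _ "2 ^ n"] int_pow_int[of G _ 2] by (auto simp: gtate_def)

lemma int_pow_cong:
  assumes "x \<in> carrier G" "x [^] (m :: int) = \<one>" "i mod m = j mod m"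
  shows "x [^] i = x [^] j"
proof -
  have "x [^] k = x [^] (k mod m)" for k
  proof -
    have "x [^] k = x [^] (m * (k div m) + k mod m)"
      by simp
    also have "\<dots> = (x [^] m) [^] (k div m) \<otimes> x [^] (k mod m)"
      using assms(1) by (simp only: int_pow_mult int_pow_pow)
    finally show ?thesis
      using assms(1,2) by simp
  qed
  then show ?thesis
    using assms(3) by metis
qed

lemma gtate_pow_cong:
  assumes "t \<in> gtate" "i mod 2 ^ n = j mod 2 ^ n"
  shows "t n [^] (i :: int) = t n [^] j"
  using int_pow_cong gtateD[OF assms(1)] assms(2) by blast

lemma gcomb_int:
  "gcomb e1 e2 a b n = e1 n [^] z2_residue a n \<otimes> e2 n [^] z2_residue b n"
  using z2_residue_range by (simp add: gcomb_def flip: int_pow_int)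

lemma gcomb_mult:
  assumes "e1 \<in> gtate" "e2 \<in> gtate"
  shows "gcomb e1 e2 a b n \<otimes> gcomb e1 e2 c d n = gcomb e1 e2 (a + c) (b + d) n"
proof -
  have "gcomb e1 e2 (a + c) (b + d) n =
      e1 n [^] (z2_residue a n + z2_residue c n) \<otimes> e2 n [^] (z2_residue b n + z2_residue d n)"
    unfolding gcomb_int
    using gtate_pow_cong[OF assms(1), of "z2_residue (a + c) n" n "z2_residue a n + z2_residue c n"]
      gtate_pow_cong[OF assms(2), of "z2_residue (b + d) n" n "z2_residue b n + z2_residue d n"]
    by simp
  also have "\<dots> = (e1 n [^] z2_residue a n \<otimes> e1 n [^] z2_residue c n) \<otimes>
      (e2 n [^] z2_residue b n \<otimes> e2 n [^] z2_residue d n)"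
    using gtateD(1)[OF assms(1)] gtateD(1)[OF assms(2)] by (simp only: int_pow_mult)
  also have "\<dots> = gcomb e1 e2 a b n \<otimes> gcomb e1 e2 c d n"
    unfolding gcomb_int using gtateD(1)[OF assms(1)] gtateD(1)[OF assms(2)] by (simp add: m_ac)
  finally show ?thesis ..
qed

lemma gcomb_pow:
  assumes "e1 \<in> gtate" "e2 \<in> gtate"
  shows "gcomb e1 e2 a b n [^] z2_residue c n = gcomb e1 e2 (a * c) (b * c) n"
proof -
  have "gcomb e1 e2 (a * c) (b * c) n =
      e1 n [^] (z2_residue a n * z2_residue c n) \<otimes> e2 n [^] (z2_residue b n * z2_residue c n)"
    unfolding gcomb_int
    using gtate_pow_cong[OF assms(1), of "z2_residue (a * c) n" n "z2_residue a n * z2_residue c n"]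
      gtate_pow_cong[OF assms(2), of "z2_residue (b * c) n" n "z2_residue b n * z2_residue c n"]
    by simp
  also have "\<dots> = (e1 n [^] z2_residue a n) [^] z2_residue c n \<otimes> (e2 n [^] z2_residue b n) [^] z2_residue c n"
    using gtateD(1)[OF assms(1)] gtateD(1)[OF assms(2)] by (simp only: int_pow_pow)
  also have "\<dots> = gcomb e1 e2 a b n [^] z2_residue c n"
    unfolding gcomb_int using gtateD(1)[OF assms(1)] gtateD(1)[OF assms(2)]
    by (simp add: int_pow_distrib)
  finally show ?thesis ..
qed

lemma gcomb_gcomb:
  assumes "e1 \<in> gtate" "e2 \<in> gtate"
  shows "gcomb (gcomb e1 e2 a b) (gcomb e1 e2 c d) x y = gcomb e1 e2 (a * x + c * y) (b * x + d * y)"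
proof
  fix n
  show "gcomb (gcomb e1 e2 a b) (gcomb e1 e2 c d) x y n = gcomb e1 e2 (a * x + c * y) (b * x + d * y) n"
    using gcomb_pow[OF assms] gcomb_mult[OF assms] by (simp add: gcomb_int[of "gcomb e1 e2 a b"])
qed

lemma gcomb_unit:
  assumes "e1 \<in> gtate" "e2 \<in> gtate"
  shows "gcomb e1 e2 1 0 = e1" "gcomb e1 e2 0 1 = e2"
proof -
  have "t n [^] z2_residue 1 n = t n [^] (1 :: int)" if "t \<in> gtate" for t n
    using gtate_pow_cong[OF that] by simp
  then show "gcomb e1 e2 1 0 = e1" "gcomb e1 e2 0 1 = e2"
    using assms gtateD(1) by (auto simp: gcomb_int fun_eq_iff)
qed

lemma gcomb_in_gtate:
  assumes "e1 \<in> gtate" "e2 \<in> gtate"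
  shows "gcomb e1 e2 a b \<in> gtate"
proof -
  note c = gtateD(1)[OF assms(1)] gtateD(1)[OF assms(2)]
  have "t n [^] (2 ^ n * k :: int) = \<one>" if "t \<in> gtate" for t n k
    using gtateD(1,2)[OF that] int_pow_pow[of "t n" "2 ^ n" k] by (metis int_pow_one)
  then have "gcomb e1 e2 a b n [^] (2 ^ n :: int) = \<one>" for n
    using c assms by (simp add: gcomb_int int_pow_distrib int_pow_pow mult.commute[of _ "2 ^ n"])
  moreover have "gcomb e1 e2 a b (Suc n) [^] (2 :: int) = gcomb e1 e2 a b n" for n
  proof -
    have "gcomb e1 e2 a b (Suc n) [^] (2 :: int) =
        (e1 (Suc n) [^] (2::int)) [^] z2_residue a (Suc n) \<otimes> (e2 (Suc n) [^] (2::int)) [^] z2_residue b (Suc n)"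
      using c by (simp add: gcomb_int int_pow_distrib int_pow_pow mult.commute)
    then show ?thesis
      using gtateD(3)[OF assms(1)] gtateD(3)[OF assms(2)]
        gtate_pow_cong[OF assms(1), of "z2_residue a (Suc n)" n "z2_residue a n"]
        gtate_pow_cong[OF assms(2), of "z2_residue b (Suc n)" n "z2_residue b n"]
      by (simp add: gcomb_int z2_residue_Suc_mod)
  qed
  ultimately show ?thesis
    using c int_pow_int[of G _ "2 ^ n" for n] int_pow_int[of G _ 2]
    by (auto simp: gtate_def gcomb_int)
qed

lemma gbasis_unique:
  assumes "gbasis e1 e2" "gcomb e1 e2 a b = gcomb e1 e2 c d"
  shows "a = c" "b = d"
proof -
  have "gcomb e1 e2 a b \<in> gtate"
    using assms(1) gcomb_in_gtate by (simp add: gbasis_def)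
  then have "\<exists>!(x, y). gcomb e1 e2 a b = gcomb e1 e2 x y"
    using assms(1) unfolding gbasis_def by blast
  then obtain p where "\<And>q. (case q of (x, y) \<Rightarrow> gcomb e1 e2 a b = gcomb e1 e2 x y) \<Longrightarrow> q = p"
    by (rule ex1E) blast
  from this[of "(a, b)"] this[of "(c, d)"] have "(a, b) = (c, d)"
    using assms(2) by simp
  then show "a = c" "b = d" by auto
qed

lemma gbasis_obtain:
  assumes "gbasis e1 e2" "t \<in> gtate"
  obtains a b where "t = gcomb e1 e2 a b"
  using assms unfolding gbasis_def by blast

lemma hom_gtate:
  assumes "s \<in> hom G G" "t \<in> gtate"
  shows "(\<lambda>n. s (t n)) \<in> gtate"
proof -
  have "s \<one> = \<one>"
    using hom_one[OF assms(1)] is_group by blast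
  moreover have "s (x [^] (k :: nat)) = s x [^] k" if "x \<in> carrier G" for x k
    using hom_nat_pow[OF assms(1) that] is_group by blast
  ultimately show ?thesis
    using assms hom_in_carrier[OF assms(1)] unfolding gtate_def by (auto, metis+)
qed

lemma hom_gcomb:
  assumes "s \<in> hom G G" "e1 \<in> gtate" "e2 \<in> gtate"
  shows "(\<lambda>n. s (gcomb e1 e2 a b n)) = gcomb (\<lambda>n. s (e1 n)) (\<lambda>n. s (e2 n)) a b"
proof
  fix n
  have "s (x [^] (k :: int)) = s x [^] k" if "x \<in> carrier G" for x k
    using hom_int_pow[OF assms(1) that] is_group by blast
  then show "s (gcomb e1 e2 a b n) = gcomb (\<lambda>n. s (e1 n)) (\<lambda>n. s (e2 n)) a b n"
    using gtateD(1)[OF assms(2)] gtateD(1)[OF assms(3)] assms(1)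
    by (simp add: gcomb_int hom_mult)
qed

lemma gmatrix_exists:
  assumes "gbasis e1 e2" "s \<in> hom G G"
  obtains M where "gmatrix e1 e2 s M"
proof -
  have e: "e1 \<in> gtate" "e2 \<in> gtate"
    using assms(1) by (auto simp: gbasis_def)
  obtain a b where 1: "(\<lambda>n. s (e1 n)) = gcomb e1 e2 a b"
    using gbasis_obtain[OF assms(1) hom_gtate[OF assms(2) e(1)]] .
  obtain c d where 2: "(\<lambda>n. s (e2 n)) = gcomb e1 e2 c d"
    using gbasis_obtain[OF assms(1) hom_gtate[OF assms(2) e(2)]] .
  show ?thesis
    by (rule that[of "mat2 a c b d"]) (use 1 2 in \<open>simp add: gmatrix_def mat2_def\<close>)
qed

lemma gmatrix_unique:
  assumes "gbasis e1 e2" "gmatrix e1 e2 s M" "gmatrix e1 e2 s N"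
  shows "M = N"
  using assms gbasis_unique[OF assms(1)] unfolding gmatrix_def by (intro mat2_eqI) metis+

lemma gmatrix_comp:
  assumes "gbasis e1 e2" "s \<in> hom G G" "gmatrix e1 e2 s M" "gmatrix e1 e2 s' M'"
  shows "gmatrix e1 e2 (\<lambda>x. s (s' x)) (M ** M')"
proof -
  have e: "e1 \<in> gtate" "e2 \<in> gtate"
    using assms(1) by (auto simp: gbasis_def)
  have "s (s' (e1 n)) = gcomb e1 e2 ((M ** M') $ 1 $ 1) ((M ** M') $ 2 $ 1) n"
    "s (s' (e2 n)) = gcomb e1 e2 ((M ** M') $ 1 $ 2) ((M ** M') $ 2 $ 2) n" for n
  proof -
    have "s' (e1 n) = gcomb e1 e2 (M' $ 1 $ 1) (M' $ 2 $ 1) n" "s' (e2 n) = gcomb e1 e2 (M' $ 1 $ 2) (M' $ 2 $ 2) n"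
      using assms(4) unfolding gmatrix_def by metis+
    then show "s (s' (e1 n)) = gcomb e1 e2 ((M ** M') $ 1 $ 1) ((M ** M') $ 2 $ 1) n"
      "s (s' (e2 n)) = gcomb e1 e2 ((M ** M') $ 1 $ 2) ((M ** M') $ 2 $ 2) n"
      using fun_cong[OF hom_gcomb[OF assms(2) e], of _ _ n] assms(3) gcomb_gcomb[OF e]
      unfolding gmatrix_def mat2_mult_component by simp_all
  qed
  then show ?thesis
    by (simp add: gmatrix_def)
qed

lemma gmatrix_id:
  assumes "gbasis e1 e2"
  shows "gmatrix e1 e2 (\<lambda>x. x) (mat 1)"
  using assms gcomb_unit[of e1 e2] by (simp add: gmatrix_def mat_def gbasis_def)

text \<open>The columns of \<open>P\<close> are the coordinates of \<open>f1\<close>,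
  \<open>f2\<close> in the basis \<open>e1\<close>, \<open>e2\<close>; expanding the image of a
  basis vector in two ways gives \<open>M P = P N\<close>.\<close>

lemma gbasis_change:
  assumes e: "gbasis e1 e2" and f: "gbasis f1 f2"
  obtains P where "invertible P"
    "\<And>s M N. s \<in> hom G G \<Longrightarrow> gmatrix e1 e2 s M \<Longrightarrow> gmatrix f1 f2 s N \<Longrightarrow> M ** P = P ** N"
proof -
  have et: "e1 \<in> gtate" "e2 \<in> gtate" and ft: "f1 \<in> gtate" "f2 \<in> gtate"
    using e f by (auto simp: gbasis_def)
  have coord: "\<exists>P :: z2^2^2. h1 = gcomb k1 k2 (P $ 1 $ 1) (P $ 2 $ 1) \<and> h2 = gcomb k1 k2 (P $ 1 $ 2) (P $ 2 $ 2)"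
    if k: "gbasis k1 k2" and h: "h1 \<in> gtate" "h2 \<in> gtate" for k1 k2 h1 h2
  proof -
    obtain a b where 1: "h1 = gcomb k1 k2 a b"
      using gbasis_obtain[OF k h(1)] .
    obtain c d where 2: "h2 = gcomb k1 k2 c d"
      using gbasis_obtain[OF k h(2)] .
    show ?thesis
      by (rule exI[of _ "mat2 a c b d"]) (use 1 2 in \<open>simp add: mat2_def\<close>)
  qed
  obtain P :: "z2^2^2" where P: "f1 = gcomb e1 e2 (P $ 1 $ 1) (P $ 2 $ 1)" "f2 = gcomb e1 e2 (P $ 1 $ 2) (P $ 2 $ 2)"
    using coord[OF e ft] by blast
  obtain Q :: "z2^2^2" where Q: "e1 = gcomb f1 f2 (Q $ 1 $ 1) (Q $ 2 $ 1)" "e2 = gcomb f1 f2 (Q $ 1 $ 2) (Q $ 2 $ 2)"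
    using coord[OF f et] by blast
  have inv: "A ** B = mat 1"
    if k: "gbasis k1 k2" and "h1 = gcomb k1 k2 (A $ 1 $ 1) (A $ 2 $ 1)" "h2 = gcomb k1 k2 (A $ 1 $ 2) (A $ 2 $ 2)"
      "k1 = gcomb h1 h2 (B $ 1 $ 1) (B $ 2 $ 1)" "k2 = gcomb h1 h2 (B $ 1 $ 2) (B $ 2 $ 2)"
    for h1 h2 k1 k2 and A B :: "z2^2^2"
  proof -
    have kt: "k1 \<in> gtate" "k2 \<in> gtate"
      using k by (auto simp: gbasis_def)
    have "gcomb k1 k2 ((A ** B) $ 1 $ 1) ((A ** B) $ 2 $ 1) = gcomb k1 k2 1 0"
      "gcomb k1 k2 ((A ** B) $ 1 $ 2) ((A ** B) $ 2 $ 2) = gcomb k1 k2 0 1"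
      unfolding gcomb_unit[OF kt] mat2_mult_component gcomb_gcomb[OF kt, symmetric]
      using that by metis+
    then show ?thesis
      using gbasis_unique[OF k] by (intro mat2_eqI) (auto simp: mat_def)
  qed
  have "P ** Q = mat 1" "Q ** P = mat 1"
    using inv[OF e P Q] inv[OF f Q P] by auto
  then have "invertible P"
    unfolding invertible_def by blast
  moreover have "M ** P = P ** N"
    if s: "s \<in> hom G G" and M: "gmatrix e1 e2 s M" and N: "gmatrix f1 f2 s N" for s M N
  proof -
    have "gcomb e1 e2 ((M ** P) $ 1 $ j) ((M ** P) $ 2 $ j) =
        (\<lambda>n. s (gcomb e1 e2 (P $ 1 $ j) (P $ 2 $ j) n))" for j
      using M unfolding hom_gcomb[OF s et] gmatrix_def mat2_mult_component
      by (simp add: gcomb_gcomb[OF et])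
    moreover have "gcomb e1 e2 ((P ** N) $ 1 $ j) ((P ** N) $ 2 $ j) =
        gcomb f1 f2 (N $ 1 $ j) (N $ 2 $ j)" for j
      unfolding mat2_mult_component gcomb_gcomb[OF et, symmetric] P[symmetric] ..
    ultimately have
      "gcomb e1 e2 ((M ** P) $ 1 $ 1) ((M ** P) $ 2 $ 1) = gcomb e1 e2 ((P ** N) $ 1 $ 1) ((P ** N) $ 2 $ 1)"
      "gcomb e1 e2 ((M ** P) $ 1 $ 2) ((M ** P) $ 2 $ 2) = gcomb e1 e2 ((P ** N) $ 1 $ 2) ((P ** N) $ 2 $ 2)"
      using N P unfolding gmatrix_def by metis+
    then show ?thesis
      using gbasis_unique[OF e] by (intro mat2_eqI) blast+
  qed
  ultimately show ?thesis
    by (rule that)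
qed

end

section \<open>Groups with multiplication by \<open>\<surd>-2\<close>\<close>

text \<open>Additively, \<open>\<phi>\<close> is multiplication by \<open>w\<close> with
  \<open>w^2 = -2\<close>. Surjectivity and a kernel of order 2 are what make the Tate module free
  of rank one over \<open>Z_2[w]\<close>.\<close>

locale cm_module = comm_group G for G (structure) +
  fixes \<phi> :: "'a \<Rightarrow> 'a" and T :: 'a
  assumes \<phi>_hom: "\<phi> \<in> hom G G"
    and \<phi>_surj: "\<And>x. x \<in> carrier G \<Longrightarrow> \<exists>y\<in>carrier G. \<phi> y = x"
    and T: "T \<in> carrier G" "T \<noteq> \<one>"
    and \<phi>_kernel: "\<And>x. x \<in> carrier G \<Longrightarrow> \<phi> x = \<one> \<longleftrightarrow> x = \<one> \<or> x = T"
    and \<phi>_\<phi>: "\<And>x. x \<in> carrier G \<Longrightarrow> \<phi> (\<phi> x) = x [^] (- 2 :: int)"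
begin

lemma \<phi>_closed [simp]: "x \<in> carrier G \<Longrightarrow> \<phi> x \<in> carrier G"
  using \<phi>_hom by (rule hom_in_carrier)

lemma \<phi>_mult: "x \<in> carrier G \<Longrightarrow> y \<in> carrier G \<Longrightarrow> \<phi> (x \<otimes> y) = \<phi> x \<otimes> \<phi> y"
  using \<phi>_hom by (rule hom_mult)

lemma \<phi>_one [simp]: "\<phi> \<one> = \<one>"
  using hom_one[OF \<phi>_hom] is_group by blast

lemma \<phi>_int_pow: "x \<in> carrier G \<Longrightarrow> \<phi> (x [^] (k :: int)) = \<phi> x [^] k"
  using hom_int_pow[OF \<phi>_hom] is_group by blast

lemma \<phi>_T [simp]: "\<phi> T = \<one>"
  using \<phi>_kernel T by blast

lemma T_square: "T [^] (2 :: int) = \<one>"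
proof -
  have "T [^] (- 2 :: int) = \<one>"
    using \<phi>_\<phi>[OF T(1)] by simp
  then have "inv (T [^] (- 2 :: int)) = \<one>"
    by simp
  then show ?thesis
    using T(1) by (simp flip: int_pow_neg)
qed

text \<open>In additive notation this is multiplication by \<open>a + b w\<close>.\<close>

definition act :: "int \<Rightarrow> int \<Rightarrow> 'a \<Rightarrow> 'a" where
  "act a b x = x [^] a \<otimes> \<phi> x [^] b"

lemma act_closed [simp]: "x \<in> carrier G \<Longrightarrow> act a b x \<in> carrier G"
  by (simp add: act_def)

lemma \<phi>_act: "x \<in> carrier G \<Longrightarrow> \<phi> (act a b x) = act a b (\<phi> x)"
  by (simp add: act_def \<phi>_mult \<phi>_int_pow)

lemma act_act:
  assumes x: "x \<in> carrier G"
  shows "act a b (act c d x) = act (a * c - 2 * b * d) (a * d + b * c) x"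
proof -
  have "act a b (act c d x) =
      (x [^] (c * a) \<otimes> \<phi> x [^] (d * a)) \<otimes> (\<phi> x [^] (c * b) \<otimes> x [^] ((- 2) * d * b))"
    using x by (simp add: act_def \<phi>_mult \<phi>_int_pow int_pow_distrib int_pow_pow \<phi>_\<phi>)
  also have "\<dots> = (x [^] (c * a) \<otimes> x [^] ((- 2) * d * b)) \<otimes> (\<phi> x [^] (d * a) \<otimes> \<phi> x [^] (c * b))"
    using x by (simp add: m_ac)
  also have "\<dots> = x [^] (c * a + (- 2) * d * b) \<otimes> \<phi> x [^] (d * a + c * b)"
    using x by (simp only: int_pow_mult \<phi>_closed)
  finally show ?thesis
    by (simp add: act_def algebra_simps)
qed

text \<open>Since \<open>T\<close> spans the kernel of \<open>\<phi>\<close>, the condition on \<open>Q 1\<close> says that \<open>Q\<close> is not divisible by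
  \<open>\<phi>\<close>, which makes it a generator of the Tate module over \<open>\<int>\<^sub>2[\<surd>-2]\<close>.\<close>

definition cyclic_generator :: "(nat \<Rightarrow> 'a) \<Rightarrow> bool" where
  "cyclic_generator Q \<longleftrightarrow> Q \<in> gtate \<and> \<phi> (Q 1) = T"

lemma cyclic_generator_exists:
  obtains Q where "cyclic_generator Q"
proof -
  obtain q where q: "q \<in> carrier G" "\<phi> q = T"
    using \<phi>_surj T(1) by blast
  \<comment> \<open>Divisibility by 2 comes from applying surjectivity of \<open>\<phi>\<close>
    twice to the inverse of \<open>x\<close>.\<close>
  have "\<exists>y\<in>carrier G. y [^] (2 :: nat) = x" if x: "x \<in> carrier G" for x
  proof -
    obtain y where "y \<in> carrier G" "\<phi> (\<phi> y) = inv x"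
      using \<phi>_surj inv_closed[OF x] by metis
    then have "y \<in> carrier G" "inv (y [^] (2 :: int)) = inv x"
      using \<phi>_\<phi> by (auto simp flip: int_pow_neg)
    then have "y [^] (2 :: int) = x"
      using x by (metis int_pow_closed inv_inv)
    then show ?thesis
      using \<open>y \<in> carrier G\<close> int_pow_int[of G y 2] by auto
  qed
  then obtain h where h: "\<And>x. x \<in> carrier G \<Longrightarrow> h x \<in> carrier G \<and> h x [^] (2 :: nat) = x"
    by metis
  \<comment> \<open>Halving starts only after level 1: halving the neutral element could return the
    neutral element, whereas \<open>Q 1\<close> must be \<open>q\<close>.\<close>
  define Q where "Q = rec_nat \<one> (\<lambda>n x. if n = 0 then q else h x)"
  have Q_simps: "Q 0 = \<one>" "Q (Suc n) = (if n = 0 then q else h (Q n))" for n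
    by (simp_all add: Q_def)
  have c: "Q n \<in> carrier G" for n
    by (induction n) (use q h in \<open>auto simp: Q_simps\<close>)
  have "q [^] (- 2 :: int) = \<one>"
    using \<phi>_\<phi>[OF q(1)] q(2) by simp
  then have "inv (q [^] (- 2 :: int)) = \<one>"
    by simp
  then have "q [^] (2 :: int) = \<one>"
    using q(1) by (simp flip: int_pow_neg)
  then have "q [^] (2 :: nat) = \<one>"
    using int_pow_int[of G q 2] by simp
  then have sq: "Q (Suc n) [^] (2 :: nat) = Q n" for n
    using c h q(1) by (cases n) (auto simp: Q_simps)
  have "Q n [^] (2 ^ n :: nat) = \<one>" for n
  proof (induction n)
    case (Suc n)
    have "Q (Suc n) [^] (2 ^ Suc n :: nat) = (Q (Suc n) [^] (2 :: nat)) [^] (2 ^ n :: nat)"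
      using c by (simp add: nat_pow_pow)
    then show ?case
      using sq Suc by simp
  qed (simp add: Q_simps)
  then have "cyclic_generator Q"
    using c sq q(2) by (simp add: cyclic_generator_def gtate_def Q_simps)
  then show ?thesis
    by (rule that)
qed

lemma act_double:
  assumes Q: "Q \<in> gtate"
  shows "act a b (Q (Suc n)) [^] (2 :: int) = act a b (Q n)"
proof -
  note c = gtateD(1)[OF Q]
  have "act a b (Q (Suc n)) [^] (2 :: int) = act a b (Q (Suc n) [^] (2 :: int))"
    using c by (simp add: act_def int_pow_distrib int_pow_pow \<phi>_int_pow mult.commute)
  then show ?thesis
    using gtateD(3)[OF Q] by simp
qed

lemma act_add:
  assumes "x \<in> carrier G"
  shows "act (a + c) (b + d) x = act a b x \<otimes> act c d x"
  using assms by (simp add: act_def int_pow_mult m_ac)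

lemma act_pow2_times:
  assumes Q: "Q \<in> gtate"
  shows "act (2 ^ n * a) (2 ^ n * b) (Q (Suc n)) = act a b (Q 1)"
proof -
  have "Q (n + k) [^] (2 ^ n :: int) = Q k" for k
  proof (induction n arbitrary: k)
    case (Suc n)
    have "Q (Suc n + k) [^] (2 ^ Suc n :: int) = (Q (Suc (n + k)) [^] (2 :: int)) [^] (2 ^ n :: int)"
      using gtateD(1)[OF Q] by (simp add: int_pow_pow)
    then show ?case
      using Suc gtateD(3)[OF Q] by simp
  qed (use gtateD(1)[OF Q] in simp)
  from this[of 1] have "Q (Suc n) [^] (2 ^ n :: int) = Q 1" by simp
  moreover have "act (2 ^ n * a) (2 ^ n * b) (Q (Suc n)) = act a b (Q (Suc n) [^] (2 ^ n :: int))"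
    using gtateD(1)[OF Q] by (simp add: act_def int_pow_pow \<phi>_int_pow)
  ultimately show ?thesis by simp
qed

text \<open>Doubling passes from level \<open>n + 1\<close> to level \<open>n\<close>, where
  induction makes both coefficients divisible by \<open>2^n\<close>; dividing this out leaves level
  1. There \<open>\<phi>\<close> removes the \<open>b\<close> part and shows \<open>a\<close> even,
  after which \<open>T [^] b\<close> remains.\<close>

lemma act_eq_one_iff:
  assumes Q: "cyclic_generator Q"
  shows "act a b (Q n) = \<one> \<longleftrightarrow> 2 ^ n dvd a \<and> 2 ^ n dvd b"
proof
  have Qt: "Q \<in> gtate" and QT: "\<phi> (Q 1) = T"
    using Q by (auto simp: cyclic_generator_def)
  note c = gtateD(1)[OF Qt]
  have T1: "T [^] k = \<one> \<longleftrightarrow> 2 dvd k" for k :: int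
  proof -
    have "T [^] k = T [^] (k mod 2)"
      by (rule int_pow_cong[OF T(1) T_square]) simp
    then show ?thesis
      using T by (cases "even k") (auto simp: even_iff_mod_2_eq_zero odd_iff_mod_2_eq_one)
  qed
  have base: "2 dvd a \<and> 2 dvd b" if ab: "act a b (Q 1) = \<one>" for a b
  proof -
    have "\<phi> (act a b (Q 1)) = T [^] a \<otimes> \<one>"
      using c QT by (simp add: \<phi>_act) (simp add: act_def)
    then have "T [^] a = \<one>"
      using ab T(1) by simp
    then have a: "2 dvd a"
      using T1 by blast
    have "Q 1 [^] a = \<one>"
      using gtate_pow_cong[OF Qt, of a 1 0] a by (simp add: mod_eq_0_iff_dvd)
    then show ?thesis
      using ab a T1 T(1) QT by (simp add: act_def)
  qed
  show "2 ^ n dvd a \<and> 2 ^ n dvd b" if "act a b (Q n) = \<one>"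
    using that
  proof (induction n)
    case (Suc n)
    have "act a b (Q n) = \<one>"
      using Suc.prems act_double[OF Qt, of a b n] by simp
    then obtain a' b' where ab: "a = 2 ^ n * a'" "b = 2 ^ n * b'"
      using Suc.IH by (auto elim!: dvdE)
    then have "act a' b' (Q 1) = \<one>"
      using Suc.prems act_pow2_times[OF Qt] by simp
    then show ?case
      using base[of a' b'] by (auto simp: ab)
  qed simp
  show "act a b (Q n) = \<one>" if d: "2 ^ n dvd a \<and> 2 ^ n dvd b"
  proof -
    have "Q n [^] a = \<one>"
      using gtate_pow_cong[OF Qt, of a n 0] d by (simp add: mod_eq_0_iff_dvd)
    moreover have "\<phi> (Q n) [^] b = \<one>"
      using gtate_pow_cong[OF hom_gtate[OF \<phi>_hom Qt], of b n 0] d by (simp add: mod_eq_0_iff_dvd)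
    ultimately show ?thesis
      by (simp add: act_def)
  qed
qed

lemma act_inverse:
  assumes "x \<in> carrier G"
  shows "act (- a) (- b) x = inv (act a b x)"
  using assms by (simp add: act_def int_pow_neg inv_mult)

lemma act_eq_iff:
  assumes Q: "cyclic_generator Q"
  shows "act a b (Q n) = act c d (Q n) \<longleftrightarrow> a mod 2 ^ n = c mod 2 ^ n \<and> b mod 2 ^ n = d mod 2 ^ n"
proof -
  have c: "Q n \<in> carrier G"
    using Q gtateD(1) by (auto simp: cyclic_generator_def)
  have "act a b (Q n) = act c d (Q n) \<longleftrightarrow> act (a + - c) (b + - d) (Q n) = \<one>"
    unfolding act_add[OF c] act_inverse[OF c]
    using c inv_equality[of "act a b (Q n)" "inv (act c d (Q n))"] by (metis act_closed inv_closed inv_inv r_inv)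
  then show ?thesis
    using act_eq_one_iff[OF Q, of "a - c" "b - d"] by (simp add: mod_eq_dvd_iff)
qed

lemma torsion_is_orbit:
  assumes Q: "cyclic_generator Q" and x: "x \<in> carrier G" "x [^] (2 ^ n :: int) = \<one>"
  shows "\<exists>a b. x = act a b (Q n)"
  using x
proof (induction n arbitrary: x)
  case 0
  then show ?case
    by (intro exI[of _ 0]) (simp add: act_def)
next
  case (Suc n)
  have Qt: "Q \<in> gtate" and QT: "\<phi> (Q 1) = T"
    using Q by (auto simp: cyclic_generator_def)
  note c = gtateD(1)[OF Qt]
  have "(x [^] (2 :: int)) [^] (2 ^ n :: int) = \<one>"
    using Suc.prems by (simp add: int_pow_pow)
  then obtain a b where ab: "x [^] (2 :: int) = act a b (Q n)"
    using Suc.IH[of "x [^] (2 :: int)"] Suc.prems(1) by auto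
  define y where "y = x \<otimes> inv (act a b (Q (Suc n)))"
  have y: "y \<in> carrier G"
    using Suc.prems(1) c by (simp add: y_def)
  have xy: "x = act a b (Q (Suc n)) \<otimes> y"
    using Suc.prems(1) c by (simp add: y_def m_lcomm)
  have "x [^] (2 :: int) = act a b (Q n) \<otimes> y [^] (2 :: int)"
    using c y act_double[OF Qt, of a b n] by (simp add: xy int_pow_distrib)
  then have "y [^] (2 :: int) = \<one>"
    using ab c y by simp
  then have "\<phi> (\<phi> y) = \<one>"
    using y by (simp add: \<phi>_\<phi> int_pow_neg)
  then have "\<phi> y = \<one> \<or> \<phi> y = T"
    using \<phi>_kernel y by simp
  \<comment> \<open>From here on \<open>y\<close> is 2-torsion, and the 2-torsion is spanned by
    \<open>Q 1\<close> and \<open>T = \<phi> (Q 1)\<close>.\<close>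
  then obtain i :: int where i: "\<phi> y = T [^] i"
    using T(1) by (metis int_pow_0 int_pow_1)
  have "\<phi> (y \<otimes> Q 1 [^] (- i)) = T [^] i \<otimes> T [^] (- i)"
    using y c by (simp only: \<phi>_mult \<phi>_int_pow int_pow_closed QT i)
  also have "\<dots> = \<one>"
    using T(1) by (simp flip: int_pow_mult)
  finally have "\<phi> (y \<otimes> Q 1 [^] (- i)) = \<one>" .
  then have "y \<otimes> Q 1 [^] (- i) = \<one> \<or> y \<otimes> Q 1 [^] (- i) = T"
    using \<phi>_kernel y c by simp
  then obtain j :: int where j: "y \<otimes> Q 1 [^] (- i) = T [^] j"
    using T(1) by (metis int_pow_0 int_pow_1)
  have "y = y \<otimes> Q 1 [^] (- i) \<otimes> Q 1 [^] i"
    using y c by (simp add: m_assoc flip: int_pow_mult)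
  also have "\<dots> = act i j (Q 1)"
    unfolding j using c QT T(1) by (simp add: act_def m_comm)
  also have "\<dots> = act (2 ^ n * i) (2 ^ n * j) (Q (Suc n))"
    by (simp add: act_pow2_times[OF Qt])
  finally have "x = act (a + 2 ^ n * i) (b + 2 ^ n * j) (Q (Suc n))"
    using c by (simp add: act_add flip: xy) (metis xy)
  then show ?case by blast
qed

text \<open>The order \<open>(\<phi> Q, Q)\<close> is chosen so that, with coordinates in columns,
  multiplication by \<open>a + b w\<close> has rows \<open>(a, b)\<close> and
  \<open>(- 2 b, a)\<close>, as in \<open>cartan\<close>. Uniqueness of the coefficients modulo
  \<open>2^n\<close> at each level makes them coherent 2-adic integers.\<close>

lemma cyclic_generator_gbasis:
  assumes Q: "cyclic_generator Q"
  shows "gbasis (\<lambda>n. \<phi> (Q n)) Q"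
proof -
  have Qt: "Q \<in> gtate" and \<phi>Qt: "(\<lambda>n. \<phi> (Q n)) \<in> gtate"
    using Q hom_gtate[OF \<phi>_hom] by (auto simp: cyclic_generator_def)
  have comb: "gcomb (\<lambda>n. \<phi> (Q n)) Q b a n = act (z2_residue a n) (z2_residue b n) (Q n)" for a b n
    using gtateD(1)[OF Qt] by (simp add: gcomb_int act_def m_comm)
  have "\<exists>!(a, b). t = gcomb (\<lambda>n. \<phi> (Q n)) Q a b" if t: "t \<in> gtate" for t
  proof -
    have "\<exists>a b. t n = act a b (Q n)" for n
      using torsion_is_orbit[OF Q gtateD(1,2)[OF t]] .
    then obtain f g where fg: "\<And>n. t n = act (f n) (g n) (Q n)"
      by metis
    have "act (f (Suc n)) (g (Suc n)) (Q n) = act (f n) (g n) (Q n)" for n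
      using gtateD(3)[OF t, of n] act_double[OF Qt] by (simp add: fg)
    then have compat: "f n mod 2 ^ n = f (Suc n) mod 2 ^ n" "g n mod 2 ^ n = g (Suc n) mod 2 ^ n" for n
      unfolding act_eq_iff[OF Q] by metis+
    obtain a where a: "\<And>n. z2_residue a n = f n mod 2 ^ n"
      using z2_of_sequence[of f] compat by metis
    obtain b where b: "\<And>n. z2_residue b n = g n mod 2 ^ n"
      using z2_of_sequence[of g] compat by metis
    have "t = gcomb (\<lambda>n. \<phi> (Q n)) Q b a"
    proof
      fix n
      show "t n = gcomb (\<lambda>n. \<phi> (Q n)) Q b a n"
        unfolding comb fg act_eq_iff[OF Q] using a b by simp
    qed
    moreover have "(b', a') = (b, a)" if "t = gcomb (\<lambda>n. \<phi> (Q n)) Q b' a'" for a' b'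
    proof -
      have "act (z2_residue a' n) (z2_residue b' n) (Q n) = act (z2_residue a n) (z2_residue b n) (Q n)" for n
        using that calculation comb by metis
      then show ?thesis
        unfolding act_eq_iff[OF Q] by (auto intro: z2_eqI)
    qed
    ultimately show ?thesis
      by (intro ex1I[of _ "(b, a)"]) auto
  qed
  then show ?thesis
    using Qt \<phi>Qt by (simp add: gbasis_def)
qed

end

section \<open>The curve \<open>\<eta>\<^sup>2 = \<xi>\<^sup>3 + 4 d \<xi>\<^sup>2 + 2 d\<^sup>2 \<xi>\<close> and its endomorphism \<open>\<surd>-2\<close>\<close>

text \<open>The constant is \<open>2^17 * 3^12\<close>.\<close>

lemma discriminant_Ed:
  fixes d :: "'a::field_char_0"
  shows "4 * (- 4320 * d\<^sup>2) ^ 3 + 27 * (96768 * d ^ 3)\<^sup>2 = - 69657034752 * d ^ 6"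
  by (simp add: power_mult_distrib flip: power_mult)

locale cm_curve =
  fixes d w :: "'a::{alg_closed_field, field_char_0}"
  assumes d: "d \<noteq> 0" and w: "w\<^sup>2 = - 2"
begin

definition EA :: 'a where "EA = - 4320 * d\<^sup>2"

definition EB :: 'a where "EB = 96768 * d ^ 3"

sublocale weierstrass EA EB
  by standard (simp add: EA_def EB_def discriminant_Ed d del: mult_minus_left)

lemma w_nonzero: "w \<noteq> 0"
  using w by auto

text \<open>The substitution \<open>x = 36 \<xi> + 48 d\<close>, \<open>y = 216 \<eta>\<close> leads to the short Weierstrass form.\<close>

definition pt :: "'a \<Rightarrow> 'a \<Rightarrow> 'a ec_point" where
  "pt \<xi> \<eta> = Affine (36 * \<xi> + 48 * d) (216 * \<eta>)"

lemma pt_inject [simp]: "pt \<xi> \<eta> = pt \<xi>' \<eta>' \<longleftrightarrow> \<xi> = \<xi>' \<and> \<eta> = \<eta>'"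
  by (simp add: pt_def)

lemma pt_not_Infinity [simp]: "pt \<xi> \<eta> \<noteq> Infinity" "Infinity \<noteq> pt \<xi> \<eta>"
  by (simp_all add: pt_def)

lemma pt_cases:
  obtains "P = Infinity" | \<xi> \<eta> where "P = pt \<xi> \<eta>"
proof (cases P)
  case (Affine x y)
  have "P = pt ((x - 48 * d) / 36) (y / 216)"
    unfolding Affine pt_def by (simp add: field_simps)
  then show ?thesis using that(2) by blast
qed (use that(1) in simp)

lemma neg_pt [simp]: "neg (pt \<xi> \<eta>) = pt \<xi> (- \<eta>)"
  by (simp add: pt_def)

lemma add_pt_minus [simp]: "add (pt \<xi> (- \<eta>)) (pt \<xi> \<eta>) = Infinity"
  by (simp add: pt_def)

lemma on_curve_pt: "on_curve (pt \<xi> \<eta>) \<longleftrightarrow> \<eta>\<^sup>2 = \<xi> ^ 3 + 4 * d * \<xi>\<^sup>2 + 2 * d\<^sup>2 * \<xi>"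
proof -
  have "(216 * \<eta>)\<^sup>2 - ((36 * \<xi> + 48 * d) ^ 3 + - 4320 * d\<^sup>2 * (36 * \<xi> + 48 * d) + 96768 * d ^ 3) =
      46656 * (\<eta>\<^sup>2 - (\<xi> ^ 3 + 4 * d * \<xi>\<^sup>2 + 2 * d\<^sup>2 * \<xi>))"
    by Groebner_Basis.algebra
  then have "(216 * \<eta>)\<^sup>2 = (36 * \<xi> + 48 * d) ^ 3 + - 4320 * d\<^sup>2 * (36 * \<xi> + 48 * d) + 96768 * d ^ 3 \<longleftrightarrow>
      \<eta>\<^sup>2 = \<xi> ^ 3 + 4 * d * \<xi>\<^sup>2 + 2 * d\<^sup>2 * \<xi>"
    by (metis (no_types, lifting) eq_iff_diff_eq_0 mult_eq_0_iff zero_neq_numeral)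
  then show ?thesis
    unfolding pt_def on_curve.simps unfolding EA_def EB_def .
qed

text \<open>The counterpart of \<open>line3\<close> in the coordinates of \<open>pt\<close>: the
  last three equations are the elementary symmetric functions of the roots of
  \<open>\<xi>^3 + 4 d \<xi>^2 + 2 d^2 \<xi> - (l \<xi> + n)^2\<close>.\<close>

definition cline :: "'a \<Rightarrow> 'a \<Rightarrow> 'a \<times> 'a \<Rightarrow> 'a \<times> 'a \<Rightarrow> 'a \<times> 'a \<Rightarrow> bool" where
  "cline l n P Q R \<longleftrightarrow>
     snd P = l * fst P + n \<and> snd Q = l * fst Q + n \<and> snd R = l * fst R + n \<and>
     fst P + fst Q + fst R = l\<^sup>2 - 4 * d \<and>
     fst P * fst Q + fst P * fst R + fst Q * fst R = 2 * d\<^sup>2 - 2 * l * n \<and>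
     fst P * fst Q * fst R = n\<^sup>2"

lemma cline_swap12: "cline l n P Q R \<Longrightarrow> cline l n Q P R"
  by (auto simp: cline_def algebra_simps)

lemma cline_rotate: "cline l n P Q R \<Longrightarrow> cline l n Q R P"
  by (auto simp: cline_def algebra_simps)

lemma cline_line3:
  "cline l n (X1, Y1) (X2, Y2) (X3, Y3) \<longleftrightarrow>
   line3 (6 * l) (216 * n - 288 * d * l) (36 * X1 + 48 * d, 216 * Y1) (36 * X2 + 48 * d, 216 * Y2)
     (36 * X3 + 48 * d, 216 * Y3)" (is "?L \<longleftrightarrow> ?R")
proof
  assume ?L
  then have h: "Y1 = l * X1 + n" "Y2 = l * X2 + n" "Y3 = l * X3 + n" "X1 + X2 + X3 = l\<^sup>2 - 4 * d"
    "X1 * X2 + X1 * X3 + X2 * X3 = 2 * d\<^sup>2 - 2 * l * n" "X1 * X2 * X3 = n\<^sup>2"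
    by (auto simp: cline_def)
  show ?R
    unfolding line3_def fst_conv snd_conv unfolding EA_def EB_def
  proof (intro conjI)
    show "(36 * X1 + 48 * d) + (36 * X2 + 48 * d) + (36 * X3 + 48 * d) = (6 * l)\<^sup>2"
      using h(4) by Groebner_Basis.algebra
    show "(36 * X1 + 48 * d) * (36 * X2 + 48 * d) + (36 * X1 + 48 * d) * (36 * X3 + 48 * d) +
        (36 * X2 + 48 * d) * (36 * X3 + 48 * d) = - 4320 * d\<^sup>2 - 2 * (6 * l) * (216 * n - 288 * d * l)"
      using h(4,5) by Groebner_Basis.algebra
    show "(36 * X1 + 48 * d) * (36 * X2 + 48 * d) * (36 * X3 + 48 * d) =
        (216 * n - 288 * d * l)\<^sup>2 - 96768 * d ^ 3"
      using h(4,5,6) by Groebner_Basis.algebra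
  qed (simp_all add: h algebra_simps)
next
  assume ?R
  then have h: "216 * Y1 = 6 * l * (36 * X1 + 48 * d) + (216 * n - 288 * d * l)"
    "216 * Y2 = 6 * l * (36 * X2 + 48 * d) + (216 * n - 288 * d * l)"
    "216 * Y3 = 6 * l * (36 * X3 + 48 * d) + (216 * n - 288 * d * l)"
    "(36 * X1 + 48 * d) + (36 * X2 + 48 * d) + (36 * X3 + 48 * d) = (6 * l)\<^sup>2"
    "(36 * X1 + 48 * d) * (36 * X2 + 48 * d) + (36 * X1 + 48 * d) * (36 * X3 + 48 * d) +
        (36 * X2 + 48 * d) * (36 * X3 + 48 * d) = - 4320 * d\<^sup>2 - 2 * (6 * l) * (216 * n - 288 * d * l)"
    "(36 * X1 + 48 * d) * (36 * X2 + 48 * d) * (36 * X3 + 48 * d) =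
        (216 * n - 288 * d * l)\<^sup>2 - 96768 * d ^ 3"
    unfolding line3_def unfolding EA_def EB_def by auto
  show ?L
    unfolding cline_def fst_conv snd_conv
  proof (intro conjI)
    show s: "X1 + X2 + X3 = l\<^sup>2 - 4 * d"
      using h(4) by Groebner_Basis.algebra
    show t: "X1 * X2 + X1 * X3 + X2 * X3 = 2 * d\<^sup>2 - 2 * l * n"
      using h(5) s by Groebner_Basis.algebra
    show "X1 * X2 * X3 = n\<^sup>2"
      using h(6) s t by Groebner_Basis.algebra
    have "216 * (Y1 - (l * X1 + n)) = 0" "216 * (Y2 - (l * X2 + n)) = 0" "216 * (Y3 - (l * X3 + n)) = 0"
      using h(1-3) by Groebner_Basis.algebra+
    then show "Y1 = l * X1 + n" "Y2 = l * X2 + n" "Y3 = l * X3 + n"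
      by (metis eq_iff_diff_eq_0 mult_eq_0_iff zero_neq_numeral)+
  qed
qed

lemma cline_add:
  assumes "cline l n (X1, Y1) (X2, Y2) (X3, Y3)"
  shows "add (pt X1 Y1) (pt X2 Y2) = pt X3 (- Y3)"
  using line3_add[OF assms[unfolded cline_line3]] by (simp add: pt_def)

lemma add_pt_cases:
  assumes P: "on_curve (pt X1 Y1)" and Q: "on_curve (pt X2 Y2)"
  obtains "pt X1 Y1 = neg (pt X2 Y2)"
  | l n X3 Y3 where "cline l n (X1, Y1) (X2, Y2) (X3, Y3)" "add (pt X1 Y1) (pt X2 Y2) = pt X3 (- Y3)"
proof -
  show ?thesis
  proof (cases rule: add_affine_cases[OF P[unfolded pt_def] Q[unfolded pt_def]])
    case 1
    then show ?thesis using that(1) by (simp add: pt_def)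
  next
    case (2 l n x3 y3)
    have "6 * (l / 6) = l" "216 * ((n + 48 * d * l) / 216) - 288 * d * (l / 6) = n"
      "36 * ((x3 - 48 * d) / 36) + 48 * d = x3" "216 * (- y3 / 216) = - y3"
      by (simp_all add: field_simps)
    then have "cline (l / 6) ((n + 48 * d * l) / 216) (X1, Y1) (X2, Y2) ((x3 - 48 * d) / 36, - y3 / 216)"
      using 2(1) unfolding cline_line3 by (simp only:)
    then show ?thesis
      using that(2) cline_add by blast
  qed
qed

text \<open>Multiplication by \<open>w = \<surd>-2\<close>: the 2-isogeny with kernel \<open>{\<infinity>, (0, 0)}\<close>, composed with the
  isomorphism of its target with the curve itself.\<close>

definition phi :: "'a ec_point \<Rightarrow> 'a ec_point" where
  "phi P = (case P of Infinity \<Rightarrow> Infinity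
     | Affine x y \<Rightarrow> (let \<xi> = (x - 48 * d) / 36; \<eta> = y / 216 in
         if \<xi> = 0 then Infinity
         else pt (- ((\<eta> / \<xi>)\<^sup>2 / 2)) ((\<eta> / \<xi>) * (\<xi> - 2 * d\<^sup>2 / \<xi>) / (2 * w))))"

lemma phi_Infinity [simp]: "phi Infinity = Infinity"
  by (simp add: phi_def)

lemma phi_pt:
  "phi (pt \<xi> \<eta>) = (if \<xi> = 0 then Infinity
     else pt (- ((\<eta> / \<xi>)\<^sup>2 / 2)) ((\<eta> / \<xi>) * (\<xi> - 2 * d\<^sup>2 / \<xi>) / (2 * w)))"
  by (simp add: phi_def pt_def)

text \<open>\<open>Z = 2 d^2 / \<xi>\<close> is the first coordinate of the translate by
  \<open>(0, 0)\<close>, and \<open>u\<close> is the slope from the origin. With \<open>Z\<close>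
  and \<open>u\<close> as unknowns the curve equation reads \<open>u^2 = \<xi> + Z + 4 d\<close>,
  and the isogeny is free of divisions by unknowns.\<close>

lemma phi_pt_coords:
  assumes "\<xi> * Z = 2 * d\<^sup>2" "\<eta> = u * \<xi>"
  shows "phi (pt \<xi> \<eta>) = pt (- (u\<^sup>2 / 2)) (u * (\<xi> - Z) / (2 * w))"
proof -
  have "\<xi> \<noteq> 0"
    using assms(1) d by auto
  moreover from this have "2 * d\<^sup>2 / \<xi> = Z" "\<eta> / \<xi> = u"
    using assms by (simp_all add: field_simps)
  ultimately show ?thesis
    unfolding phi_pt by simp
qed

lemma curve_coords:
  assumes "on_curve (pt \<xi> \<eta>)" "\<xi> \<noteq> 0"
  obtains Z u where "\<xi> * Z = 2 * d\<^sup>2" "\<eta> = u * \<xi>" "u\<^sup>2 = \<xi> + Z + 4 * d"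
proof
  show "\<xi> * (2 * d\<^sup>2 / \<xi>) = 2 * d\<^sup>2" "\<eta> = \<eta> / \<xi> * \<xi>"
    using assms(2) by auto
  show "(\<eta> / \<xi>)\<^sup>2 = \<xi> + 2 * d\<^sup>2 / \<xi> + 4 * d"
    using assms unfolding on_curve_pt by (simp add: field_simps power2_eq_square power3_eq_cube)
qed

lemma on_curve_phi:
  assumes "on_curve P"
  shows "on_curve (phi P)"
proof (cases P rule: pt_cases)
  case (2 \<xi> \<eta>)
  show ?thesis
  proof (cases "\<xi> = 0")
    case False
    then obtain Z u where u: "\<xi> * Z = 2 * d\<^sup>2" "\<eta> = u * \<xi>" "u\<^sup>2 = \<xi> + Z + 4 * d"
      using curve_coords assms unfolding 2 by blast
    define v where "v = u * (\<xi> - Z) / (2 * w)"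
    have v: "2 * w * v = u * (\<xi> - Z)"
      using w_nonzero by (simp add: v_def)
    have "8 * (v\<^sup>2 - ((- (u\<^sup>2 / 2)) ^ 3 + 4 * d * (- (u\<^sup>2 / 2))\<^sup>2 + 2 * d\<^sup>2 * (- (u\<^sup>2 / 2)))) = 0"
    proof -
      have "8 * v\<^sup>2 = - (u\<^sup>2 * (\<xi> - Z)\<^sup>2)"
        using v w by Groebner_Basis.algebra
      \<comment> \<open>This is \<open>(\<xi> - Z)^2 = (\<xi> + Z)^2 - 4 \<xi> Z\<close>, a
        polynomial in \<open>u^2\<close>.\<close>
      also have "\<dots> = - (u\<^sup>2 * ((u\<^sup>2 - 4 * d)\<^sup>2 - 8 * d\<^sup>2))"
        using u(1) unfolding u(3) by Groebner_Basis.algebra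
      finally have "8 * v\<^sup>2 = - (u\<^sup>2 * ((u\<^sup>2 - 4 * d)\<^sup>2 - 8 * d\<^sup>2))" .
      moreover define U where "U = - (u\<^sup>2 / 2)"
      moreover have "2 * U = - u\<^sup>2"
        by (simp add: U_def)
      ultimately show ?thesis
        unfolding U_def[symmetric] by Groebner_Basis.algebra
    qed
    then have "v\<^sup>2 = (- (u\<^sup>2 / 2)) ^ 3 + 4 * d * (- (u\<^sup>2 / 2))\<^sup>2 + 2 * d\<^sup>2 * (- (u\<^sup>2 / 2))"
      by (metis eq_iff_diff_eq_0 mult_eq_0_iff zero_neq_numeral)
    then show ?thesis
      unfolding 2 phi_pt_coords[OF u(1,2)] on_curve_pt v_def .
  qed (simp add: 2 phi_pt)
qed simp

lemma phi_neg: "phi (neg P) = neg (phi P)"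
  by (cases P rule: pt_cases) (simp_all add: phi_pt)

text \<open>With \<open>m = 1 / n\<close>, the slopes \<open>u\<^sub>i = \<eta>\<^sub>i / \<xi>\<^sub>i\<close> at the points of a line are the roots of
  \<open>u\<^sup>3 - (l + 2 d\<^sup>2 m) u\<^sup>2 + (4 d\<^sup>2 m l - 4 d) u - (n - 4 d l + 2 d\<^sup>2 m l\<^sup>2)\<close>; the \<open>\<xi>\<close>-coordinates
  of the images of these points are \<open>- u\<^sub>i\<^sup>2 / 2\<close>.\<close>

lemma phi_cline:
  assumes T: "cline l n (X1, Y1) (X2, Y2) (X3, Y3)" and n: "n \<noteq> 0"
  obtains l' n' U1 V1 U2 V2 U3 V3 where
    "phi (pt X1 Y1) = pt U1 V1" "phi (pt X2 Y2) = pt U2 V2" "phi (pt X3 Y3) = pt U3 V3"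
    "cline l' n' (U1, V1) (U2, V2) (U3, V3)"
proof -
  define m where "m = inverse n"
  have mn: "m * n = 1"
    using n by (simp add: m_def)
  have \<eta>: "Y1 = l * X1 + n" "Y2 = l * X2 + n" "Y3 = l * X3 + n"
    and e1: "X1 + X2 + X3 = l\<^sup>2 - 4 * d"
    and e2: "X1 * X2 + X1 * X3 + X2 * X3 = 2 * d\<^sup>2 - 2 * l * n"
    and e3: "X1 * X2 * X3 = n\<^sup>2"
    using T by (auto simp: cline_def)
  define b where "b = 2 * d\<^sup>2 * m"
  \<comment> \<open>The slope \<open>l + n / X1\<close>, written without division by
    \<open>X1\<close>: the product of the three \<open>\<xi>\<close>-coordinates is
    \<open>n^2\<close>.\<close>
  define u1 where "u1 = l + m * (X2 * X3)"
  define u2 where "u2 = l + m * (X1 * X3)"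
  define u3 where "u3 = l + m * (X1 * X2)"
  have me3: "m * (X1 * X2 * X3) = n" "m\<^sup>2 * (X1 * X2 * X3) = 1"
    using e3 mn by Groebner_Basis.algebra+
  have me2: "m * (X1 * X2 + X1 * X3 + X2 * X3) = b - 2 * l"
    using e2 mn unfolding b_def by Groebner_Basis.algebra
  have s1: "u1 + u2 + u3 = l + b"
    using me2 unfolding u1_def u2_def u3_def by Groebner_Basis.algebra
  have s2: "u1 * u2 + u1 * u3 + u2 * u3 = 2 * b * l - 4 * d"
  proof -
    have "u1 * u2 + u1 * u3 + u2 * u3 = 3 * l\<^sup>2 + 2 * l * (m * (X1 * X2 + X1 * X3 + X2 * X3)) +
        m\<^sup>2 * (X1 * X2 * X3) * (X1 + X2 + X3)"
      unfolding u1_def u2_def u3_def by Groebner_Basis.algebra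
    then show ?thesis
      unfolding me2 me3 e1 by (simp add: algebra_simps power2_eq_square)
  qed
  define c where "c = n - 4 * d * l + b * l\<^sup>2"
  have s3: "u1 * u2 * u3 = c"
  proof -
    have "u1 * u2 * u3 = l ^ 3 + l\<^sup>2 * (m * (X1 * X2 + X1 * X3 + X2 * X3)) +
        l * (m\<^sup>2 * (X1 * X2 * X3)) * (X1 + X2 + X3) + (m\<^sup>2 * (X1 * X2 * X3)) * (m * (X1 * X2 * X3))"
      unfolding u1_def u2_def u3_def by Groebner_Basis.algebra
    then show ?thesis
      unfolding me2 me3 e1 c_def by (simp add: algebra_simps power2_eq_square power3_eq_cube)
  qed
  have bc: "b * c = 2 * d\<^sup>2 - 4 * d * l * b + b\<^sup>2 * l\<^sup>2"
    using mn unfolding b_def c_def by Groebner_Basis.algebra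
  have image: "phi (pt \<xi> \<eta>) = pt (- (u\<^sup>2 / 2)) (u * (\<xi> - b * m * XX) / (2 * w)) \<and>
      u * (\<xi> - b * m * XX) / (2 * w) = (b - l) / w * (- (u\<^sup>2 / 2)) + c / (2 * w)"
    if "\<xi> * XX = X1 * X2 * X3" "\<eta> = l * \<xi> + n" "u = l + m * XX"
      "u ^ 3 - (l + b) * u\<^sup>2 + (2 * b * l - 4 * d) * u = c"
      "\<xi> * u = l * \<xi> + n" "on_curve (pt \<xi> \<eta>)"
    for \<xi> XX \<eta> u
  proof
    have Z: "\<xi> * (b * m * XX) = 2 * d\<^sup>2"
    proof -
      have "\<xi> * (b * m * XX) = 2 * d\<^sup>2 * (m\<^sup>2 * (X1 * X2 * X3))"
        unfolding b_def that(1)[symmetric] by Groebner_Basis.algebra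
      then show ?thesis
        unfolding me3 by simp
    qed
    have Yu: "\<eta> = u * \<xi>"
      using that(2,5) by (simp add: mult.commute)
    show "phi (pt \<xi> \<eta>) = pt (- (u\<^sup>2 / 2)) (u * (\<xi> - b * m * XX) / (2 * w))"
      using Z Yu by (rule phi_pt_coords)
    have X0: "\<xi> \<noteq> 0"
      using Z d by auto
    have "\<xi>\<^sup>2 * (u\<^sup>2 - (\<xi> + b * m * XX + 4 * d)) = 0"
      using that(6) Z unfolding on_curve_pt Yu by Groebner_Basis.algebra
    then have u2: "u\<^sup>2 = \<xi> + b * m * XX + 4 * d"
      using X0 by simp
    have mX: "m * XX = u - l"
      using that(3) by simp
    \<comment> \<open>The second coordinate of the image is thus affine in \<open>u^2\<close>, with
      the same coefficients for all three points, so the images are collinear.\<close>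
    have "u * (\<xi> - b * m * XX) = (l - b) * u\<^sup>2 + c"
      unfolding that(4)[symmetric] using u2 mX by Groebner_Basis.algebra
    then show "u * (\<xi> - b * m * XX) / (2 * w) = (b - l) / w * (- (u\<^sup>2 / 2)) + c / (2 * w)"
      using w_nonzero by (simp add: field_simps)
  qed
  have root: "u ^ 3 - (l + b) * u\<^sup>2 + (2 * b * l - 4 * d) * u = c" if "u = u1 \<or> u = u2 \<or> u = u3" for u
  proof -
    have "(u - u1) * (u - u2) * (u - u3) = 0"
      using that by auto
    then show ?thesis
      unfolding s1[symmetric] s2[symmetric] s3[symmetric] by Groebner_Basis.algebra
  qed
  have onc: "on_curve (pt X1 Y1)" "on_curve (pt X2 Y2)" "on_curve (pt X3 Y3)"
  proof -
    note L = T[unfolded cline_line3]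
    from line3_on_curve[OF L] line3_on_curve[OF line3_rotate[OF L]]
      line3_on_curve[OF line3_rotate[OF line3_rotate[OF L]]]
    show "on_curve (pt X1 Y1)" "on_curve (pt X2 Y2)" "on_curve (pt X3 Y3)"
      unfolding pt_def on_curve.simps .
  qed
  have Xu: "X1 * u1 = l * X1 + n" "X2 * u2 = l * X2 + n" "X3 * u3 = l * X3 + n"
  proof -
    have "X1 * u1 = l * X1 + m * (X1 * X2 * X3)" "X2 * u2 = l * X2 + m * (X1 * X2 * X3)"
      "X3 * u3 = l * X3 + m * (X1 * X2 * X3)"
      by (simp_all add: u1_def u2_def u3_def algebra_simps)
    then show "X1 * u1 = l * X1 + n" "X2 * u2 = l * X2 + n" "X3 * u3 = l * X3 + n"
      unfolding me3 .
  qed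
  note i1 = image[OF _ \<eta>(1) u1_def root Xu(1) onc(1)] and i2 = image[OF _ \<eta>(2) u2_def root Xu(2) onc(2)]
    and i3 = image[OF _ \<eta>(3) u3_def root Xu(3) onc(3)]
  have "cline ((b - l) / w) (c / (2 * w))
     (- (u1\<^sup>2 / 2), u1 * (X1 - b * m * (X2 * X3)) / (2 * w))
     (- (u2\<^sup>2 / 2), u2 * (X2 - b * m * (X1 * X3)) / (2 * w))
     (- (u3\<^sup>2 / 2), u3 * (X3 - b * m * (X1 * X2)) / (2 * w))"
    unfolding cline_def fst_conv snd_conv
  proof (intro conjI)
    show "- (u1\<^sup>2 / 2) + - (u2\<^sup>2 / 2) + - (u3\<^sup>2 / 2) = ((b - l) / w)\<^sup>2 - 4 * d"
    proof -
      have "u1\<^sup>2 + u2\<^sup>2 + u3\<^sup>2 = (b - l)\<^sup>2 + 8 * d"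
        using s1 s2 by Groebner_Basis.algebra
      moreover have "- (u1\<^sup>2 / 2) + - (u2\<^sup>2 / 2) + - (u3\<^sup>2 / 2) = - ((u1\<^sup>2 + u2\<^sup>2 + u3\<^sup>2) / 2)"
        by (simp add: field_simps)
      moreover have "((b - l) / w)\<^sup>2 - 4 * d = - (((b - l)\<^sup>2 + 8 * d) / 2)"
        by (simp add: power_divide w field_simps)
      ultimately show ?thesis
        by simp
    qed
    show "- (u1\<^sup>2 / 2) * - (u2\<^sup>2 / 2) + - (u1\<^sup>2 / 2) * - (u3\<^sup>2 / 2) + - (u2\<^sup>2 / 2) * - (u3\<^sup>2 / 2) =
      2 * d\<^sup>2 - 2 * ((b - l) / w) * (c / (2 * w))"
    proof -
      have "u1\<^sup>2 * u2\<^sup>2 + u1\<^sup>2 * u3\<^sup>2 + u2\<^sup>2 * u3\<^sup>2 =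
          (u1 * u2 + u1 * u3 + u2 * u3)\<^sup>2 - 2 * (u1 + u2 + u3) * (u1 * u2 * u3)"
        by Groebner_Basis.algebra
      also have "\<dots> = 8 * d\<^sup>2 + 2 * (b - l) * c"
        unfolding s1 s2 s3 using bc by Groebner_Basis.algebra
      finally have "u1\<^sup>2 * u2\<^sup>2 + u1\<^sup>2 * u3\<^sup>2 + u2\<^sup>2 * u3\<^sup>2 = 8 * d\<^sup>2 + 2 * (b - l) * c" .
      moreover have "((b - l) / w) * (c / (2 * w)) = - ((b - l) * c / 4)"
      proof -
        have "((b - l) / w) * (c / (2 * w)) = (b - l) * c / (2 * w\<^sup>2)"
          by (simp add: power2_eq_square mult_ac)
        then show ?thesis by (simp add: w)
      qed
      moreover have "- (u1\<^sup>2 / 2) * - (u2\<^sup>2 / 2) + - (u1\<^sup>2 / 2) * - (u3\<^sup>2 / 2) + - (u2\<^sup>2 / 2) * - (u3\<^sup>2 / 2) =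
          (u1\<^sup>2 * u2\<^sup>2 + u1\<^sup>2 * u3\<^sup>2 + u2\<^sup>2 * u3\<^sup>2) / 4"
        by (simp add: field_simps)
      ultimately show ?thesis
        by (simp only: mult.assoc) (simp add: field_simps)
    qed
    show "- (u1\<^sup>2 / 2) * - (u2\<^sup>2 / 2) * - (u3\<^sup>2 / 2) = (c / (2 * w))\<^sup>2"
      unfolding s3[symmetric] by (simp add: power_divide power_mult_distrib w)
  qed (use i1 i2 i3 in \<open>simp_all add: mult_ac\<close>)
  then show ?thesis
    using that i1 i2 i3 by (simp add: mult_ac)
qed

text \<open>The case \<open>n = 0\<close> missing in \<open>phi_cline\<close>. On a line through the
  origin the other two points exchange the roles of \<open>\<xi>\<close> and \<open>Z\<close>, and
  the isogeny does not distinguish a point from its translate by \<open>(0, 0)\<close>.\<close>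

lemma cline_origin:
  assumes T: "cline l n (0, Y1) (X2, Y2) (X3, Y3)"
  shows "phi (pt X3 (- Y3)) = phi (pt X2 Y2)" "Y1 = 0"
proof -
  have n: "n = 0" and \<xi>: "X2 * X3 = 2 * d\<^sup>2" and \<eta>: "Y1 = n" "Y2 = l * X2" "Y3 = l * X3"
    using T by (auto simp: cline_def)
  show "Y1 = 0"
    using n \<eta> by simp
  have "phi (pt X2 Y2) = pt (- (l\<^sup>2 / 2)) (l * (X2 - X3) / (2 * w))"
    using phi_pt_coords[OF \<xi>, of Y2 l] \<eta> by simp
  moreover have "phi (pt X3 (- Y3)) = pt (- ((- l)\<^sup>2 / 2)) (- l * (X3 - X2) / (2 * w))"
    using phi_pt_coords[of X3 X2 "- Y3" "- l"] \<xi> \<eta> by (simp add: mult.commute)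
  ultimately show "phi (pt X3 (- Y3)) = phi (pt X2 Y2)"
    by (simp add: algebra_simps)
qed

lemma phi_add:
  assumes P: "on_curve P" and Q: "on_curve Q"
  shows "phi (add P Q) = add (phi P) (phi Q)"
proof (cases P rule: pt_cases)
  case P': (2 X1 Y1)
  show ?thesis
  proof (cases Q rule: pt_cases)
    case Q': (2 X2 Y2)
    show ?thesis
    proof (cases rule: add_pt_cases[OF P[unfolded P'] Q[unfolded Q']])
      case 1
      then show ?thesis
        unfolding P' Q' 1 phi_neg by simp
    next
      case (2 l n X3 Y3)
      have sum: "add P Q = pt X3 (- Y3)"
        using 2(2) by (simp add: P' Q')
      show ?thesis
      proof (cases "n = 0")
        case False
        obtain l' n' U1 V1 U2 V2 U3 V3 where
          "phi (pt X1 Y1) = pt U1 V1" "phi (pt X2 Y2) = pt U2 V2" "phi (pt X3 Y3) = pt U3 V3"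
          "cline l' n' (U1, V1) (U2, V2) (U3, V3)"
          by (rule phi_cline[OF 2(1) False])
        then show ?thesis
          using cline_add phi_neg[of "pt X3 Y3"] unfolding P' Q' 2(2) by simp
      next
        case True
        then have "X1 * X2 * X3 = 0"
          using 2(1) by (simp add: cline_def)
        then consider "X1 = 0" | "X2 = 0" | "X3 = 0" by auto
        then show ?thesis
        proof cases
          case 1
          then have "phi P = Infinity"
            by (simp add: P' phi_pt)
          then show ?thesis
            unfolding sum cline_origin(1)[OF 2(1)[unfolded 1]] by (simp add: Q')
        next
          case X2: 2
          then have "phi Q = Infinity"
            by (simp add: Q' phi_pt)
          then show ?thesis
            unfolding sum cline_origin(1)[OF cline_swap12[OF 2(1)[unfolded X2]]] by (simp add: P')
        next
          case 3
          from cline_origin[OF cline_rotate[OF cline_rotate[OF 2(1)[unfolded 3]]]]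
          have "phi P = neg (phi Q)"
            using phi_neg[of Q] by (simp add: P' Q')
          then show ?thesis
            unfolding sum by (simp add: 3 phi_pt)
        qed
      qed
    qed
  qed simp
qed simp

text \<open>A prescribed first coordinate \<open>U\<close> means
  \<open>\<xi> + Z + 4 d = - 2 U\<close>, a quadratic equation for \<open>\<xi>\<close>. The second
  coordinate is then right up to sign, which negation repairs.\<close>

lemma phi_surj:
  assumes P: "on_curve P"
  shows "\<exists>Q. on_curve Q \<and> phi Q = P"
proof (cases P rule: pt_cases)
  case 1
  then show ?thesis
    by (intro exI[of _ Infinity]) simp
next
  case (2 U V)
  obtain \<xi> where \<xi>: "\<xi>\<^sup>2 + (4 * d + 2 * U) * \<xi> + 2 * d\<^sup>2 = 0"
  proof -
    have "\<exists>x. poly [:2 * d\<^sup>2, 4 * d + 2 * U, 1:] x = 0"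
      by (rule alg_closed_imp_poly_has_root) simp
    then show ?thesis
      using that by (auto simp: algebra_simps power2_eq_square)
  qed
  obtain u where u: "u\<^sup>2 = - 2 * U"
    using nth_root_exists[of 2 "- 2 * U"] by auto
  have X0: "\<xi> \<noteq> 0"
    using \<xi> d by auto
  define Z where "Z = 2 * d\<^sup>2 / \<xi>"
  have XZ: "\<xi> * Z = 2 * d\<^sup>2"
    using X0 by (simp add: Z_def)
  have "\<xi> * (\<xi> + Z + 4 * d + 2 * U) = 0"
    using \<xi> XZ by Groebner_Basis.algebra
  then have S: "\<xi> + Z + 4 * d = - 2 * U"
    using X0 by (simp add: eq_neg_iff_add_eq_0)
  have onc: "on_curve (pt \<xi> (u * \<xi>))"
    unfolding on_curve_pt using u S XZ by Groebner_Basis.algebra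
  have phi: "phi (pt \<xi> (u * \<xi>)) = pt U (u * (\<xi> - Z) / (2 * w))"
    using phi_pt_coords[OF XZ refl, of u] u by simp
  have "on_curve (pt U (u * (\<xi> - Z) / (2 * w)))"
    using on_curve_phi[OF onc] phi by simp
  then have "V\<^sup>2 = (u * (\<xi> - Z) / (2 * w))\<^sup>2"
    using P unfolding 2 on_curve_pt by simp
  then consider "V = u * (\<xi> - Z) / (2 * w)" | "V = - (u * (\<xi> - Z) / (2 * w))"
    by (auto simp: power2_eq_iff)
  then show ?thesis
  proof cases
    case 1
    then show ?thesis
      using onc phi 2 by blast
  next
    case V: 2
    have "phi (neg (pt \<xi> (u * \<xi>))) = P"
      unfolding phi_neg phi 2 V by simp
    then show ?thesis
      using onc on_curve_neg by blast
  qed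
qed

lemma phi_eq_Infinity:
  assumes "on_curve P"
  shows "phi P = Infinity \<longleftrightarrow> P = Infinity \<or> P = pt 0 0"
  using assms by (cases P rule: pt_cases) (auto simp: phi_pt on_curve_pt)

text \<open>With \<open>q = (\<xi> - Z) / (2 u)\<close> the tangent at \<open>P\<close> has slope
  \<open>u + q\<close> and meets the curve again at first coordinate \<open>q^2\<close>. The slope
  from the origin at \<open>phi P\<close> is \<open>w q\<close>, so a second application of
  \<open>phi\<close> also has first coordinate \<open>q^2\<close>.\<close>

lemma phi_phi:
  assumes P: "on_curve P"
  shows "phi (phi P) = neg (add P P)"
proof (cases P rule: pt_cases)
  case (2 \<xi> \<eta>)
  show ?thesis
  proof (cases "\<eta> = 0")
    case True
    then have "P = neg P"
      by (simp add: 2)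
    then have "add P P = Infinity"
      by (metis add_neg(1))
    then show ?thesis
      using True by (simp add: 2 phi_pt)
  next
    case False
    then have X0: "\<xi> \<noteq> 0"
      using P unfolding 2 on_curve_pt by auto
    then obtain Z u where u: "\<xi> * Z = 2 * d\<^sup>2" "\<eta> = u * \<xi>" "u\<^sup>2 = \<xi> + Z + 4 * d"
      using curve_coords P unfolding 2 by blast
    have u0: "u \<noteq> 0"
      using False u(2) by auto
    define l where "l = u + (\<xi> - Z) / (2 * u)"
    define q where "q = (\<xi> - Z) / (2 * u)"
    have q: "2 * u * q = \<xi> - Z"
      using u0 by (simp add: q_def)
    have l: "l = u + q"
      by (simp add: l_def q_def)
    have "cline l (- q * \<xi>) (\<xi>, \<eta>) (\<xi>, \<eta>) (q\<^sup>2, l * q\<^sup>2 - q * \<xi>)"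
      unfolding cline_def fst_conv snd_conv l u(2)
    proof (intro conjI)
      show "\<xi> + \<xi> + q\<^sup>2 = (u + q)\<^sup>2 - 4 * d" 
        using u(3) q by Groebner_Basis.algebra
      show "\<xi> * \<xi> + \<xi> * q\<^sup>2 + \<xi> * q\<^sup>2 = 2 * d\<^sup>2 - 2 * (u + q) * (- q * \<xi>)"
        using u(1,3) q by Groebner_Basis.algebra
    qed (simp_all add: algebra_simps power2_eq_square)
    from cline_add[OF this] have "neg (add P P) = pt (q\<^sup>2) (l * q\<^sup>2 - q * \<xi>)"
      unfolding 2 by simp
    moreover have "phi (phi P) = pt (q\<^sup>2) (l * q\<^sup>2 - q * \<xi>)"
    proof -
      have phi: "phi P = pt (- (u\<^sup>2 / 2)) (u * (\<xi> - Z) / (2 * w))"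
        unfolding 2 by (rule phi_pt_coords[OF u(1,2)])
      have 1: "- (u\<^sup>2 / 2) * (- 4 * d\<^sup>2 / u\<^sup>2) = 2 * d\<^sup>2"
        using u0 by (simp add: field_simps)
      have wi: "1 / w = - w / 2"
        using w w_nonzero by (simp add: field_simps power2_eq_square)
      have 2: "u * (\<xi> - Z) / (2 * w) = (w * q) * (- (u\<^sup>2 / 2))"
      proof -
        have "u * (\<xi> - Z) / (2 * w) = u * (2 * u * q) * (1 / w) / 2"
          unfolding q by simp
        then show ?thesis
          unfolding wi by (simp add: power2_eq_square)
      qed
      have "phi (phi P) = pt (- ((w * q)\<^sup>2 / 2)) ((w * q) * (- (u\<^sup>2 / 2) - (- 4 * d\<^sup>2 / u\<^sup>2)) / (2 * w))"
        unfolding phi by (rule phi_pt_coords[OF 1 2])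
      moreover have "- ((w * q)\<^sup>2 / 2) = q\<^sup>2"
        by (simp add: power_mult_distrib w)
      moreover have "(w * q) * (- (u\<^sup>2 / 2) - (- 4 * d\<^sup>2 / u\<^sup>2)) / (2 * w) = l * q\<^sup>2 - q * \<xi>"
      proof -
        have "(w * q) * (- (u\<^sup>2 / 2) - (- 4 * d\<^sup>2 / u\<^sup>2)) / (2 * w) = q * (2 * d\<^sup>2 / u\<^sup>2 - u\<^sup>2 / 4)"
          using w_nonzero by (simp add: field_simps)
        also have "2 * d\<^sup>2 / u\<^sup>2 - u\<^sup>2 / 4 = l * q - \<xi>"
        proof -
        have "u\<^sup>2 * 4 * (2 * d\<^sup>2 / u\<^sup>2 - u\<^sup>2 / 4) = u\<^sup>2 * 4 * (l * q - \<xi>)"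
        proof -
          have "u\<^sup>2 * 4 * (2 * d\<^sup>2 / u\<^sup>2 - u\<^sup>2 / 4) = 8 * d\<^sup>2 - u\<^sup>2 * u\<^sup>2"
            using u0 by (simp add: field_simps)
          also have "\<dots> = u\<^sup>2 * 4 * (l * q - \<xi>)"
            unfolding l using u(1,3) q by Groebner_Basis.algebra
          finally show ?thesis .
        qed
        then show ?thesis
          using u0 by (metis mult_cancel_left mult_eq_0_iff power_not_zero zero_neq_numeral)
        qed
        finally show ?thesis
          by (simp add: algebra_simps power2_eq_square)
      qed
      ultimately show ?thesis by simp
    qed
    ultimately show ?thesis by simp
  qed
qed simp

abbreviation E where "E \<equiv> ec_group EA EB"

lemma carrier_E: "x \<in> carrier E \<longleftrightarrow> on_curve x"
  by (cases x) (auto simp: ec_group_def)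

lemma mult_E [simp]: "x \<otimes>\<^bsub>E\<^esub> y = add x y" and one_E [simp]: "\<one>\<^bsub>E\<^esub> = Infinity"
  by (simp_all add: ec_group_def)

sublocale E: comm_group E
  by (rule comm_group_ec_group)

lemma inv_E: "on_curve x \<Longrightarrow> inv\<^bsub>E\<^esub> x = neg x"
  by (rule E.inv_equality) (simp_all add: carrier_E)

lemma pow2_E: "on_curve x \<Longrightarrow> x [^]\<^bsub>E\<^esub> (2 :: int) = add x x"
  using int_pow_int[of E x 2] by (simp add: numeral_2_eq_2)

sublocale E: cm_module E phi "pt 0 0"
proof
  show "phi \<in> hom E E"
    by (rule homI) (simp_all add: carrier_E on_curve_phi phi_add)
  show "\<exists>y\<in>carrier E. phi y = x" if x: "x \<in> carrier E" for x
  proof -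
    obtain y where "on_curve y" "phi y = x"
      using phi_surj[of x] x carrier_E[of x] by auto
    then show ?thesis
      using carrier_E[of y] by blast
  qed
  show "pt 0 0 \<in> carrier E" "pt 0 0 \<noteq> \<one>\<^bsub>E\<^esub>"
    by (simp_all add: carrier_E on_curve_pt)
  show "phi x = \<one>\<^bsub>E\<^esub> \<longleftrightarrow> x = \<one>\<^bsub>E\<^esub> \<or> x = pt 0 0" if "x \<in> carrier E" for x
    using phi_eq_Infinity that by (simp add: carrier_E)
  show "phi (phi x) = x [^]\<^bsub>E\<^esub> (- 2 :: int)" if "x \<in> carrier E" for x
    using that phi_phi[of x] pow2_E[of x] inv_E[of "add x x"] E.int_pow_neg[of x 2]
    by (simp add: carrier_E on_curve_add)
qed

end

context cm_curve
begin

subsection \<open>Points annihilated by \<open>(\<surd>-2)\<^sup>5\<close>\<close>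

text \<open>In the coordinates \<open>\<xi>\<close>, \<open>\<eta>\<close> of \<open>pt\<close>, these are \<open>- \<xi> / d\<close> and \<open>\<eta> / \<xi>\<close>.\<close>

definition xc :: "'a ec_point \<Rightarrow> 'a" where
  "xc P = (case P of Infinity \<Rightarrow> 0 | Affine x y \<Rightarrow> (x - 48 * d) / 36 / (- d))"

definition slope :: "'a ec_point \<Rightarrow> 'a" where
  "slope P = (case P of Infinity \<Rightarrow> 0 | Affine x y \<Rightarrow> (y / 216) / ((x - 48 * d) / 36))"

text \<open>In the notation of \<open>level5_coords\<close> the denominator is \<open>1 + s\<close>.
  Writing it through coordinates of \<open>phi P\<close> and \<open>phi (phi P)\<close> avoids
  naming the roots \<open>r\<close> and \<open>s\<close>, so that the Galois action can be carried
  through the formula.\<close>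

definition kappa :: "'a ec_point \<Rightarrow> 'a" where
  "kappa P = slope P / (1 + (xc (phi P) - 2 + xc (phi (phi P))) / 2)"

text \<open>The annihilator is exactly the fifth power: the fourth image is the nontrivial kernel
  point.\<close>

definition level5 :: "'a ec_point \<Rightarrow> bool" where
  "level5 P \<longleftrightarrow> on_curve P \<and> phi (phi (phi (phi P))) = pt 0 0"

lemma xc_pt: "xc (pt (- d * x) \<eta>) = x"
  using d by (simp add: xc_def pt_def)

lemma xc_neg [simp]: "xc (neg P) = xc P"
  by (cases P) (simp_all add: xc_def)

lemma slope_pt [simp]: "slope (pt \<xi> \<eta>) = \<eta> / \<xi>"
  by (simp add: slope_def pt_def)

lemma slope_neg [simp]: "slope (neg P) = - slope P"
  by (cases P rule: pt_cases) (simp, simp add: slope_def, simp)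

lemma kappa_neg: "kappa (neg P) = - kappa P"
  by (simp add: kappa_def phi_neg)

lemma phi_scaled:
  assumes "x * z = 2"
  shows "phi (pt (- d * x) (u * (- d * x))) = pt (- (u\<^sup>2 / 2)) (u * (- d * (x - z)) / (2 * w))"
proof -
  have "x * z - 2 = 0"
    using assms by simp
  then have "(- d * x) * (- d * z) = 2 * d\<^sup>2"
    by Groebner_Basis.algebra
  from phi_pt_coords[OF this refl, of u] show ?thesis
    by (simp add: algebra_simps)
qed

lemma scaled_coords:
  assumes P: "on_curve (pt (- d * x) \<eta>)" and xz: "x * z = 2"
  obtains u where "\<eta> = u * (- d * x)" "u\<^sup>2 = - d * (x + z - 4)"
proof -
  have "x \<noteq> 0"
    using xz by auto
  then have "- d * x \<noteq> 0"
    using d by simp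
  then obtain Z u where u: "(- d * x) * Z = 2 * d\<^sup>2" "\<eta> = u * (- d * x)" "u\<^sup>2 = - d * x + Z + 4 * d"
    using curve_coords[OF P] by blast
  have "x * z - 2 = 0"
    using xz by simp
  then have "(- d * x) * (Z - (- d * z)) = 0"
    using u(1) by Groebner_Basis.algebra
  then have "Z = - d * z"
    using \<open>- d * x \<noteq> 0\<close> by (simp add: eq_neg_iff_add_eq_0)
  then show ?thesis
    using that[OF u(2)] u(3) by (simp add: algebra_simps)
qed

text \<open>Dividing once by \<open>w\<close>: \<open>x\<close> and \<open>z\<close> are the two
  roots of \<open>X^2 - (4 - 2 x') X + 2\<close>, and the new slope is a square root of
  \<open>2 d x'\<close>.\<close>

lemma phi_preimage:
  assumes P: "on_curve P" and phi: "phi P = pt (- d * x') \<eta>'"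
  obtains x z u where "P = pt (- d * x) (u * (- d * x))" "x * z = 2" "x + z = 4 - 2 * x'"
    "u\<^sup>2 = 2 * d * x'" "\<eta>' = u * (- d * (x - z)) / (2 * w)"
proof (cases P rule: pt_cases)
  case (2 \<xi> \<eta>)
  have \<xi>: "\<xi> \<noteq> 0"
    using phi by (auto simp: 2 phi_pt)
  define x where "x = \<xi> / (- d)"
  define z where "z = 2 / x"
  have x: "x \<noteq> 0" "\<xi> = - d * x" "x * z = 2"
    using \<xi> d by (auto simp: x_def z_def)
  obtain u where u: "\<eta> = u * (- d * x)" "u\<^sup>2 = - d * (x + z - 4)"
    using scaled_coords[OF P[unfolded 2 x(2)] x(3)] .
  have P': "P = pt (- d * x) (u * (- d * x))"
    using 2 x(2) u(1) by simp
  have eq: "- (u\<^sup>2 / 2) = - d * x'" "\<eta>' = u * (- d * (x - z)) / (2 * w)"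
    using phi unfolding P' phi_scaled[OF x(3)] by simp_all
  have u2: "u\<^sup>2 = 2 * d * x'"
    using eq(1) by (simp add: field_simps)
  have "d * (x + z - (4 - 2 * x')) = 0"
    using u2 u(2) by Groebner_Basis.algebra
  then have "x + z = 4 - 2 * x'"
    using d by simp
  then show ?thesis
    using that P' x(3) u2 eq(2) by blast
qed (use phi in simp)

lemma level2_coords:
  assumes "on_curve P" "phi P = pt 0 0"
  obtains r where "r\<^sup>2 = 2" "P = pt (- d * (2 + r)) 0"
proof -
  have "phi P = pt (- d * 0) 0"
    using assms(2) by simp
  from phi_preimage[OF assms(1) this] obtain x z u where
    x: "P = pt (- d * x) (u * (- d * x))" "x * z = 2" "x + z = 4 - 2 * 0" "u\<^sup>2 = 2 * d * 0"
    by metis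
  show ?thesis
  proof (rule that)
    show "(x - 2)\<^sup>2 = 2"
    proof -
      have "x * z - 2 = 0" "x + z - 4 = 0"
        using x(2,3) by simp_all
      then show ?thesis
        by Groebner_Basis.algebra
    qed
    show "P = pt (- d * (2 + (x - 2))) 0"
      using x(1,4) by simp
  qed
qed

text \<open>The tower of square roots \<open>r\<^sup>2 = 2\<close>, \<open>s\<^sup>2 = 1 + r\<close>, \<open>t\<^sup>2 = s (r + s)\<close>, \<open>k\<^sup>2 = 2 d\<close>
  obtained by dividing \<open>(0, 0)\<close> repeatedly by \<open>\<surd>-2\<close>. The identity \<open>2 + r + 2 s = (1 + s)\<^sup>2\<close>
  is what makes \<open>kappa\<close> a square root of \<open>2 d\<close>.\<close>

lemma level5_coords:
  assumes "level5 P"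
  obtains r s t k where "r\<^sup>2 = 2" "s\<^sup>2 = 1 + r" "t\<^sup>2 = s * (r + s)" "k\<^sup>2 = 2 * d" "1 + s \<noteq> 0"
    "P = pt (- d * (2 * t - r - 2 * s)) (k * (1 + s) * (- d * (2 * t - r - 2 * s)))"
    "phi P = pt (- d * (1 + s)\<^sup>2) (d * w * k * (1 + s) * t)" "kappa P = k"
    "(2 * t - r - 2 * s) * (- (2 * t) - r - 2 * s) = 2"
proof -
  have on: "on_curve P" "on_curve (phi P)" "on_curve (phi (phi P))" "on_curve (phi (phi (phi P)))"
    and T: "phi (phi (phi (phi P))) = pt 0 0"
    using assms on_curve_phi by (auto simp: level5_def)
  obtain r where r: "r\<^sup>2 = 2" and P2: "phi (phi (phi P)) = pt (- d * (2 + r)) 0"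
    using level2_coords[OF on(4) T] .
  obtain x3 z3 u3 where P3: "phi (phi P) = pt (- d * x3) (u3 * (- d * x3))"
    and 3: "x3 * z3 = 2" "x3 + z3 = 4 - 2 * (2 + r)"
    using phi_preimage[OF on(3) P2] by metis
  have 3: "x3 * z3 - 2 = 0" "x3 + z3 - (4 - 2 * (2 + r)) = 0"
    using 3 by simp_all
  have r0: "r\<^sup>2 - 2 = 0"
    using r by simp
  \<comment> \<open>The two roots have sum \<open>- 2 r\<close> and product \<open>2 = r^2\<close>,
    so they coincide: this division introduces no new square root in the first coordinate.\<close>
  have "(x3 + r)\<^sup>2 = 0"
    using 3 r0 by Groebner_Basis.algebra
  then have x3: "x3 = - r"
    by (simp add: eq_neg_iff_add_eq_0)
  obtain x4 z4 u4 where P4: "phi P = pt (- d * x4) (u4 * (- d * x4))"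
    and 4: "x4 * z4 = 2" "x4 + z4 = 4 - 2 * x3"
    using phi_preimage[OF on(2) P3] by metis
  have 4: "x4 * z4 - 2 = 0" "x4 + z4 - (4 - 2 * x3) = 0" "x4 \<noteq> 0"
    using 4 by auto
  \<comment> \<open>Completing the square:
    \<open>(x4 - 2 - r)^2 = (2 + r)^2 - 2 = 4 (1 + r)\<close>.\<close>
  define s where "s = (x4 - 2 - r) / 2"
  have s4: "x4 = 2 + r + 2 * s"
    unfolding s_def by (simp add: field_simps)
  have "4 * (s\<^sup>2 - (1 + r)) = 0"
    using 4(1,2) r0 unfolding x3 s4 by Groebner_Basis.algebra
  then have s: "s\<^sup>2 = 1 + r"
    by (metis eq_iff_diff_eq_0 mult_eq_0_iff zero_neq_numeral)
  have x4: "x4 = (1 + s)\<^sup>2"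
    unfolding s4 using s by (simp add: power2_eq_square algebra_simps)
  then have s1: "1 + s \<noteq> 0"
    using 4(3) by auto
  obtain x5 z5 u5 where P5: "P = pt (- d * x5) (u5 * (- d * x5))"
    and 5: "x5 * z5 = 2" "x5 + z5 = 4 - 2 * x4" "u5\<^sup>2 = 2 * d * x4"
      "u4 * (- d * x4) = u5 * (- d * (x5 - z5)) / (2 * w)"
    using phi_preimage[OF on(1) P4] by metis
  \<comment> \<open>Completing the square again:
    \<open>(x5 + r + 2 s)^2 = (r + 2 s)^2 - 2 = 4 s (r + s)\<close>.\<close>
  define t where "t = (x5 + r + 2 * s) / 2"
  have x5: "x5 = 2 * t - r - 2 * s"
    unfolding t_def by (simp add: field_simps)
  have "z5 = 4 - 2 * x4 - x5"
    using 5(2) by (simp add: eq_diff_eq add.commute)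
  then have "z5 = 4 - 2 * (2 + r + 2 * s) - (2 * t - r - 2 * s)"
    unfolding x5 s4 .
  then have z5: "z5 = - (2 * t) - r - 2 * s"
    by (rule trans) (simp add: algebra_simps)
  have xz5: "x5 * z5 - 2 = 0"
    using 5(1) by simp
  have "4 * (t\<^sup>2 - s * (r + s)) = 0"
    using xz5 r0 unfolding x5 z5 by Groebner_Basis.algebra
  then have t: "t\<^sup>2 = s * (r + s)"
    by (metis eq_iff_diff_eq_0 mult_eq_0_iff zero_neq_numeral)
  \<comment> \<open>The slope satisfies \<open>u5^2 = 2 d x4\<close> with
    \<open>x4 = (1 + s)^2\<close>.\<close>
  define k where "k = u5 / (1 + s)"
  have k: "u5 = k * (1 + s)"
    using s1 by (simp add: k_def)
  have "(1 + s)\<^sup>2 * (k\<^sup>2 - 2 * d) = 0"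
    using 5(3) unfolding k x4 by Groebner_Basis.algebra
  then have k2: "k\<^sup>2 = 2 * d"
    using s1 by simp
  have "u5 * (- d * (x5 - z5)) / (2 * w) = d * w * k * (1 + s) * t"
  proof -
    have wi: "1 / (2 * w) = - w / 4"
      using w w_nonzero by (simp add: field_simps power2_eq_square)
    have tt: "x5 - z5 = 4 * t"
      by (simp add: x5 z5)
    have "u5 * (- d * (x5 - z5)) / (2 * w) = u5 * (- d * (x5 - z5)) * (1 / (2 * w))"
      by simp
    then show ?thesis
      unfolding wi k tt by simp
  qed
  then have P4': "phi P = pt (- d * (1 + s)\<^sup>2) (d * w * k * (1 + s) * t)"
    using P4 5(4) x4 by simp
  have "x5 \<noteq> 0"
    using 5(1) by auto
  then have "slope P = u5"
    using P5 d by simp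
  moreover have "xc (phi P) = 2 + r + 2 * s" "xc (phi (phi P)) = - r"
  proof -
    show "xc (phi P) = 2 + r + 2 * s"
      unfolding P4 xc_pt by (rule s4)
    show "xc (phi (phi P)) = - r"
      unfolding P3 xc_pt by (rule x3)
  qed
  ultimately have "kappa P = k"
    using s1 by (simp add: kappa_def k)
  then show ?thesis
    using that[OF r s t k2 s1] P5 P4' 5(1) unfolding k x5 z5 by simp
qed

lemma add_pt_chord:
  assumes "X1 \<noteq> X2" "l * (X2 - X1) = Y2 - Y1"
  shows "add (pt X1 Y1) (pt X2 Y2) =
    pt (l\<^sup>2 - 4 * d - X1 - X2) (l * (X1 - (l\<^sup>2 - 4 * d - X1 - X2)) - Y1)"
proof -
  have "(216 * Y2 - 216 * Y1) / (36 * X2 + 48 * d - (36 * X1 + 48 * d)) = 6 * l"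
  proof -
    have "216 * Y2 - 216 * Y1 = 216 * (Y2 - Y1)"
      by (simp add: algebra_simps)
    also have "\<dots> = 6 * l * (36 * X2 + 48 * d - (36 * X1 + 48 * d))"
      unfolding assms(2)[symmetric] by (simp add: algebra_simps)
    finally show ?thesis
      using assms(1) by simp
  qed
  then show ?thesis
    using assms(1) unfolding pt_def ec_add.simps(3) Let_def by (simp add: algebra_simps power2_eq_square)
qed

text \<open>For \<open>(1 + w) P\<close> the tower has \<open>- r\<close> and \<open>s'\<close> in
  place of \<open>r\<close> and \<open>s\<close>, and its slope turns out to be
  \<open>k (1 + s')\<close> with the same \<open>k\<close>.\<close>

lemma kappa_add_phi:
  assumes P: "level5 P"
  shows "kappa (add P (phi P)) = kappa P"
proof -
  obtain r s t k where rel: "r\<^sup>2 = 2" "s\<^sup>2 = 1 + r" "t\<^sup>2 = s * (r + s)" "k\<^sup>2 = 2 * d" "1 + s \<noteq> 0"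
    and P5: "P = pt (- d * (2 * t - r - 2 * s)) (k * (1 + s) * (- d * (2 * t - r - 2 * s)))"
    and P4: "phi P = pt (- d * (1 + s)\<^sup>2) (d * w * k * (1 + s) * t)" and kP: "kappa P = k"
    and x5z5: "(2 * t - r - 2 * s) * (- (2 * t) - r - 2 * s) = 2"
    using level5_coords[OF P] .
  \<comment> \<open>\<open>L\<close>, \<open>xS\<close> and \<open>zS\<close> come from a computation in \<open>\<rat>(t, w)\<close>: the chord through \<open>P\<close> and \<open>phi P\<close> has slope
    \<open>k L / 4\<close>, and \<open>- d xS\<close> is the \<open>\<xi>\<close>-coordinate of the sum, with \<open>xS zS = 2\<close>.\<close>
  define x5 where "x5 = 2 * t - r - 2 * s"
  define x4 where "x4 = (1 + s)\<^sup>2"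
  \<comment> \<open>A square root of \<open>1 - r\<close>: the product \<open>s s'\<close> must have
    square \<open>1 - r^2 = -1 = (w r / 2)^2\<close>, and \<open>1 / s = s (r - 1)\<close>.\<close>
  define s' where "s' = s * w * (2 - r) / 2"
  define L where "L = - 2 * t * w + 2 * s - 2 * s * w + 2 * s * t + 2 * s * t * w + r * s * w
    - 2 * r * s * t - r * s * t * w"
  define xS where "xS = - t * w - 2 * s * w + 2 * s * t + s * t * w + r - r * t + r * s * w - r * s * t"
  define zS where "zS = t * w - 2 * s * w - 2 * s * t - s * t * w + r + r * t + r * s * w + r * s * t"
  \<comment> \<open>Normal forms in \<open>r\<close>, \<open>s\<close>, \<open>t\<close>,
    \<open>w\<close>: each square is reduced, once alone and once inside a product nested to the
    right.\<close>
  have red: "r * r = 2" "r * (r * x) = 2 * x" "s * s = 1 + r" "s * (s * x) = (1 + r) * x"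
    "t * t = s * (r + s)" "t * (t * x) = s * (r + s) * x" "w * w = - 2" "w * (w * x) = - 2 * x" for x
    using rel(1-3) w by (simp_all add: power2_eq_square flip: mult.assoc)
  note red' = algebra_simps power2_eq_square red
  have s'w: "2 * s' = s * w * (2 - r)"
    by (simp add: s'_def)
  have "4 * (s' * s') = (2 * s') * (2 * s')"
    by simp
  also have "\<dots> = 4 * (1 - r)"
    unfolding s'w by (simp add: red')
  finally have s'2: "s' * s' = 1 - r"
    by (metis mult_left_cancel zero_neq_numeral)
  \<comment> \<open>\<open>V1\<close> is the chord condition, \<open>V2\<close> gives the first
    coordinate of the sum, \<open>V3\<close> its slope, and \<open>V4\<close> that \<open>zS\<close>
    belongs to \<open>xS\<close>; common factors of \<open>d\<close> and \<open>k\<close> are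
    removed.\<close>
  have V1: "L * (x4 - x5) = - 4 * (w * (1 + s) * t + (1 + s) * x5)"
    unfolding L_def x4_def x5_def by (simp add: red')
  have V2: "L\<^sup>2 = 8 * (4 - x5 - x4 - xS)"
    unfolding L_def x4_def x5_def xS_def by (simp add: red')
  have V3: "L * (x5 - xS) - 4 * (1 + s) * x5 = 4 * xS + 2 * (s * w * (2 - r)) * xS"
    unfolding L_def x5_def xS_def by (simp add: red')
  have V4: "xS * zS = 2"
    unfolding xS_def zS_def by (simp add: red')
  \<comment> \<open>The chord formula applies only to different abscissas; equality would force
    \<open>s = - (1 + r)\<close> and then \<open>r = - 2\<close>.\<close>
  have x45: "x5 \<noteq> x4"
  proof
    assume eq: "x5 = x4"
    have "x4 = 2 + r + 2 * s"
      unfolding x4_def by (simp add: red')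
    moreover have "x4 * (2 + r - 2 * s) = 2"
      unfolding x4_def by (simp add: red')
    moreover have "x4 * (- (2 * t) - r - 2 * s) = 2"
      using x5z5 eq unfolding x5_def by simp
    moreover have "x4 \<noteq> 0"
      using rel(5) by (simp add: x4_def)
    ultimately have "2 + r - 2 * s = - (2 * t) - r - 2 * s" "2 + r + 2 * s = 2 * t - r - 2 * s"
      using eq unfolding x5_def by (metis mult_left_cancel)+
    then have "4 * (s + 1 + r) = 0"
      by Groebner_Basis.algebra
    then have "s + 1 + r = 0"
      by (metis mult_eq_0_iff zero_neq_numeral)
    then have s: "s = - (1 + r)"
      by (metis add.assoc eq_neg_iff_add_eq_0)
    have "r + 2 = 0"
      using rel(2) rel(1) unfolding s by (simp add: power2_eq_square algebra_simps)
    then have "r = - 2"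
      by (simp add: eq_neg_iff_add_eq_0)
    then show False
      using rel(1) by simp
  qed
  define l where "l = k * L / 4"
  have l4: "4 * (l * x) = k * (L * x)" for x
    by (simp add: l_def)
  have 1: "l * (- d * x4 - - d * x5) = d * w * k * (1 + s) * t - k * (1 + s) * (- d * x5)"
  proof -
    have "4 * (l * (- d * x4 - - d * x5)) = - (d * k) * (L * (x4 - x5))"
      unfolding l4 by (simp add: algebra_simps)
    also have "\<dots> = 4 * (d * w * k * (1 + s) * t - k * (1 + s) * (- d * x5))"
      unfolding V1 by (simp add: algebra_simps)
    finally show ?thesis
      by (metis mult_left_cancel zero_neq_numeral)
  qed
  have 2: "l\<^sup>2 - 4 * d - - d * x5 - - d * x4 = - d * xS"
  proof -
    have "16 * l\<^sup>2 = 2 * d * L\<^sup>2"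
      using rel(4) by (simp add: l_def power_mult_distrib power_divide)
    then have "16 * (l\<^sup>2 - 4 * d - - d * x5 - - d * x4) = 16 * (- d * xS)"
      unfolding V2 by Groebner_Basis.algebra
    then show ?thesis
      by (metis mult_left_cancel zero_neq_numeral)
  qed
  have 3: "l * (- d * x5 - - d * xS) - k * (1 + s) * (- d * x5) = k * (1 + s') * (- d * xS)"
  proof -
    have "4 * (l * (- d * x5 - - d * xS) - k * (1 + s) * (- d * x5)) =
        - (d * k) * (L * (x5 - xS) - 4 * (1 + s) * x5)"
      unfolding right_diff_distrib[of 4] l4 by (simp add: algebra_simps)
    also have "\<dots> = 4 * (k * (1 + s') * (- d * xS))"
      unfolding V3 s'w[symmetric] by (simp add: algebra_simps)
    finally show ?thesis
      by (metis mult_left_cancel zero_neq_numeral)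
  qed
  have "- d * x5 \<noteq> - d * x4"
    using x45 d by simp
  from add_pt_chord[OF this 1]
  have S: "add P (phi P) = pt (- d * xS) (k * (1 + s') * (- d * xS))"
    unfolding 2 3 P4[folded x4_def] P5[folded x5_def, symmetric] .
  have onS: "on_curve (add P (phi P))"
    using P on_curve_add on_curve_phi by (simp add: level5_def)
  define x4' where "x4' = (1 + s')\<^sup>2"
  have x4': "x4' = 2 - r + 2 * s'" "x4' * (2 - r - 2 * s') = 2"
  proof -
    show e: "x4' = 2 - r + 2 * s'"
      using s'2 unfolding x4'_def by (simp add: power2_eq_square algebra_simps)
    have "(2 - r + 2 * s') * (2 - r - 2 * s') = 4 - 4 * r + r * r - 4 * (s' * s')"
      by (simp add: algebra_simps)
    then show "x4' * (2 - r - 2 * s') = 2"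
      unfolding e s'2 red(1) by simp
  qed
  have "- ((k * (1 + s'))\<^sup>2 / 2) = - d * x4'"
    by (simp add: power_mult_distrib rel(4) x4'_def)
  then obtain Y4 where phiS: "phi (add P (phi P)) = pt (- d * x4') Y4"
    using phi_scaled[OF V4, of "k * (1 + s')"] unfolding S by auto
  obtain u where u: "Y4 = u * (- d * x4')" "u\<^sup>2 = - d * (x4' + (2 - r - 2 * s') - 4)"
    using scaled_coords[OF on_curve_phi[OF onS, unfolded phiS] x4'(2)] .
  have "- (u\<^sup>2 / 2) = - d * r"
    unfolding u(2) x4'(1) by (simp add: algebra_simps)
  \<comment> \<open>Together with \<open>xc (phi (add P (phi P)))\<close> this makes the denominator
    of \<open>kappa\<close> at the sum equal to \<open>1 + s'\<close>, which cancels the slope down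
    to \<open>k\<close>.\<close>
  then have "xc (phi (phi (add P (phi P)))) = r"
    unfolding phiS u(1) phi_scaled[OF x4'(2)] by (simp only: xc_pt)
  moreover have "xc (phi (add P (phi P))) = 2 - r + 2 * s'"
    unfolding phiS x4'(1)[symmetric] by (simp only: xc_pt)
  moreover have "slope (add P (phi P)) = k * (1 + s')"
    unfolding S using V4 d by auto
  moreover have "1 + s' \<noteq> 0"
    using x4'(2) unfolding x4'_def by auto
  ultimately show ?thesis
    unfolding kP by (simp add: kappa_def)
qed

lemma kappa_square: "level5 P \<Longrightarrow> (kappa P)\<^sup>2 = 2 * d"
  using level5_coords by metis

end

text \<open>The quadratic character of the units \<open>a + b w\<close> modulo \<open>w^5\<close>
  whose kernel is generated by \<open>1 + w\<close> and \<open>1 - w\<close>. That ideal consists of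
  the elements with \<open>a\<close> divisible by 8 and \<open>b\<close> by 4.\<close>

definition chi :: "int \<Rightarrow> int \<Rightarrow> int" where
  "chi a b = (if (a mod 8 \<in> {1, 3}) = (b mod 4 = 2) then - 1 else 1)"

lemma cm_curve_uminus: "cm_curve d w \<Longrightarrow> cm_curve d (- w)"
  by (simp add: cm_curve_def)

context cm_curve
begin

lemma phi_uminus: "cm_curve.phi d (- w) P = neg (phi P)"
proof -
  interpret m: cm_curve d "- w"
    by (rule cm_curve_uminus) (rule cm_curve_axioms)
  show ?thesis
    by (cases P rule: pt_cases) (simp_all add: phi_pt m.phi_pt)
qed

text \<open>The curve does not depend on the choice of \<open>w\<close>. Taking \<open>- w\<close>
  instead replaces \<open>phi\<close> by its negative and leaves \<open>kappa\<close> alone, because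
  \<open>xc\<close> ignores signs.\<close>

lemma kappa_sub_phi:
  assumes P: "level5 P"
  shows "kappa (add P (neg (phi P))) = kappa P"
proof -
  interpret m: cm_curve d "- w"
    by (rule cm_curve_uminus) (rule cm_curve_axioms)
  have "m.kappa Q = kappa Q" for Q
    unfolding m.kappa_def kappa_def phi_uminus phi_neg by simp
  moreover have "m.level5 P"
    using P unfolding m.level5_def level5_def phi_uminus phi_neg by simp
  ultimately show ?thesis
    using m.kappa_add_phi[of P] unfolding phi_uminus by simp
qed

lemma level5_closed: "level5 P \<Longrightarrow> P \<in> carrier E"
  by (simp add: level5_def carrier_E)

lemma level5_pow4:
  assumes P: "level5 P"
  shows "P [^]\<^bsub>E\<^esub> (4 :: int) = pt 0 0"
proof -
  note c = level5_closed[OF P]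
  have "phi (phi (phi (phi P))) = (P [^]\<^bsub>E\<^esub> (- 2 :: int)) [^]\<^bsub>E\<^esub> (- 2 :: int)"
    using c by (simp only: E.\<phi>_\<phi> E.\<phi>_closed E.int_pow_closed)
  then show ?thesis
    using P c by (simp add: E.int_pow_pow level5_def)
qed

lemma level5_act_cong:
  assumes P: "level5 P" and ab: "a mod 8 = a' mod 8" "b mod 4 = b' mod 4"
  shows "E.act a b P = E.act a' b' P"
proof -
  note c = level5_closed[OF P]
  have "P [^]\<^bsub>E\<^esub> (8 :: int) = (P [^]\<^bsub>E\<^esub> (4 :: int)) [^]\<^bsub>E\<^esub> (2 :: int)"
    using c by (simp add: E.int_pow_pow)
  then have 1: "P [^]\<^bsub>E\<^esub> (8 :: int) = \<one>\<^bsub>E\<^esub>"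
    using level5_pow4[OF P] E.T_square by simp
  have 2: "phi P [^]\<^bsub>E\<^esub> (4 :: int) = \<one>\<^bsub>E\<^esub>"
    using level5_pow4[OF P] c E.\<phi>_T by (simp add: E.\<phi>_int_pow[symmetric])
  show ?thesis
    unfolding E.act_def using E.int_pow_cong[OF c 1 ab(1)] E.int_pow_cong[OF E.\<phi>_closed[OF c] 2 ab(2)]
    by simp
qed

lemma level5_act:
  assumes P: "level5 P" and a: "odd a"
  shows "level5 (E.act a b P)"
proof -
  note c = level5_closed[OF P]
  have "phi (phi (phi (phi (E.act a b P)))) = E.act a b (pt 0 0)"
    using P c by (simp add: E.\<phi>_act level5_def)
  also have "\<dots> = pt 0 0 [^]\<^bsub>E\<^esub> (1 :: int)"
    using E.int_pow_cong[OF E.T(1) E.T_square, of a 1] a E.T(1)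
    by (simp add: E.act_def odd_iff_mod_2_eq_one del: mult_E one_E)
  finally show ?thesis
    using E.act_closed[OF c, of a b] E.T(1) by (simp add: level5_def carrier_E)
qed

text \<open>\<open>kappa\<close> is odd and unchanged by \<open>1 + w\<close> and
  \<open>1 - w\<close>. Modulo \<open>w^5\<close> these generate the eight listed units, and the
  negatives of the eight are the remaining units.\<close>

lemma kappa_act:
  assumes P: "level5 P" and a: "odd a"
  shows "kappa (E.act a b P) = of_int (chi a b) * kappa P"
proof -
  \<comment> \<open>Invariance is demanded at every level 5 point, since a product acts by applying
    one factor at the image under the other.\<close>
  define good where "good = (\<lambda>a b. \<forall>P. level5 P \<longrightarrow> kappa (E.act a b P) = kappa P)"
  have mult: "good (a * c - 2 * b * d) (a * d + b * c)" if "good a b" "good c d" "odd c" for a b c d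
    unfolding good_def
  proof (intro allI impI)
    fix P assume P: "level5 P"
    have "kappa (E.act (a * c - 2 * b * d) (a * d + b * c) P) = kappa (E.act a b (E.act c d P))"
      using E.act_act[OF level5_closed[OF P]] by simp
    also have "\<dots> = kappa P"
      using that P level5_act[OF P, of c d] unfolding good_def by simp
    finally show "kappa (E.act (a * c - 2 * b * d) (a * d + b * c) P) = kappa P" .
  qed
  have cong: "good a b \<longleftrightarrow> good a' b'" if "a mod 8 = a' mod 8" "b mod 4 = b' mod 4" for a b a' b'
    using level5_act_cong[OF _ that] by (simp add: good_def)
  have g10: "good 1 0"
    using level5_closed by (simp add: good_def E.act_def)
  have g11: "good 1 1"
    using level5_closed kappa_add_phi by (simp add: good_def E.act_def)
  have g1m1: "good 1 (- 1)"
  proof -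
    have "E.act 1 (- 1) P = add P (neg (phi P))" if "level5 P" for P
      using level5_closed[OF that] E.\<phi>_closed[of P]
      by (simp add: E.act_def E.int_pow_neg inv_E carrier_E)
    then show ?thesis
      using kappa_sub_phi by (simp add: good_def)
  qed
  have g13: "good 1 3"
    using g1m1 cong[of 1 1 "- 1" 3] by simp
  have g30: "good 3 0"
    using mult[OF g11 g1m1] by simp
  have g33: "good 3 3"
    using mult[OF g30 g11] by simp
  have g72m: "good (- 1) 2"
    using mult[OF g11 g11] by simp
  have g72: "good 7 2"
    using g72m cong[of "- 1" 7 2 2] by simp
  have g31: "good 3 1"
    using mult[OF g72m g11] cong[of "- 5" 3 1 1] by simp
  have g52: "good 5 2"
    using mult[OF g30 g72m] cong[of "- 3" 5 6 2] by simp
  have pos: "kappa (E.act a b P) = kappa P"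
    if "(a mod 8, b mod 4) \<in> {(1,0),(1,1),(1,3),(3,0),(3,3),(7,2),(3,1),(5,2)}" for a b
  proof -
    have "good (a mod 8) (b mod 4)"
      using that g10 g11 g13 g30 g33 g72 g31 g52 by auto
    then show ?thesis
      using cong[of a "a mod 8" b "b mod 4"] P by (simp add: good_def)
  qed
  have neg: "kappa (E.act a b P) = - kappa (E.act (- a) (- b) P)"
    using E.act_inverse[OF level5_closed[OF P], of a b] level5_act[OF P a, of b]
    by (simp add: inv_E level5_def kappa_neg)
  have a8: "a mod 8 = 1 \<or> a mod 8 = 3 \<or> a mod 8 = 5 \<or> a mod 8 = 7"
    using a by presburger
  have b4: "b mod 4 = 0 \<or> b mod 4 = 1 \<or> b mod 4 = 2 \<or> b mod 4 = 3"
    by presburger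
  have minus: "(- a) mod 8 = (8 - a mod 8) mod 8" "(- b) mod 4 = (4 - b mod 4) mod 4"
  proof -
    have "(m - x mod m) mod m = (- x) mod m" for m x :: int
    proof -
      have "(m - x mod m) mod m = (m + - x) mod m"
        by (simp only: mod_diff_right_eq add_uminus_conv_diff)
      then show ?thesis
        by (simp only: mod_add_self1)
    qed
    then show "(- a) mod 8 = (8 - a mod 8) mod 8" "(- b) mod 4 = (4 - b mod 4) mod 4"
      by metis+
  qed
  show ?thesis
  proof (cases "(a mod 8, b mod 4) \<in> {(1,0),(1,1),(1,3),(3,0),(3,3),(7,2),(3,1),(5,2)}")
    case True
    then have "chi a b = 1"
      by (auto simp: chi_def)
    then show ?thesis
      using pos[OF True] by simp
  next
    case False
    have "((8 - \<alpha>) mod 8, (4 - \<beta>) mod 4) \<in> {(1,0),(1,1),(1,3),(3,0),(3,3),(7,2),(3,1),(5,2)} \<and>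
        (\<alpha> = 1 \<or> \<alpha> = 3) = (\<beta> = 2)"
      if "\<alpha> = 1 \<or> \<alpha> = 3 \<or> \<alpha> = 5 \<or> \<alpha> = 7" "\<beta> = 0 \<or> \<beta> = 1 \<or> \<beta> = 2 \<or> \<beta> = 3"
        "(\<alpha>, \<beta>) \<notin> {(1,0),(1,1),(1,3),(3,0),(3,3),(7,2),(3,1),(5,2)}" for \<alpha> \<beta> :: int
      using that by (elim disjE) simp_all
    from this[OF a8 b4 False]
    have "((- a) mod 8, (- b) mod 4) \<in> {(1,0),(1,1),(1,3),(3,0),(3,3),(7,2),(3,1),(5,2)}"
      "chi a b = - 1"
      unfolding minus chi_def by simp_all
    then show ?thesis
      using pos[of "- a" "- b"] neg by simp
  qed
qed

end

section \<open>Arithmetic of the 2-adic integers\<close>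

lemma z2_residue_numeral [simp]: "z2_residue (numeral k) n = numeral k mod 2 ^ n"
proof -
  have nat: "z2_residue (of_nat m) n = int m mod 2 ^ n" for m
    by (induction m) (auto simp: mod_simps add.commute)
  show ?thesis
    using nat[of "numeral k"] by simp
qed

lemma z2_residue_pow2 [simp]: "z2_residue (2 ^ m) n = 2 ^ m mod 2 ^ n"
  by (induction m) (simp_all add: mod_simps)

lemma z2_residue_mod_le: "m \<le> n \<Longrightarrow> z2_residue a n mod 2 ^ m = z2_residue a m"
proof (induction n)
  case (Suc n)
  show ?case
  proof (cases "m = Suc n")
    case False
    then have "m \<le> n" using Suc.prems by simp
    have "z2_residue a (Suc n) mod 2 ^ n mod 2 ^ m = z2_residue a (Suc n) mod 2 ^ m"
      using \<open>m \<le> n\<close> by (simp add: mod_mod_cancel le_imp_power_dvd)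
    then show ?thesis
      using Suc.IH \<open>m \<le> n\<close> by (simp add: z2_residue_Suc_mod)
  next
    case True
    then show ?thesis
      using z2_residue_mod[of a m] by (simp only:)
  qed
qed simp

lemma pow2_dvd_z2_iff: "2 ^ m dvd (x :: z2) \<longleftrightarrow> z2_residue x m = 0"
proof
  assume x: "z2_residue x m = 0"
  have dvd: "2 ^ m dvd z2_residue x (n + m)" for n
    using z2_residue_mod_le[of m "n + m" x] x by (simp add: dvd_eq_mod_eq_0)
  \<comment> \<open>Division by \<open>2^m\<close> costs \<open>m\<close> binary digits, so level
    \<open>n\<close> of the quotient is read from level \<open>n + m\<close> of
    \<open>x\<close>.\<close>
  define f where "f = (\<lambda>n. z2_residue x (n + m) div 2 ^ m)"
  have f: "2 ^ m * f n = z2_residue x (n + m)" for n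
    using dvd by (simp add: f_def)
  have "f n mod 2 ^ n = f (Suc n) mod 2 ^ n" for n
  proof -
    have "(2 ^ m * f (Suc n)) mod (2 ^ m * 2 ^ n) = (2 ^ m * f n) mod (2 ^ m * 2 ^ n)"
    proof -
      have "2 ^ m * 2 ^ n = (2 :: int) ^ (n + m)"
        by (simp add: power_add mult.commute)
      then show ?thesis
        using z2_residue_mod_le[of "n + m" "Suc n + m" x] z2_residue_mod[of x "n + m"]
        unfolding f by (metis add_Suc le_add2 plus_1_eq_Suc)
    qed
    then show ?thesis
      by (simp only: mult_mod_right[symmetric]) simp
  qed
  then obtain y where y: "\<And>n. z2_residue y n = f n mod 2 ^ n"
    using z2_of_sequence[of f] by metis
  have "x = 2 ^ m * y"
  proof (rule z2_eqI)
    fix n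
    have "z2_residue (2 ^ m * y) n = (2 ^ m * (f n mod 2 ^ n)) mod 2 ^ n"
      by (simp add: y mod_simps)
    also have "\<dots> = z2_residue x (n + m) mod 2 ^ n"
      by (simp add: mod_simps f)
    finally show "z2_residue x n = z2_residue (2 ^ m * y) n"
      by (simp add: z2_residue_mod_le)
  qed
  then show "2 ^ m dvd x" by simp
next
  assume "2 ^ m dvd x"
  then show "z2_residue x m = 0"
    by (auto elim!: dvdE simp: mod_simps)
qed

lemma pow2_dvd_diff_iff: "2 ^ m dvd (x - y :: z2) \<longleftrightarrow> z2_residue x m = z2_residue y m"
  unfolding pow2_dvd_z2_iff z2_residue_simps mod_eq_0_iff_dvd mod_eq_dvd_iff[symmetric] z2_residue_mod ..

lemma z2_dichotomy:
  assumes "2 ^ m dvd (x :: z2)"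
  obtains "2 ^ Suc m dvd x" | "2 ^ Suc m dvd x - 2 ^ m"
proof -
  obtain y where y: "x = 2 ^ m * y"
    using assms by (elim dvdE)
  have "z2_residue y 1 = 0 \<or> z2_residue y 1 = 1"
    using z2_residue_range[of y 1] by auto
  then have "2 ^ 1 dvd y \<or> 2 ^ 1 dvd y - 1"
    unfolding pow2_dvd_z2_iff by auto
  then show ?thesis
  proof
    assume "2 ^ 1 dvd y"
    then show ?thesis
      using that(1) unfolding y by (auto simp: mult.commute mult_dvd_mono)
  next
    assume "2 ^ 1 dvd y - 1"
    then have "2 ^ m * 2 dvd 2 ^ m * (y - 1)"
      by (simp add: mult_dvd_mono)
    then show ?thesis
      using that(2) unfolding y by (simp add: algebra_simps)
  qed
qed

abbreviation z2_odd :: "z2 \<Rightarrow> bool" where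
  "z2_odd x \<equiv> z2_residue x 1 = 1"

lemma z2_not_odd_iff: "\<not> z2_odd x \<longleftrightarrow> 2 dvd x"
  using z2_residue_range[of x 1] pow2_dvd_z2_iff[of 1 x] by auto

lemma odd_residue:
  assumes "z2_odd x" "n > 0"
  shows "odd (z2_residue x n)"
proof -
  have "z2_residue x n mod 2 = 1"
    using z2_residue_mod_le[of 1 n x] assms by simp
  then show ?thesis by presburger
qed

lemma z2_odd_cancel:
  assumes "z2_odd y" "x * y = 0"
  shows "x = 0"
proof (rule z2_eqI)
  fix n
  show "z2_residue x n = z2_residue 0 n"
  proof (cases "n = 0")
    case False
    have "z2_residue (x * y) n = 0"
      using assms(2) by simp
    then have "2 ^ n dvd z2_residue x n * z2_residue y n"
      by (simp add: dvd_eq_mod_eq_0)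
    moreover have "coprime (2 ^ n) (z2_residue y n)"
      using odd_residue[OF assms(1)] False by simp
    ultimately have "2 ^ n dvd z2_residue x n"
      by (simp add: coprime_dvd_mult_left_iff)
    then show ?thesis
      using z2_residue_mod[of x n] by (simp add: dvd_eq_mod_eq_0)
  qed simp
qed

lemma z2_double_eq_0:
  assumes "2 * x = (0 :: z2)"
  shows "x = 0"
proof (rule z2_eqI)
  fix n
  have "z2_residue (2 * x) (Suc n) = 0"
    by (simp only: assms z2_residue_simps)
  then have "(2 * z2_residue x (Suc n)) mod 2 ^ Suc n = 0"
    by (simp only: z2_residue_simps z2_residue_numeral mod_mult_left_eq)
  then have "2 ^ n dvd z2_residue x (Suc n)"
    by (simp add: mod_eq_0_iff_dvd)
  then show "z2_residue x n = z2_residue 0 n"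
    using z2_residue_Suc_mod[of x n] by (simp add: dvd_eq_mod_eq_0)
qed

text \<open>Such an \<open>x\<close> is odd; for \<open>x = 1 + 2 c\<close> the equation becomes
  \<open>c (c + 1) = 0\<close>, and one of the two factors is odd and can be cancelled.\<close>

lemma z2_square_eq_1:
  assumes "x * x = (1 :: z2)"
  shows "x = 1 \<or> x = - 1"
proof -
  have "z2_odd x"
  proof (rule ccontr)
    assume "\<not> z2_odd x"
    then have "2 dvd x * x"
      unfolding z2_not_odd_iff by simp
    then show False
      using pow2_dvd_z2_iff[of 1 1] assms by simp
  qed
  then have "2 ^ 1 dvd x - 1"
    unfolding pow2_dvd_diff_iff by simp
  then obtain c where c: "x = 1 + 2 * c"
    by (metis add.commute diff_add_cancel dvdE power_one_right)
  have "2 * (2 * (c * (c + 1))) = 0"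
    using assms unfolding c by (simp add: algebra_simps)
  then have cc: "c * (c + 1) = 0"
    using z2_double_eq_0 by blast
  show ?thesis
  proof (cases "z2_odd c")
    case True
    then have "c + 1 = 0"
      using z2_odd_cancel[of c "c + 1"] cc by (simp add: mult.commute)
    then have "c = - 1"
      by (simp add: eq_neg_iff_add_eq_0)
    then show ?thesis
      by (simp add: c)
  next
    case False
    then have "z2_odd (c + 1)"
      using z2_residue_range[of c 1] by auto
    then show ?thesis
      using z2_odd_cancel[OF _ cc] by (simp add: c)
  qed
qed

section \<open>Closed subgroups of \<open>GL(2, \<int>\<^sub>2)\<close>\<close>

definition mat_cong :: "nat \<Rightarrow> z2^2^2 \<Rightarrow> z2^2^2 \<Rightarrow> bool" where
  "mat_cong k M N \<longleftrightarrow> (\<forall>i j. z2_residue (M $ i $ j) k = z2_residue (N $ i $ j) k)"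

text \<open>Topological closedness in terms of congruences; \<open>closedin_iff_limit_closed\<close>
  proves the equivalence.\<close>

definition limit_closed :: "(z2^2^2) set \<Rightarrow> bool" where
  "limit_closed S \<longleftrightarrow> S \<subseteq> carrier GL2_Z2 \<and>
     (\<forall>M\<in>carrier GL2_Z2. (\<forall>k. \<exists>N\<in>S. mat_cong k M N) \<longrightarrow> M \<in> S)"

lemma mat_cong_sym: "mat_cong k M N \<Longrightarrow> mat_cong k N M"
  by (simp add: mat_cong_def)

lemma mat_cong_trans: "mat_cong k M N \<Longrightarrow> mat_cong k N P \<Longrightarrow> mat_cong k M P"
  by (simp add: mat_cong_def)

lemma mat_cong_le: "k \<le> l \<Longrightarrow> mat_cong l M N \<Longrightarrow> mat_cong k M N"
  unfolding mat_cong_def using z2_residue_le by blast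

lemma mat_cong_mult:
  assumes "mat_cong k M M'" "mat_cong k N N'"
  shows "mat_cong k (M ** N) (M' ** N')"
  using assms unfolding mat_cong_def mat2_mult_component by simp

lemma open_mat_cong: "open {N. mat_cong k M N}"
proof -
  have z: "open {y. z2_residue x k = z2_residue y k}" for x
    unfolding open_z2_def by (metis mem_Collect_eq)
  have v: "open {w. \<forall>j. z2_residue (v $ j) k = z2_residue (w $ j) k}" for v :: "z2^2"
  proof (subst open_vec_def, intro ballI)
    fix w assume w: "w \<in> {w. \<forall>j. z2_residue (v $ j) k = z2_residue (w $ j) k}"
    show "\<exists>A. (\<forall>i. open (A i) \<and> w $ i \<in> A i) \<and>
        (\<forall>y. (\<forall>i. y $ i \<in> A i) \<longrightarrow> y \<in> {w. \<forall>j. z2_residue (v $ j) k = z2_residue (w $ j) k})"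
      by (rule exI[of _ "\<lambda>j. {y. z2_residue (v $ j) k = z2_residue y k}"]) (use z w in simp)
  qed
  show ?thesis
  proof (subst open_vec_def, intro ballI)
    fix N assume N: "N \<in> {N. mat_cong k M N}"
    show "\<exists>A. (\<forall>i. open (A i) \<and> N $ i \<in> A i) \<and>
        (\<forall>y. (\<forall>i. y $ i \<in> A i) \<longrightarrow> y \<in> {N. mat_cong k M N})"
      by (rule exI[of _ "\<lambda>i. {w. \<forall>j. z2_residue (M $ i $ j) k = z2_residue (w $ j) k}"])
        (use v N in \<open>auto simp: mat_cong_def\<close>)
  qed
qed

lemma open_contains_mat_cong:
  assumes "open U" "M \<in> U"
  obtains k where "{N. mat_cong k M N} \<subseteq> U"
proof -
  have z: "\<exists>k. \<forall>y. z2_residue y k = z2_residue x k \<longrightarrow> y \<in> V" if "open V" "x \<in> V" for x V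
    using that unfolding open_z2_def by blast
  have v: "\<exists>k. \<forall>w. (\<forall>j. z2_residue (w $ j) k = z2_residue (v $ j) k) \<longrightarrow> w \<in> V"
    if V: "open V" "v \<in> V" for v :: "z2^2" and V
  proof -
    obtain A where "\<forall>i. open (A i) \<and> v $ i \<in> A i" "\<forall>y. (\<forall>i. y $ i \<in> A i) \<longrightarrow> y \<in> V"
      using open_vec_def[THEN iffD1, OF V(1), rule_format, OF V(2)] by (elim exE conjE)
    then have A: "\<And>i. open (A i)" "\<And>i. v $ i \<in> A i" "\<And>y. (\<forall>i. y $ i \<in> A i) \<Longrightarrow> y \<in> V"
      by simp_all
    obtain k where k: "\<And>i y. z2_residue y (k i) = z2_residue (v $ i) (k i) \<Longrightarrow> y \<in> A i"
      using z[OF A(1,2)] by metis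
    show ?thesis
    proof (intro exI allI impI)
      fix w assume w: "\<forall>j. z2_residue (w $ j) (max (k 1) (k 2)) = z2_residue (v $ j) (max (k 1) (k 2))"
      have "w $ i \<in> A i" for i
        using k[of "w $ i" i] z2_residue_le[of "k i" "max (k 1) (k 2)" "w $ i" "v $ i"] w exhaust_2[of i]
        by auto
      then show "w \<in> V"
        using A(3) by blast
    qed
  qed
  obtain A where "\<forall>i. open (A i) \<and> M $ i \<in> A i" "\<forall>y. (\<forall>i. y $ i \<in> A i) \<longrightarrow> y \<in> U"
    using open_vec_def[THEN iffD1, OF assms(1), rule_format, OF assms(2)] by (elim exE conjE)
  then have A: "\<And>i. open (A i)" "\<And>i. M $ i \<in> A i" "\<And>y. (\<forall>i. y $ i \<in> A i) \<Longrightarrow> y \<in> U"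
    by simp_all
  obtain k where k: "\<And>i w. (\<forall>j. z2_residue (w $ j) (k i) = z2_residue (M $ i $ j) (k i)) \<Longrightarrow> w \<in> A i"
    using v[OF A(1,2)] by metis
  show ?thesis
  proof (rule that[of "max (k 1) (k 2)"], rule subsetI)
    fix N assume N: "N \<in> {N. mat_cong (max (k 1) (k 2)) M N}"
    have "N $ i \<in> A i" for i
    proof (rule k, rule allI)
      fix j
      show "z2_residue (N $ i $ j) (k i) = z2_residue (M $ i $ j) (k i)"
        using z2_residue_le[of "k i" "max (k 1) (k 2)" "N $ i $ j" "M $ i $ j"] N exhaust_2[of i]
        by (auto simp: mat_cong_def)
    qed
    then show "N \<in> U"
      using A(3) by blast
  qed
qed

lemma closedin_iff_limit_closed:
  assumes "S \<subseteq> carrier GL2_Z2"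
  shows "closedin (top_of_set (carrier GL2_Z2)) S \<longleftrightarrow> limit_closed S"
proof
  assume "closedin (top_of_set (carrier GL2_Z2)) S"
  then obtain T where T: "closed T" "S = carrier GL2_Z2 \<inter> T"
    unfolding closedin_closed by blast
  have "M \<in> S" if M: "M \<in> carrier GL2_Z2" "\<forall>k. \<exists>N\<in>S. mat_cong k M N" for M
  proof (rule ccontr)
    assume "M \<notin> S"
    then have "M \<in> - T" "open (- T)"
      using M(1) T by auto
    then obtain k where "{N. mat_cong k M N} \<subseteq> - T"
      using open_contains_mat_cong by metis
    then show False
      using M(2) T(2) by blast
  qed
  then show "limit_closed S"
    using assms by (simp add: limit_closed_def)
next
  assume S: "limit_closed S"
  define T where "T = {M. \<forall>k. \<exists>N\<in>S. mat_cong k M N}"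
  have "open (- T)"
  proof (subst open_subopen, intro ballI)
    fix M assume "M \<in> - T"
    then obtain k where k: "\<forall>N\<in>S. \<not> mat_cong k M N"
      by (auto simp: T_def)
    have "{N. mat_cong k M N} \<subseteq> - T"
      using k mat_cong_trans unfolding T_def by blast
    then show "\<exists>U. open U \<and> M \<in> U \<and> U \<subseteq> - T"
      using open_mat_cong by (intro exI[of _ "{N. mat_cong k M N}"]) (auto simp: mat_cong_def)
  qed
  then have "closed T"
    by (simp add: closed_def)
  moreover have "S = carrier GL2_Z2 \<inter> T"
    using S unfolding T_def limit_closed_def by (auto simp: mat_cong_def)
  ultimately show "closedin (top_of_set (carrier GL2_Z2)) S"
    unfolding closedin_closed by blast
qed

lemma GL2_simps [simp]:
  "M \<otimes>\<^bsub>GL2_Z2\<^esub> N = M ** N" "\<one>\<^bsub>GL2_Z2\<^esub> = mat 1" "M \<in> carrier GL2_Z2 \<longleftrightarrow> invertible M"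
  by (simp_all add: GL2_Z2_def)

interpretation GL2: group GL2_Z2
  by (rule group_GL2_Z2)

lemma closed_subgroup_generated_eqI:
  assumes K: "subgroup K GL2_Z2" "limit_closed K" "S \<subseteq> K"
    and min: "\<And>L. subgroup L GL2_Z2 \<Longrightarrow> limit_closed L \<Longrightarrow> S \<subseteq> L \<Longrightarrow> K \<subseteq> L"
  shows "closed_subgroup_generated S = K"
proof -
  have iff: "subgroup L GL2_Z2 \<and> closedin (top_of_set (carrier GL2_Z2)) L \<and> S \<subseteq> L \<longleftrightarrow>
      subgroup L GL2_Z2 \<and> limit_closed L \<and> S \<subseteq> L" for L
    using closedin_iff_limit_closed[OF subgroup.subset] by blast
  show ?thesis
    unfolding closed_subgroup_generated_def iff using K min by blast
qed

lemma closed_subgroup_generated_superset: "S \<subseteq> closed_subgroup_generated S"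
  unfolding closed_subgroup_generated_def by blast

lemma closed_subgroup_generated_subset:
  assumes "subgroup L GL2_Z2" "limit_closed L" "S \<subseteq> L"
  shows "closed_subgroup_generated S \<subseteq> L"
  unfolding closed_subgroup_generated_def
  using assms closedin_iff_limit_closed[OF subgroup.subset[OF assms(1)]] by blast

section \<open>The normalizer of the Cartan subgroup and its subgroups of index 2\<close>

lemma mat2_nth [simp]:
  "mat2 a b c d $ 1 $ 1 = a" "mat2 a b c d $ 1 $ 2 = b" "mat2 a b c d $ 2 $ 1 = c" "mat2 a b c d $ 2 $ 2 = d"
  by (simp_all add: mat2_def)

lemma mat_1_nth [simp]:
  "(mat 1 :: z2^2^2) $ 1 $ 1 = 1" "(mat 1 :: z2^2^2) $ 1 $ 2 = 0"
  "(mat 1 :: z2^2^2) $ 2 $ 1 = 0" "(mat 1 :: z2^2^2) $ 2 $ 2 = 1"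
  by (simp_all add: mat_def)

text \<open>Multiplication by \<open>a + b w\<close> in the basis \<open>(w Q, Q)\<close>.\<close>

definition cmat :: "z2 \<Rightarrow> z2 \<Rightarrow> z2^2^2" where
  "cmat a b = mat2 a b (- 2 * b) a"

definition in_C :: "z2^2^2 \<Rightarrow> bool" where
  "in_C M \<longleftrightarrow> M $ 1 $ 1 = M $ 2 $ 2 \<and> M $ 2 $ 1 = - 2 * M $ 1 $ 2"

text \<open>Anticommutation with \<open>w\<close>, just as \<open>in_C\<close> is commutation with
  \<open>w\<close>; see \<open>in_A_iff\<close> and \<open>in_C_iff\<close>.\<close>

definition in_A :: "z2^2^2 \<Rightarrow> bool" where
  "in_A M \<longleftrightarrow> M $ 1 $ 1 = - M $ 2 $ 2 \<and> M $ 2 $ 1 = 2 * M $ 1 $ 2"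

definition normC :: "(z2^2^2) set" where
  "normC = {M. invertible M \<and> (in_C M \<or> in_A M)}"

lemma in_C_cmat: "in_C M \<Longrightarrow> M = cmat (M $ 2 $ 2) (M $ 1 $ 2)"
  by (rule mat2_eqI) (simp_all add: in_C_def cmat_def)

lemma cmat_in_C [simp]: "in_C (cmat a b)"
  by (simp add: in_C_def cmat_def)

lemma cmat_nth [simp]: "cmat a b $ 2 $ 2 = a" "cmat a b $ 1 $ 2 = b" "cmat a b $ 1 $ 1 = a" "cmat a b $ 2 $ 1 = - 2 * b"
  by (simp_all add: cmat_def)

lemma cmat_mult: "cmat a b ** cmat c d = cmat (a * c - 2 * b * d) (a * d + b * c)"
  by (rule mat2_eqI) (simp_all add: mat2_mult_component algebra_simps)

lemma cmat_1: "cmat 1 0 = mat 1"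
  by (rule mat2_eqI) simp_all

lemma z2_odd_det:
  assumes "invertible (M :: z2^2^2)"
  shows "z2_odd (M $ 1 $ 1 * M $ 2 $ 2 - M $ 1 $ 2 * M $ 2 $ 1)"
proof (rule ccontr)
  assume "\<not> ?thesis"
  then have even: "2 dvd det M"
    unfolding z2_not_odd_iff det_2 .
  obtain M' where "M ** M' = mat 1"
    using assms by (auto simp: invertible_def)
  then have "det M * det M' = 1"
    by (metis det_I det_mul)
  then have "2 dvd (1 :: z2)"
    using even by (metis dvd_mult2)
  then show False
    using pow2_dvd_z2_iff[of 1 1] by simp
qed

text \<open>The entry below the diagonal is even, so an odd determinant forces an odd
  diagonal.\<close>

lemma normC_odd:
  assumes "M \<in> normC"
  shows "z2_odd (M $ 2 $ 2)"
proof (rule ccontr)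
  assume "\<not> z2_odd (M $ 2 $ 2)"
  then have 0: "z2_residue (M $ 2 $ 2) 1 = 0"
    using z2_residue_range[of "M $ 2 $ 2" 1] by auto
  have "z2_odd (M $ 1 $ 1 * M $ 2 $ 2 - M $ 1 $ 2 * M $ 2 $ 1)"
    using assms z2_odd_det by (simp add: normC_def)
  moreover have "z2_residue (M $ 2 $ 1) 1 = 0"
    using assms by (auto simp: normC_def in_C_def in_A_def)
  ultimately show False
    using 0 by simp
qed

lemma not_in_C_and_A:
  assumes "M \<in> normC"
  shows "in_C M \<longleftrightarrow> \<not> in_A M"
proof -
  have False if "in_C M" "in_A M"
  proof -
    have "M $ 2 $ 2 = - M $ 2 $ 2"
      using that unfolding in_C_def in_A_def by metis
    then have "2 * M $ 2 $ 2 = 0"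
      by (metis mult_2 right_minus)
    then show False
      using z2_double_eq_0[of "M $ 2 $ 2"] normC_odd[OF assms] by simp
  qed
  then show ?thesis
    using assms by (auto simp: normC_def)
qed

lemma in_C_A_mult:
  fixes M N :: "z2^2^2"
  shows "in_C M \<Longrightarrow> in_C N \<Longrightarrow> in_C (M ** N)"
  "in_C M \<Longrightarrow> in_A N \<Longrightarrow> in_A (M ** N)"
  "in_A M \<Longrightarrow> in_C N \<Longrightarrow> in_A (M ** N)"
  "in_A M \<Longrightarrow> in_A N \<Longrightarrow> in_C (M ** N)"
  by (simp_all add: in_C_def in_A_def mat2_mult_component algebra_simps)

lemma invertible_mult2:
  fixes M N :: "z2^2^2"
  shows "invertible M \<Longrightarrow> invertible N \<Longrightarrow> invertible (M ** N)"
  using GL2.m_closed[of M N] by simp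

lemma normC_mult: "M \<in> normC \<Longrightarrow> N \<in> normC \<Longrightarrow> M ** N \<in> normC"
  using in_C_A_mult invertible_mult2 unfolding normC_def by blast

lemma normC_1 [simp]: "mat 1 \<in> normC"
  by (auto simp: normC_def in_C_def invertible_def)

text \<open>As intertwining relations, the two types pass to inverses through
  \<open>intertwine_inverse\<close>.\<close>

lemma in_C_iff: "in_C M \<longleftrightarrow> M ** cmat 0 1 = cmat 0 1 ** M"
  and in_A_iff: "in_A M \<longleftrightarrow> M ** cmat 0 1 = cmat 0 (- 1) ** M"
  and in_A_iff': "in_A M \<longleftrightarrow> M ** cmat 0 (- 1) = cmat 0 1 ** M"
proof -
  have eq: "A = B \<longleftrightarrow> A $ 1 $ 1 = B $ 1 $ 1 \<and> A $ 1 $ 2 = B $ 1 $ 2 \<and> A $ 2 $ 1 = B $ 2 $ 1 \<and> A $ 2 $ 2 = B $ 2 $ 2"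
    for A B :: "z2^2^2"
    using mat2_eqI by blast
  show "in_C M \<longleftrightarrow> M ** cmat 0 1 = cmat 0 1 ** M"
    unfolding eq in_C_def by (auto simp: mat2_mult_component)
  show "in_A M \<longleftrightarrow> M ** cmat 0 1 = cmat 0 (- 1) ** M"
    unfolding eq in_A_def by (auto simp: mat2_mult_component minus_equation_iff[of "M $ 1 $ 1"])
  show "in_A M \<longleftrightarrow> M ** cmat 0 (- 1) = cmat 0 1 ** M"
    unfolding eq in_A_def by (auto simp: mat2_mult_component minus_equation_iff[of "M $ 1 $ 1"])
qed

lemma GL2_inv:
  assumes "invertible M"
  shows "M ** inv\<^bsub>GL2_Z2\<^esub> M = mat 1" "inv\<^bsub>GL2_Z2\<^esub> M ** M = mat 1" "invertible (inv\<^bsub>GL2_Z2\<^esub> M)"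
  using GL2.r_inv[of M] GL2.l_inv[of M] GL2.inv_closed[of M] assms by simp_all

lemma intertwine_inverse:
  fixes M M' P Q :: "z2^2^2"
  assumes "M ** M' = mat 1" "M' ** M = mat 1" "M ** P = Q ** M"
  shows "M' ** Q = P ** M'"
proof -
  have "M' ** Q = M' ** (Q ** M) ** M'"
    using assms(1) by (simp flip: matrix_mul_assoc)
  also have "\<dots> = (M' ** M) ** P ** M'"
    unfolding assms(3)[symmetric] by (simp add: matrix_mul_assoc)
  finally show ?thesis
    using assms(2) by simp
qed

lemma normC_inv: "M \<in> normC \<Longrightarrow> inv\<^bsub>GL2_Z2\<^esub> M \<in> normC"
proof -
  assume M: "M \<in> normC"
  then have inv: "invertible M" by (simp add: normC_def)
  have "in_C (inv\<^bsub>GL2_Z2\<^esub> M)" if "in_C M"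
    using intertwine_inverse[OF GL2_inv(1,2)[OF inv]] that unfolding in_C_iff by simp
  moreover have "in_A (inv\<^bsub>GL2_Z2\<^esub> M)" if "in_A M"
    using intertwine_inverse[OF GL2_inv(1,2)[OF inv], of "cmat 0 1" "cmat 0 (- 1)"] that
    unfolding in_A_iff' by (simp flip: in_A_iff in_A_iff')
  ultimately show ?thesis
    using M GL2_inv(3)[OF inv] by (auto simp: normC_def)
qed

lemma subgroup_normC: "subgroup normC GL2_Z2"
proof (rule GL2.subgroupI)
  show "normC \<subseteq> carrier GL2_Z2"
    by (auto simp: normC_def)
  show "normC \<noteq> {}"
    using normC_1 by blast
qed (simp_all add: normC_inv normC_mult)

subsection \<open>Quadratic characters\<close>

lemma chi_mod: "chi (a mod 8) (b mod 4) = chi a b"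
  by (simp add: chi_def)

lemma chi_cong: "a mod 8 = a' mod 8 \<Longrightarrow> b mod 4 = b' mod 4 \<Longrightarrow> chi a b = chi a' b'"
  by (simp add: chi_def)

lemma chi_finite:
  "\<forall>a\<in>{1, 3, 5, 7}. \<forall>b\<in>{0, 1, 2, 3}. \<forall>c\<in>{1, 3, 5, 7}. \<forall>d\<in>{0, 1, 2, 3}.
     chi (a * c - 2 * b * d) (a * d + b * c) = chi a b * chi c d"
  unfolding chi_def by code_simp

text \<open>The real and the \<open>w\<close> component of a product depend modulo 8 and 4 only on
  the classes of the factors, because \<open>2 * 4 = 8\<close>. What remains is the finite table
  \<open>chi_finite\<close>.\<close>

lemma chi_mult:
  assumes "odd a" "odd c"
  shows "chi (a * c - 2 * b * d) (a * d + b * c) = chi a b * chi c d"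
proof -
  define a' c' b' d' where "a' = a mod 8" "c' = c mod 8" "b' = b mod 4" "d' = d mod 4"
  then have e: "a = 8 * (a div 8) + a'" "c = 8 * (c div 8) + c'" "b = 4 * (b div 4) + b'" "d = 4 * (d div 4) + d'"
    by simp_all
  have "(a * c - 2 * b * d) - (a' * c' - 2 * b' * d') =
      8 * (8 * (a div 8) * (c div 8) + (a div 8) * c' + (c div 8) * a' - 4 * (b div 4) * (d div 4)
        - (b div 4) * d' - (d div 4) * b')"
    by (subst e(1), subst e(2), subst e(3), subst e(4)) (simp add: algebra_simps)
  then have m: "(a * c - 2 * b * d) mod 8 = (a' * c' - 2 * b' * d') mod 8"
    unfolding mod_eq_dvd_iff by simp
  have "(a * d + b * c) - (a' * d' + b' * c') =
      4 * (8 * (a div 8) * (d div 4) + 2 * (a div 8) * d' + (d div 4) * a' + 8 * (b div 4) * (c div 8)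
        + (b div 4) * c' + 2 * (c div 8) * b')"
    by (subst e(1), subst e(2), subst e(3), subst e(4)) (simp add: algebra_simps)
  then have n: "(a * d + b * c) mod 4 = (a' * d' + b' * c') mod 4"
    unfolding mod_eq_dvd_iff by simp
  have "chi (a * c - 2 * b * d) (a * d + b * c) =
      chi (a' * c' - 2 * b' * d') (a' * d' + b' * c')"
    using m n by (rule chi_cong)
  also have "\<dots> = chi a' b' * chi c' d'"
  proof -
    have "x mod 8 \<in> {1, 3, 5, 7}" if "odd x" for x :: int
    proof -
      have "x mod 8 = 1 \<or> x mod 8 = 3 \<or> x mod 8 = 5 \<or> x mod 8 = 7"
        using that by presburger
      then show ?thesis by simp
    qed
    moreover have "x mod 4 \<in> {0, 1, 2, 3}" for x :: int
    proof -
      have "x mod 4 = 0 \<or> x mod 4 = 1 \<or> x mod 4 = 2 \<or> x mod 4 = 3"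
        by presburger
      then show ?thesis by simp
    qed
    ultimately show ?thesis
      using chi_finite assms unfolding \<open>a' = a mod 8\<close> \<open>c' = c mod 8\<close> \<open>b' = b mod 4\<close> \<open>d' = d mod 4\<close>
      by blast
  qed
  finally show ?thesis
    unfolding \<open>a' = a mod 8\<close> \<open>c' = c mod 8\<close> \<open>b' = b mod 4\<close> \<open>d' = d mod 4\<close> chi_mod .
qed

lemma chi_minus_right: "chi a (- b) = chi a b"
proof -
  have "(- b) mod 4 = 2 \<longleftrightarrow> b mod 4 = 2"
    by presburger
  then show ?thesis by (simp add: chi_def)
qed

definition chi2 :: "z2 \<Rightarrow> z2 \<Rightarrow> int" where
  "chi2 a b = chi (z2_residue a 3) (z2_residue b 2)"

lemma chi2_eq: "chi2 a b = chi (z2_residue a 3) (z2_residue b 3)"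
  unfolding chi2_def using z2_residue_mod_le[of 2 3 b] by (intro chi_cong) simp_all

lemma chi2_mult:
  assumes "z2_odd a" "z2_odd c"
  shows "chi2 (a * c - 2 * b * d) (a * d + b * c) = chi2 a b * chi2 c d"
proof -
  define p where "p = z2_residue a 3 * z2_residue c 3 - 2 * z2_residue b 3 * z2_residue d 3"
  define q where "q = z2_residue a 3 * z2_residue d 3 + z2_residue b 3 * z2_residue c 3"
  have pq: "z2_residue (a * c - 2 * b * d) 3 = p mod 2 ^ 3" "z2_residue (a * d + b * c) 3 = q mod 2 ^ 3"
  proof -
    show "z2_residue (a * c - 2 * b * d) 3 = p mod 2 ^ 3" "z2_residue (a * d + b * c) 3 = q mod 2 ^ 3"
      unfolding p_def q_def z2_residue_simps z2_residue_numeral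
      by (simp_all only: mod_mult_left_eq mod_mult_right_eq mod_diff_left_eq mod_diff_right_eq mod_add_left_eq mod_add_right_eq)
  qed
  have "(2 :: int) ^ 3 = 8"
    by simp
  then have "chi2 (a * c - 2 * b * d) (a * d + b * c) = chi (p mod 8) (q mod 8)"
    unfolding chi2_eq pq by (simp only:)
  also have "\<dots> = chi p q"
    by (rule chi_cong) (simp_all add: mod_mod_cancel)
  also have "\<dots> = chi2 a b * chi2 c d"
    unfolding p_def q_def chi2_eq using odd_residue[OF assms(1), of 3] odd_residue[OF assms(2), of 3]
    by (simp add: chi_mult)
  finally show ?thesis .
qed

lemma chi2_minus_right: "chi2 a (- b) = chi2 a b"
  unfolding chi2_def using chi_minus_right[of "z2_residue a 3" "z2_residue b 2"]
    chi_cong[of "z2_residue a 3" "z2_residue a 3" "- z2_residue b 2 mod 4" "- z2_residue b 2"] by simp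

text \<open>The second column says that \<open>M\<close> sends \<open>Q\<close> to
  \<open>(a + b w) Q\<close>. This makes sense on both types of matrices, so the character is
  defined on the whole normalizer.\<close>

definition chi_mat :: "z2^2^2 \<Rightarrow> int" where
  "chi_mat M = chi2 (M $ 2 $ 2) (M $ 1 $ 2)"

definition beta_mat :: "z2^2^2 \<Rightarrow> int" where
  "beta_mat M = (if z2_odd (M $ 1 $ 2) then - 1 else 1)"

definition gamma_mat :: "z2^2^2 \<Rightarrow> int" where
  "gamma_mat M = (if in_C M then 1 else - 1)"

text \<open>The kernels of the four characters \<open>psi i j\<close> are, up to conjugation, the images for \<open>d = 2, -1, 1, -2\<close>,
  in this order of \<open>(i, j) = (False, False), (False, True), (True, False), (True, True)\<close>.\<close>

definition psi :: "bool \<Rightarrow> bool \<Rightarrow> z2^2^2 \<Rightarrow> int" where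
  "psi i j M = chi_mat M * gamma_mat M * (if i then beta_mat M else 1) * (if j then gamma_mat M else 1)"

definition normC_index2 :: "bool \<Rightarrow> bool \<Rightarrow> (z2^2^2) set" where
  "normC_index2 i j = {M \<in> normC. psi i j M = 1}"

lemma gamma_mat_mult: "M \<in> normC \<Longrightarrow> N \<in> normC \<Longrightarrow> gamma_mat (M ** N) = gamma_mat M * gamma_mat N"
  using in_C_A_mult[of M N] not_in_C_and_A normC_mult[of M N] unfolding gamma_mat_def by auto

text \<open>The upper right entry of the product is \<open>M11 * N12 + M12 * N22\<close> with
  \<open>M11\<close> and \<open>N22\<close> odd, so parities add.\<close>

lemma beta_mat_mult:
  assumes "M \<in> normC" "N \<in> normC"
  shows "beta_mat (M ** N) = beta_mat M * beta_mat N"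
proof -
  have "z2_odd (M $ 1 $ 1)"
    using assms(1) normC_odd[OF assms(1)] by (auto simp: normC_def in_C_def in_A_def)
  then show ?thesis
    using normC_odd[OF assms(2)] z2_residue_range[of "M $ 1 $ 2" 1] z2_residue_range[of "N $ 1 $ 2" 1]
    unfolding beta_mat_def mat2_mult_component by auto
qed

text \<open>If \<open>M\<close> anticommutes with \<open>w\<close>, then \<open>M\<close> applied to
  \<open>(c + d w) Q\<close> is \<open>(c - d w) M Q\<close>, and \<open>chi\<close> is invariant
  under conjugation.\<close>

lemma chi_mat_mult:
  assumes "M \<in> normC" "N \<in> normC"
  shows "chi_mat (M ** N) = chi_mat M * chi_mat N"
proof (cases "in_C M")
  case True
  then show ?thesis
    using chi2_mult[OF normC_odd[OF assms(1)] normC_odd[OF assms(2)], of "M $ 1 $ 2" "N $ 1 $ 2"]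
    unfolding chi_mat_def mat2_mult_component in_C_def by (simp add: algebra_simps)
next
  case False
  then have A: "in_A M"
    using assms(1) by (simp add: normC_def)
  have "chi2 (M $ 2 $ 2 * N $ 2 $ 2 - 2 * M $ 1 $ 2 * - (N $ 1 $ 2)) (M $ 2 $ 2 * - (N $ 1 $ 2) + M $ 1 $ 2 * N $ 2 $ 2)
      = chi_mat M * chi_mat N"
    unfolding chi2_mult[OF normC_odd[OF assms(1)] normC_odd[OF assms(2)]] chi2_minus_right chi_mat_def ..
  then show ?thesis
    using A unfolding chi_mat_def mat2_mult_component in_A_def by (simp add: algebra_simps)
qed

lemma psi_mult: "M \<in> normC \<Longrightarrow> N \<in> normC \<Longrightarrow> psi i j (M ** N) = psi i j M * psi i j N"
  unfolding psi_def by (simp add: chi_mat_mult beta_mat_mult gamma_mat_mult)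

lemma psi_1 [simp]: "psi i j (mat 1) = 1"
proof -
  have "in_C (mat 1)"
    by (simp add: in_C_def)
  then show ?thesis
    by (simp add: psi_def chi_mat_def chi2_def chi_def beta_mat_def gamma_mat_def)
qed

lemma psi_inv:
  assumes "M \<in> normC"
  shows "psi i j M * psi i j (inv\<^bsub>GL2_Z2\<^esub> M) = 1"
  using psi_mult[OF assms normC_inv[OF assms], of i j] GL2_inv(1)[of M] assms by (simp add: normC_def)

lemma psi_values: "psi i j M = 1 \<or> psi i j M = - 1"
  by (simp add: psi_def chi_mat_def chi2_def chi_def beta_mat_def gamma_mat_def)

lemma subgroup_normC_index2: "subgroup (normC_index2 i j) GL2_Z2"
proof (rule GL2.subgroupI)
  show "normC_index2 i j \<subseteq> carrier GL2_Z2"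
    by (auto simp: normC_index2_def normC_def)
  have "mat 1 \<in> normC_index2 i j"
    by (simp add: normC_index2_def)
  then show "normC_index2 i j \<noteq> {}" by blast
  show "inv\<^bsub>GL2_Z2\<^esub> M \<in> normC_index2 i j" if "M \<in> normC_index2 i j" for M
    using that psi_inv[of M i j] normC_inv[of M] by (simp add: normC_index2_def)
qed (auto simp: normC_index2_def normC_mult psi_mult)

text \<open>Either elements of type \<open>in_C\<close> approximate \<open>M\<close> at every level,
  or from some level on only \<open>in_A\<close> ones do; each type is given by equations and hence
  closed. Agreement modulo 8 together with the type determines \<open>psi\<close>.\<close>

lemma limit_in_normC:
  assumes M: "invertible M" and lim: "\<And>k. \<exists>N\<in>S. mat_cong k M N" and S: "S \<subseteq> normC"
  obtains N where "M \<in> normC" "N \<in> S" "mat_cong 3 M N" "in_C N \<longleftrightarrow> in_C M"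
proof -
  have entries: "z2_residue (M $ a $ b) k = z2_residue (N $ a $ b) k" if "mat_cong k M N" for N a b k
    using that by (simp add: mat_cong_def)
  show ?thesis
  proof (cases "\<forall>k. \<exists>N\<in>S. mat_cong k M N \<and> in_C N")
    case True
    have "in_C M"
      unfolding in_C_def
    proof (intro conjI z2_eqI)
      fix k
      obtain N where N: "mat_cong k M N" "in_C N"
        using True by blast
      show "z2_residue (M $ 1 $ 1) k = z2_residue (M $ 2 $ 2) k"
        "z2_residue (M $ 2 $ 1) k = z2_residue (- 2 * M $ 1 $ 2) k"
        using N(2) entries[OF N(1)] by (simp_all add: in_C_def)
    qed
    moreover obtain N where "N \<in> S" "mat_cong 3 M N" "in_C N"
      using True by blast
    ultimately show ?thesis
      using that M by (auto simp: normC_def)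
  next
    case False
    then obtain k0 where k0: "\<And>N. N \<in> S \<Longrightarrow> mat_cong k0 M N \<Longrightarrow> \<not> in_C N" by blast
    have ex: "\<exists>N\<in>S. mat_cong k M N \<and> in_A N \<and> \<not> in_C N" for k
    proof -
      obtain N where N: "N \<in> S" "mat_cong (max k k0) M N"
        using lim by blast
      then have "mat_cong k M N" "mat_cong k0 M N"
        using mat_cong_le[of _ "max k k0"] by simp_all
      then show ?thesis
        using N(1) k0 S by (auto simp: normC_def)
    qed
    have "in_A M"
      unfolding in_A_def
    proof (intro conjI z2_eqI)
      fix k
      obtain N where N: "mat_cong k M N" "in_A N"
        using ex by blast
      show "z2_residue (M $ 1 $ 1) k = z2_residue (- M $ 2 $ 2) k"
        "z2_residue (M $ 2 $ 1) k = z2_residue (2 * M $ 1 $ 2) k"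
        using N(2) entries[OF N(1)] by (simp_all add: in_A_def)
    qed
    then have MN: "M \<in> normC" "\<not> in_C M"
      using M not_in_C_and_A[of M] by (auto simp: normC_def)
    obtain N where "N \<in> S" "mat_cong 3 M N" "\<not> in_C N"
      using ex by blast
    then show ?thesis
      using that MN by blast
  qed
qed

lemma limit_closed_normC: "limit_closed normC"
proof -
  have "M \<in> normC" if "invertible M" "\<forall>k. \<exists>N\<in>normC. mat_cong k M N" for M
    using limit_in_normC[of M normC] that by blast
  then show ?thesis
    by (auto simp: limit_closed_def normC_def)
qed

lemma psi_mat_cong:
  assumes "mat_cong 3 M N" "in_C N \<longleftrightarrow> in_C M"
  shows "psi i j M = psi i j N"
proof -
  have e: "z2_residue (M $ a $ b) k = z2_residue (N $ a $ b) k" if "k \<le> 3" for a b k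
    using mat_cong_le[OF that assms(1)] by (simp add: mat_cong_def)
  then show ?thesis
    using assms(2) by (simp add: psi_def chi_mat_def chi2_def beta_mat_def gamma_mat_def)
qed

lemma limit_closed_normC_index2: "limit_closed (normC_index2 i j)"
proof -
  have "M \<in> normC_index2 i j" if M: "invertible M" "\<forall>k. \<exists>N\<in>normC_index2 i j. mat_cong k M N" for M
  proof -
    have "normC_index2 i j \<subseteq> normC"
      by (auto simp: normC_index2_def)
    then obtain N where "M \<in> normC" "N \<in> normC_index2 i j" "mat_cong 3 M N" "in_C N \<longleftrightarrow> in_C M"
      using limit_in_normC[of M "normC_index2 i j"] M by blast
    then show ?thesis
      using psi_mat_cong[of M N i j] by (simp add: normC_index2_def)
  qed
  then show ?thesis
    by (auto simp: limit_closed_def normC_index2_def normC_def)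
qed

subsection \<open>Topological generators\<close>

text \<open>Congruence to 1 modulo a power of \<open>w\<close>: the exponents
  \<open>(m + 1, m)\<close> stand for \<open>w^(2 m + 1)\<close> and \<open>(m + 1, m + 1)\<close>
  for \<open>w^(2 m + 2)\<close>. In particular \<open>(3, 2)\<close> is \<open>w^5\<close>.\<close>

definition near_one :: "nat \<Rightarrow> nat \<Rightarrow> z2^2^2 \<Rightarrow> bool" where
  "near_one i j M \<longleftrightarrow> (\<exists>p q. M = cmat p q \<and> 2 ^ i dvd p - 1 \<and> 2 ^ j dvd q)"

lemma dvd_obtain_diff:
  assumes "(m :: z2) dvd x - y"
  obtains u where "x = y + m * u"
  using assms by (metis add.commute diff_add_cancel dvdE)

text \<open>Successive quotients of the filtration have two elements, so an \<open>M\<close> that is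
  not already one level deeper becomes so after multiplication by any element of exactly this level.
  This step leads from \<open>w^(2 m + 1)\<close> to \<open>w^(2 m + 2)\<close>, and
  \<open>near_one_step2\<close> on to \<open>w^(2 m + 3)\<close>.\<close>

lemma near_one_step1:
  fixes e f :: z2
  assumes M: "near_one (Suc m) m M" and E: "2 ^ Suc m dvd e - 1" "2 ^ Suc m dvd f - 2 ^ m"
  shows "near_one (Suc m) (Suc m) M \<or> near_one (Suc m) (Suc m) (M ** cmat e f)"
proof -
  define T :: z2 where "T = 2 ^ m"
  have T: "2 ^ Suc m = 2 * T"
    by (simp add: T_def)
  obtain p q where pq: "M = cmat p q" "2 * T dvd p - 1" "T dvd q"
    using M unfolding near_one_def T T_def[symmetric] by blast
  show ?thesis
  proof (cases "2 * T dvd q")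
    case True
    then show ?thesis
      using pq unfolding near_one_def T by blast
  next
    case False
    then have q: "2 * T dvd q - T"
      using z2_dichotomy[of m q] pq(3) unfolding T T_def[symmetric] by blast
    obtain x where x: "p = 1 + 2 * T * x"
      using pq(2) by (rule dvd_obtain_diff)
    obtain y where y: "q = T + 2 * T * y"
      using q by (rule dvd_obtain_diff)
    obtain u where u: "e = 1 + 2 * T * u"
      using E(1) unfolding T by (rule dvd_obtain_diff)
    obtain v where v: "f = T + 2 * T * v"
      using E(2) unfolding T T_def[symmetric] by (rule dvd_obtain_diff)
    have "p * e - 2 * q * f - 1 = 2 * T * (x + u + 2 * T * x * u - T * (1 + 2 * y) * (1 + 2 * v))"
      unfolding x y u v by (simp add: algebra_simps)
    moreover have "p * f + q * e = 2 * T * (1 + v + y + T * x * (1 + 2 * v) + T * u * (1 + 2 * y))"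
      unfolding x y u v by (simp add: algebra_simps)
    ultimately have "2 * T dvd p * e - 2 * q * f - 1" "2 * T dvd p * f + q * e"
      by (metis dvd_triv_left)+
    then show ?thesis
      unfolding pq(1) cmat_mult near_one_def T by blast
  qed
qed

lemma near_one_step2:
  assumes M: "near_one (Suc m) (Suc m) M" and D: "2 ^ Suc (Suc m) dvd g - (1 + 2 ^ Suc m)"
  shows "near_one (Suc (Suc m)) (Suc m) M \<or> near_one (Suc (Suc m)) (Suc m) (M ** cmat g 0)"
proof -
  define T :: z2 where "T = 2 ^ m"
  have T: "2 ^ Suc m = 2 * T" "2 ^ Suc (Suc m) = 4 * T"
    by (simp_all add: T_def)
  obtain p q where pq: "M = cmat p q" "2 * T dvd p - 1" "2 * T dvd q"
    using M unfolding near_one_def T by blast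
  show ?thesis
  proof (cases "4 * T dvd p - 1")
    case True
    then show ?thesis
      using pq unfolding near_one_def T by blast
  next
    case False
    then have "4 * T dvd p - 1 - 2 * T"
      using z2_dichotomy[of "Suc m" "p - 1"] pq(2) unfolding T by blast
    then have p: "4 * T dvd p - (1 + 2 * T)"
      by (simp add: algebra_simps)
    obtain x where x: "p = 1 + 2 * T + 4 * T * x"
      using p by (rule dvd_obtain_diff)
    obtain y where y: "g = 1 + 2 * T + 4 * T * y"
      using D unfolding T by (rule dvd_obtain_diff)
    have "p * g - 2 * q * 0 - 1 = 4 * T * (1 + T + (1 + 2 * T) * (x + y) + 4 * T * x * y)"
      unfolding x y by (simp add: algebra_simps)
    moreover have "2 * T dvd p * 0 + q * g"
      using pq(3) by simp
    ultimately have "4 * T dvd p * g - 2 * q * 0 - 1" "2 * T dvd p * 0 + q * g"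
      by (metis dvd_triv_left, blast)
    then show ?thesis
      unfolding pq(1) cmat_mult near_one_def T by blast
  qed
qed

text \<open>Squaring carries an element of exact level \<open>w^(2 m + 1)\<close> to exact level
  \<open>w^(2 m + 3)\<close>, so one element yields all later odd levels.
  \<open>square_step2\<close> does this for scalars and even levels.\<close>

lemma square_step1:
  fixes e f :: z2
  assumes "m \<ge> 1" "2 ^ Suc m dvd e - 1" "2 ^ Suc m dvd f - 2 ^ m"
  shows "2 ^ Suc (Suc m) dvd e * e - 2 * f * f - 1" "2 ^ Suc (Suc m) dvd e * f + f * e - 2 ^ Suc m"
proof -
  define R :: z2 where "R = 2 ^ (m - 1)"
  have "(2 :: z2) ^ m = 2 * R"
    using assms(1) by (cases m) (simp_all add: R_def)
  then have T: "(2 :: z2) ^ m = 2 * R" "(2 :: z2) ^ Suc m = 4 * R" "(2 :: z2) ^ Suc (Suc m) = 8 * R"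
    by simp_all
  obtain u where u: "e = 1 + 4 * R * u"
    using assms(2) unfolding T by (rule dvd_obtain_diff)
  obtain v where v: "f = 2 * R + 4 * R * v"
    using assms(3) unfolding T by (rule dvd_obtain_diff)
  have "e * e - 2 * f * f - 1 = 8 * R * (u + 2 * R * u * u - R * (1 + 2 * v) * (1 + 2 * v))"
    unfolding u v by (simp add: algebra_simps)
  moreover have "e * f + f * e - 4 * R = 8 * R * (v + 2 * R * u * (1 + 2 * v))"
    unfolding u v by (simp add: algebra_simps)
  ultimately show "2 ^ Suc (Suc m) dvd e * e - 2 * f * f - 1" "2 ^ Suc (Suc m) dvd e * f + f * e - 2 ^ Suc m"
    unfolding T by (metis dvd_triv_left)+
qed

lemma square_step2:
  fixes g :: z2
  assumes "m \<ge> 2" "2 ^ Suc m dvd g - (1 + 2 ^ m)"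
  shows "2 ^ Suc (Suc m) dvd g * g - (1 + 2 ^ Suc m)"
proof -
  define R :: z2 where "R = 2 ^ (m - 2)"
  have "(2 :: z2) ^ m = 4 * R"
  proof -
    have "m = (m - 2) + 2"
      using assms(1) by simp
    then have "(2 :: z2) ^ m = 2 ^ (m - 2) * 2 ^ 2"
      by (metis power_add)
    then show ?thesis
      by (simp add: R_def)
  qed
  then have T: "(2 :: z2) ^ m = 4 * R" "(2 :: z2) ^ Suc m = 8 * R" "(2 :: z2) ^ Suc (Suc m) = 16 * R"
    by simp_all
  obtain y where y: "g = 1 + 4 * R + 8 * R * y"
    using assms(2) unfolding T by (rule dvd_obtain_diff)
  have "g * g - (1 + 8 * R) = 16 * R * (R + y * (1 + 4 * R) + 4 * R * y * y)"
    unfolding y by (simp add: algebra_simps)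
  then show ?thesis
    unfolding T by (metis dvd_triv_left)
qed

text \<open>A pro-2 Frattini argument: modulo the units congruent to 1 modulo \<open>(\<surd>-2)\<^sup>5\<close>, the two
  generators suffice by inspection, and the powers of \<open>h\<close> and of its norm fill every further
  step of the filtration.\<close>

lemma topological_generators:
  assumes L: "subgroup L GL2_Z2" "limit_closed L"
    and h: "cmat a b \<in> L" "cmat a b \<in> normC_index2 i j" "z2_odd b"
    and g: "g \<in> L" "g \<in> normC_index2 i j" "\<not> in_C g"
  shows "normC_index2 i j \<subseteq> L"
proof -
  note Lm = subgroup.m_closed[OF L(1), simplified] and K = subgroup_normC_index2[of i j]
  note Km = subgroup.m_closed[OF K, simplified]
  have inv: "invertible M" if "M \<in> L \<or> M \<in> normC_index2 i j" for M
    using that subgroup.mem_carrier[OF L(1)] subgroup.mem_carrier[OF K] by auto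
  have L1: "mat 1 \<in> L"
    using subgroup.one_closed[OF L(1)] by simp
  have norm: "M \<in> normC" if "M \<in> normC_index2 i j" for M
    using that by (simp add: normC_index2_def)
  have odd_a: "z2_odd a"
    using normC_odd[OF norm[OF h(2)]] by simp
  have gA: "in_A g"
    using g(3) not_in_C_and_A[OF norm[OF g(2)]] by blast
  define n where "n = a * a + 2 * b * b"
  \<comment> \<open>Conjugation by \<open>g\<close> is \<open>w \<mapsto> - w\<close> on
    \<open>C\<close>, so \<open>L\<close> also contains the conjugate of \<open>h = a + b w\<close>,
    and with it the norm \<open>n\<close>.\<close>
  have conj: "g ** cmat a b = cmat a (- b) ** g"
    using gA unfolding in_A_def by (intro mat2_eqI) (simp_all add: mat2_mult_component algebra_simps)
  have bar: "cmat a (- b) \<in> L \<and> cmat a (- b) \<in> normC_index2 i j"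
  proof -
    have "g ** cmat a b ** inv\<^bsub>GL2_Z2\<^esub> g = cmat a (- b) ** (g ** inv\<^bsub>GL2_Z2\<^esub> g)"
      unfolding conj by (simp add: matrix_mul_assoc)
    then have "cmat a (- b) = g ** cmat a b ** inv\<^bsub>GL2_Z2\<^esub> g"
      using GL2_inv(1)[OF inv] g(1) by simp
    then show ?thesis
      using Lm Km g h subgroup.m_inv_closed[OF L(1)] subgroup.m_inv_closed[OF K] by simp
  qed
  have n: "cmat n 0 \<in> L" "cmat n 0 \<in> normC_index2 i j"
  proof -
    have "cmat n 0 = cmat a b ** cmat a (- b)"
      unfolding cmat_mult n_def by (simp add: algebra_simps)
    then show "cmat n 0 \<in> L" "cmat n 0 \<in> normC_index2 i j"
      using Lm Km h bar by simp_all
  qed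
  define c f where "c = a * a - 2 * b * b" "f = a * b + b * a"
  have h2: "cmat c f = cmat a b ** cmat a b"
    unfolding cmat_mult c_f_def by simp
  have cf: "cmat c f \<in> L" "cmat c f \<in> normC_index2 i j"
    unfolding h2 using Lm Km h by simp_all
  have res8: "x = 1 \<or> x = 3 \<or> x = 5 \<or> x = 7" if "odd x" "0 \<le> x" "x < 8" for x :: int
    using that by presburger
  have a3: "z2_residue a 3 = 1 \<or> z2_residue a 3 = 3 \<or> z2_residue a 3 = 5 \<or> z2_residue a 3 = 7"
    and b3: "z2_residue b 3 = 1 \<or> z2_residue b 3 = 3 \<or> z2_residue b 3 = 5 \<or> z2_residue b 3 = 7"
    using res8 odd_residue[OF odd_a, of 3] odd_residue[OF h(3), of 3] z2_residue_range[of _ 3] by auto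
  \<comment> \<open>Odd squares are 1 modulo 8. Hence \<open>h^2 = c + f w\<close> has
    \<open>c = -1\<close> modulo 8 and \<open>f = 2\<close> modulo 4, while \<open>n = 3\<close>
    modulo 8.\<close>
  have c3: "z2_residue c 3 = 7"
    using a3 b3 unfolding c_f_def by (elim disjE) simp_all
  have n3: "z2_residue n 3 = 3"
    using a3 b3 unfolding n_def by (elim disjE) simp_all
  have f3: "z2_residue f 3 = 2 \<or> z2_residue f 3 = 6"
    using a3 b3 unfolding c_f_def by (elim disjE) simp_all
  \<comment> \<open>Odd levels of the filtration: \<open>h^4\<close> has exact level
    \<open>w^5\<close>, the case \<open>m = 2\<close>, and squaring gives the others.\<close>
  have E: "\<exists>e f. cmat e f \<in> L \<and> 2 ^ Suc m dvd e - 1 \<and> 2 ^ Suc m dvd f - 2 ^ m" if "m \<ge> 2" for m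
    using that
  proof (induction m rule: dec_induct)
    case base
    have "z2_residue (c * c - 2 * f * f) 3 = z2_residue 1 3" "z2_residue (c * f + f * c) 3 = z2_residue (2 ^ 2) 3"
      using c3 f3 by auto
    then have "2 ^ 3 dvd c * c - 2 * f * f - 1" "2 ^ 3 dvd c * f + f * c - 2 ^ 2"
      unfolding pow2_dvd_diff_iff .
    then show ?case
      using Lm[OF cf(1) cf(1)] unfolding cmat_mult by (auto simp: numeral_3_eq_3)
  next
    case (step m)
    then obtain e f where ef: "cmat e f \<in> L" "2 ^ Suc m dvd e - 1" "2 ^ Suc m dvd f - 2 ^ m"
      by blast
    have "m \<ge> 1"
      using step by simp
    then show ?case
      using square_step1[OF _ ef(2,3)] Lm[OF ef(1) ef(1)] unfolding cmat_mult by blast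
  qed
  \<comment> \<open>Even levels: \<open>n^2 = 9\<close> modulo 16 is the case \<open>m = 3\<close>,
    that is \<open>w^6\<close>, and squaring gives the others.\<close>
  have D: "\<exists>g. cmat g 0 \<in> L \<and> 2 ^ Suc m dvd g - (1 + 2 ^ m)" if "m \<ge> 3" for m
    using that
  proof (induction m rule: dec_induct)
    case base
    have "2 ^ 3 dvd n - 3"
      unfolding pow2_dvd_diff_iff using n3 by simp
    then have "8 dvd n - 3"
      by simp
    then obtain k where k: "n = 3 + 8 * k"
      by (rule dvd_obtain_diff)
    have "n * n - (1 + 2 ^ 3) = 16 * (3 * k + 4 * k * k)"
      unfolding k by (simp add: algebra_simps)
    then have "16 dvd n * n - (1 + 2 ^ 3)"
      by (rule dvdI)
    then have "2 ^ Suc 3 dvd n * n - (1 + 2 ^ 3)"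
      by simp
    then show ?case
      using Lm[OF n(1) n(1)] unfolding cmat_mult by (intro exI[of _ "n * n"]) simp
  next
    case (step m)
    then obtain g where g: "cmat g 0 \<in> L" "2 ^ Suc m dvd g - (1 + 2 ^ m)"
      by blast
    have "m \<ge> 2"
      using step by simp
    then show ?case
      using square_step2[OF _ g(2)] Lm[OF g(1) g(1)] unfolding cmat_mult
      by (intro exI[of _ "g * g"]) simp
  qed
  have approx: "\<exists>Z\<in>L. near_one (Suc m) m (M ** Z)" if M: "near_one 3 2 M" and m: "m \<ge> 2" for M m
    using m
  proof (induction m rule: dec_induct)
    case base
    show ?case
      using M L1 by (intro bexI[of _ "mat 1"]) (simp_all add: numeral_3_eq_3 numeral_2_eq_2)
  next
    case (step m)
    then obtain Z where Z: "Z \<in> L" "near_one (Suc m) m (M ** Z)" by blast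
    obtain e f where ef: "cmat e f \<in> L" "2 ^ Suc m dvd e - 1" "2 ^ Suc m dvd f - 2 ^ m"
      using E step by blast
    obtain Z' where Z': "Z' \<in> L" "near_one (Suc m) (Suc m) (M ** Z')"
      using near_one_step1[OF Z(2) ef(2,3)] Z(1) Lm[OF Z(1) ef(1)] by (metis matrix_mul_assoc)
    have "Suc m \<ge> 3"
      using step by simp
    then obtain g where g: "cmat g 0 \<in> L" "2 ^ Suc (Suc m) dvd g - (1 + 2 ^ Suc m)"
      using D by blast
    show ?case
      using near_one_step2[OF Z'(2) g(2)] Z'(1) Lm[OF Z'(1) g(1)] by (metis matrix_mul_assoc)
  qed
  \<comment> \<open>The corrections \<open>Z\<close> found in \<open>L\<close> approximate the
    inverse of \<open>M\<close>, which therefore lies in the closed group \<open>L\<close>.\<close>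
  have near: "M \<in> L" if M: "invertible M" "near_one 3 2 M" for M
  proof -
    let ?I = "inv\<^bsub>GL2_Z2\<^esub> M"
    have "\<exists>N\<in>L. mat_cong k ?I N" for k
    proof -
      obtain Z where Z: "Z \<in> L" "near_one (Suc (k + 2)) (k + 2) (M ** Z)"
        using approx[OF M(2), of "k + 2"] by auto
      obtain p q where pq: "M ** Z = cmat p q" "2 ^ Suc (k + 2) dvd p - 1" "2 ^ (k + 2) dvd q"
        using Z(2) unfolding near_one_def by blast
      have le: "(2 :: z2) ^ k dvd 2 ^ Suc (k + 2)" "(2 :: z2) ^ k dvd 2 ^ (k + 2)"
        by (intro le_imp_power_dvd; simp)+
      have "2 ^ k dvd p - 1" "2 ^ k dvd q"
        using dvd_trans[OF le(1) pq(2)] dvd_trans[OF le(2) pq(3)] .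
      then have "z2_residue p k = z2_residue 1 k" "z2_residue q k = 0"
        using pow2_dvd_diff_iff pow2_dvd_z2_iff by blast+
      then have "mat_cong k (M ** Z) (mat 1)"
        unfolding pq(1) mat_cong_def forall_2 by simp
      then have "mat_cong k (?I ** (M ** Z)) (?I ** mat 1)"
        by (intro mat_cong_mult) (simp_all add: mat_cong_def)
      moreover have "?I ** (M ** Z) = Z"
        using GL2_inv(2)[OF M(1)] by (simp add: matrix_mul_assoc)
      ultimately have "mat_cong k ?I Z"
        by (simp add: mat_cong_sym)
      then show ?thesis
        using Z(1) by blast
    qed
    then have "?I \<in> L"
      using L(2) GL2_inv(3)[OF M(1)] unfolding limit_closed_def by simp
    then show ?thesis
      using subgroup.m_inv_closed[OF L(1)] GL2.inv_inv[of M] M(1) by fastforce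
  qed
  have cancel: "M \<in> L" if "Z \<in> L" "M ** Z \<in> L" "invertible M" for M Z
  proof -
    have "M = (M ** Z) ** inv\<^bsub>GL2_Z2\<^esub> Z"
      using GL2_inv(1)[OF inv] that(1) by (simp flip: matrix_mul_assoc)
    then show ?thesis
      using Lm[OF that(2) subgroup.m_inv_closed[OF L(1) that(1)]] by simp
  qed
  \<comment> \<open>Reduction to \<open>near\<close>: a factor \<open>n\<close> corrects
    \<open>p = 3\<close> modulo 8, \<open>main2\<close> uses \<open>h^2\<close> to make
    \<open>q\<close> divisible by 4, and \<open>main1\<close> uses \<open>h\<close> to make
    \<open>q\<close> even. The condition on \<open>psi\<close> excludes \<open>p = 5\<close> and
    \<open>p = 7\<close> here.\<close>
  have main4: "M \<in> L" if M: "M \<in> normC_index2 i j" "M = cmat p q" "z2_residue q 2 = 0" for M p q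
  proof -
    have "2 ^ 2 dvd q"
      unfolding pow2_dvd_z2_iff by (rule M(3))
    have "z2_residue q 1 = 0"
      using z2_residue_mod_le[of 1 2 q] M(3) by simp
    then have psi: "psi i j M = chi (z2_residue p 3) 0"
      unfolding M(2) psi_def chi_mat_def chi2_def beta_mat_def gamma_mat_def using M(3) by simp
    have "z2_residue p 3 = 1 \<or> z2_residue p 3 = 3"
    proof -
      have "chi (z2_residue p 3) 0 = 1"
        using M(1) psi by (simp add: normC_index2_def)
      then show ?thesis
        using z2_residue_range[of p 3] by (simp add: chi_def split: if_splits)
    qed
    then show ?thesis
    proof
      assume "z2_residue p 3 = 1"
      then have "2 ^ 3 dvd p - 1"
        unfolding pow2_dvd_diff_iff by simp
      then show ?thesis
        using near[OF inv] M \<open>2 ^ 2 dvd q\<close> unfolding near_one_def by blast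
    next
      assume p3: "z2_residue p 3 = 3"
      have "z2_residue (p * n) 3 = z2_residue 1 3"
        using p3 n3 by simp
      then have "2 ^ 3 dvd p * n - 1"
        unfolding pow2_dvd_diff_iff .
      then have "near_one 3 2 (M ** cmat n 0)"
        unfolding M(2) cmat_mult near_one_def using \<open>2 ^ 2 dvd q\<close>
        by (intro exI[of _ "p * n"] exI[of _ "q * n"]) simp
      then have "M ** cmat n 0 \<in> L"
        using near[of "M ** cmat n 0"] inv[of "M ** cmat n 0"] Km[OF M(1) n(2)] by blast
      then show ?thesis
        using cancel[OF n(1)] inv M(1) by blast
    qed
  qed
  have main2: "M \<in> L" if M: "M \<in> normC_index2 i j" "M = cmat p q" "z2_residue q 1 = 0" for M p q
  proof (cases "z2_residue q 2 = 0")
    case True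
    then show ?thesis using main4 M by blast
  next
    case False
    have "z2_residue q 2 = 2"
      using False z2_residue_mod_le[of 1 2 q] M(3) z2_residue_range[of q 2] by simp presburger
    moreover have "z2_residue p 2 = 1 \<or> z2_residue p 2 = 3"
    proof -
      have "z2_odd p"
        using normC_odd[OF norm[OF M(1)]] M(2) by simp
      then show ?thesis
        using odd_residue[of p 2] z2_residue_range[of p 2] by simp presburger
    qed
    moreover have "z2_residue c 2 = 3" "z2_residue f 2 = 2"
      using z2_residue_mod_le[of 2 3 c] z2_residue_mod_le[of 2 3 f] c3 f3 by auto
    ultimately have "z2_residue (p * f + q * c) 2 = 0"
      by auto
    then have "M ** cmat c f \<in> L"
      using main4[OF Km[OF M(1) cf(2)]] unfolding M(2) cmat_mult by blast
    then show ?thesis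
      using cancel[OF cf(1)] inv M(1) by blast
  qed
  have main1: "M \<in> L" if M: "M \<in> normC_index2 i j" "in_C M" for M
  proof -
    obtain p q where pq: "M = cmat p q"
      using in_C_cmat[OF M(2)] by blast
    show ?thesis
    proof (cases "z2_odd q")
      case False
      then show ?thesis
        using main2[OF M(1) pq] z2_residue_range[of q 1] by auto
    next
      case True
      have "z2_odd p"
        using normC_odd[OF norm[OF M(1)]] pq by simp
      then have "z2_residue (p * b + q * a) 1 = 0"
        using True odd_a h(3) by simp
      then have "M ** cmat a b \<in> L"
        using main2[OF Km[OF M(1) h(2)]] unfolding pq cmat_mult by blast
      then show ?thesis
        using cancel[OF h(1)] inv M(1) by blast
    qed
  qed
  show ?thesis
  proof
    fix M assume M: "M \<in> normC_index2 i j"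
    show "M \<in> L"
    proof (cases "in_C M")
      case True
      then show ?thesis using main1 M by blast
    next
      case False
      then have "in_A M"
        using not_in_C_and_A[OF norm[OF M]] by blast
      then have "M ** g \<in> L"
        using main1[OF Km[OF M g(2)]] in_C_A_mult(4) gA by blast
      then show ?thesis
        using cancel[OF g(1)] inv M by blast
    qed
  qed
qed

lemma normC_index2_maximal:
  assumes L: "subgroup L GL2_Z2" "normC_index2 i j \<subseteq> L" and M: "M \<in> L" "M \<in> normC" "psi i j M = - 1"
  shows "normC \<subseteq> L"
proof
  fix N assume N: "N \<in> normC"
  show "N \<in> L"
  proof (cases "psi i j N = 1")
    case True
    then show ?thesis using L(2) N by (auto simp: normC_index2_def)
  next
    case False
    then have "N ** M \<in> L"
      using psi_mult[OF N M(2), of i j] psi_values[of i j N] M(3) L(2) normC_mult[OF N M(2)]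
      by (auto simp: normC_index2_def)
    moreover have "N = (N ** M) ** inv\<^bsub>GL2_Z2\<^esub> M"
      using GL2_inv(1)[of M] M(2) by (simp add: normC_def flip: matrix_mul_assoc)
    ultimately show ?thesis
      using subgroup.m_closed[OF L(1) _ subgroup.m_inv_closed[OF L(1) M(1)], of "N ** M"] by simp
  qed
qed

lemma c_mat_squared: "c_mat 1 ** c_mat 1 = mat 1" "c_mat (- 1) ** c_mat (- 1) = mat 1"
  by (rule mat2_eqI; simp add: c_mat_def mat2_mult_component)+

lemma c_mat_normC: "c_mat 1 \<in> normC" "c_mat (- 1) \<in> normC" "\<not> in_C (c_mat 1)" "\<not> in_C (c_mat (- 1))"
proof -
  show n: "c_mat 1 \<in> normC" "c_mat (- 1) \<in> normC"
    using c_mat_squared by (auto simp: normC_def in_A_def c_mat_def invertible_def)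
  have "in_A (c_mat 1)" "in_A (c_mat (- 1))"
    by (simp_all add: in_A_def c_mat_def)
  then show "\<not> in_C (c_mat 1)" "\<not> in_C (c_mat (- 1))"
    using not_in_C_and_A n by blast+
qed

lemma psi_c_mat: "psi i j (c_mat 1) = (if j then - 1 else 1)" "psi i j (c_mat (- 1)) = (if j then 1 else - 1)"
  using c_mat_normC(3,4)
  by (simp_all add: psi_def chi_mat_def chi2_def chi_def beta_mat_def gamma_mat_def) (simp_all add: c_mat_def)

lemma cmat_invertible:
  assumes "a * a + 2 * b * b dvd 1"
  shows "invertible (cmat a b)"
proof -
  obtain u where u: "1 = (a * a + 2 * b * b) * u"
    using assms by (elim dvdE)
  have "a * (a * u) - 2 * b * - (b * u) = 1" "a * - (b * u) + b * (a * u) = 0"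
    "a * u * a - 2 * - (b * u) * b = 1" "a * u * b + - (b * u) * a = 0"
    using u[symmetric] by (simp_all add: algebra_simps)
  then have "cmat a b ** cmat (a * u) (- (b * u)) = mat 1" "cmat (a * u) (- (b * u)) ** cmat a b = mat 1"
    unfolding cmat_mult by (simp_all only: cmat_1)
  then show ?thesis
    unfolding invertible_def by blast
qed

lemma z2_unit_3: "(3 :: z2) dvd 1"
proof -
  \<comment> \<open>The partial sums of \<open>1/3 = - (1 + 4 + 16 + ...)\<close>. The unit 3 is the
    determinant of \<open>1 + w\<close> and of \<open>- 1 - w\<close>.\<close>
  define f :: "nat \<Rightarrow> int" where "f = (\<lambda>n. (1 - 4 ^ n) div 3)"
  have "(3 :: int) dvd 1 - 4 ^ n" for n
    by (induction n) (simp, simp, presburger)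
  then have f3: "3 * f n = 1 - 4 ^ n" for n
    by (simp add: f_def)
  have f: "(3 * f n) mod 2 ^ n = 1 mod (2 ^ n :: int)" for n
  proof -
    have "(2 :: int) ^ n dvd 4 ^ n"
      by (rule dvd_power_same) simp
    then show ?thesis
      unfolding f3 mod_eq_dvd_iff by simp
  qed
  have "f n mod 2 ^ n = f (Suc n) mod 2 ^ n" for n
  proof -
    have "(3 * f (Suc n)) mod 2 ^ n = 1 mod 2 ^ n"
      using arg_cong[OF f[of "Suc n"], of "\<lambda>x. x mod 2 ^ n"] by (simp add: mod_mod_cancel)
    then have "(3 * f n) mod 2 ^ n = (3 * f (Suc n)) mod 2 ^ n"
      using f[of n] by simp
    then have "2 ^ n dvd 3 * (f n - f (Suc n))"
      by (simp only: mod_eq_dvd_iff right_diff_distrib)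
    moreover have "coprime (2 ^ n) (3 :: int)"
      by simp
    ultimately have "2 ^ n dvd f n - f (Suc n)"
      using coprime_dvd_mult_right_iff by blast
    then show ?thesis
      by (simp add: mod_eq_dvd_iff)
  qed
  then obtain x where x: "\<And>n. z2_residue x n = f n mod 2 ^ n"
    using z2_of_sequence[of f] by metis
  have "3 * x = 1"
  proof (rule z2_eqI)
    fix n
    have "z2_residue (3 * x) n = (3 * f n) mod 2 ^ n"
      by (simp add: x mod_simps)
    then show "z2_residue (3 * x) n = z2_residue 1 n"
      using f by simp
  qed
  then show ?thesis
    by (metis dvd_triv_left)
qed

lemma generators_in_normC_index2:
  "mat2 3 0 0 3 \<in> normC_index2 i j" "mat2 1 1 (- 2) 1 \<in> normC_index2 False j"
  "mat2 (- 1) (- 1) 2 (- 1) \<in> normC_index2 True j"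
proof -
  have e: "mat2 3 0 0 3 = cmat 3 0" "mat2 1 1 (- 2) 1 = cmat 1 1" "mat2 (- 1) (- 1) 2 (- 1) = cmat (- 1) (- 1)"
    by (simp_all add: cmat_def)
  have "(3 :: z2) * 3 + 2 * 0 * 0 dvd 1"
    using mult_dvd_mono[OF z2_unit_3 z2_unit_3] by simp
  moreover have "(1 :: z2) * 1 + 2 * 1 * 1 dvd 1" "(- 1 :: z2) * - 1 + 2 * - 1 * - 1 dvd 1"
    using z2_unit_3 by simp_all
  ultimately have "cmat 3 0 \<in> normC" "cmat 1 1 \<in> normC" "cmat (- 1) (- 1) \<in> normC"
    using cmat_invertible by (simp_all add: normC_def)
  then show "mat2 3 0 0 3 \<in> normC_index2 i j" "mat2 1 1 (- 2) 1 \<in> normC_index2 False j"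
    "mat2 (- 1) (- 1) 2 (- 1) \<in> normC_index2 True j"
    unfolding e normC_index2_def
    by (simp_all add: psi_def chi_mat_def chi2_def chi_def beta_mat_def gamma_mat_def)
qed

lemma closed_subgroup_generated_index2:
  assumes h: "cmat a b \<in> normC_index2 i j" "z2_odd b" and c: "c \<in> normC_index2 i j" "\<not> in_C c"
    and S: "cmat a b \<in> S" "S \<subseteq> normC_index2 i j"
  shows "closed_subgroup_generated (closed_subgroup_generated S \<union> {c}) = normC_index2 i j"
proof (rule closed_subgroup_generated_eqI)
  show "closed_subgroup_generated S \<union> {c} \<subseteq> normC_index2 i j"
    using closed_subgroup_generated_subset[OF subgroup_normC_index2 limit_closed_normC_index2 S(2)] c(1)
    by simp
  show "normC_index2 i j \<subseteq> L"
    if "subgroup L GL2_Z2" "limit_closed L" "closed_subgroup_generated S \<union> {c} \<subseteq> L" for L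
    using topological_generators[OF that(1,2) _ h _ c] that(3) S(1) closed_subgroup_generated_superset[of S]
    by blast
qed (rule subgroup_normC_index2 limit_closed_normC_index2)+

lemma index2_groups:
  "closed_subgroup_generated (G23 \<union> {c_mat 1}) = normC_index2 False False"
  "closed_subgroup_generated (G24 \<union> {c_mat 1}) = normC_index2 True False"
  "closed_subgroup_generated (G23 \<union> {c_mat (- 1)}) = normC_index2 False True"
  "closed_subgroup_generated (G24 \<union> {c_mat (- 1)}) = normC_index2 True True"
proof -
  have e: "mat2 1 1 (- 2) 1 = cmat 1 1" "mat2 (- 1) (- 1) 2 (- 1) = cmat (- 1) (- 1)"
    by (simp_all add: cmat_def)
  have c: "c_mat 1 \<in> normC_index2 i False" "c_mat (- 1) \<in> normC_index2 i True" for i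
    using c_mat_normC psi_c_mat by (simp_all add: normC_index2_def)
  note gen = generators_in_normC_index2[unfolded e]
  show "closed_subgroup_generated (G23 \<union> {c_mat 1}) = normC_index2 False False"
    "closed_subgroup_generated (G24 \<union> {c_mat 1}) = normC_index2 True False"
    "closed_subgroup_generated (G23 \<union> {c_mat (- 1)}) = normC_index2 False True"
    "closed_subgroup_generated (G24 \<union> {c_mat (- 1)}) = normC_index2 True True"
    unfolding G23_def G24_def e
    by (rule closed_subgroup_generated_index2[OF gen(2) _ c(1) c_mat_normC(3)]
        closed_subgroup_generated_index2[OF gen(3) _ c(1) c_mat_normC(3)]
        closed_subgroup_generated_index2[OF gen(2) _ c(2) c_mat_normC(4)]
        closed_subgroup_generated_index2[OF gen(3) _ c(2) c_mat_normC(4)]; simp add: gen)+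
qed

lemma normalizer_cartan_eq: "normalizer_cartan = normC"
  unfolding normalizer_cartan_def
proof (rule closed_subgroup_generated_eqI)
  have "M \<in> normC" if "M \<in> cartan" for M
  proof -
    obtain a b where "M = cmat a b" "a * a + 2 * b * b dvd 1"
      using \<open>M \<in> cartan\<close> by (auto simp: cartan_def cmat_def power2_eq_square mult.assoc)
    then show ?thesis
      using cmat_invertible by (simp add: normC_def)
  qed
  then show "insert (c_mat 1) cartan \<subseteq> normC"
    using c_mat_normC(1) by blast
  fix L assume L: "subgroup L GL2_Z2" "insert (c_mat 1) cartan \<subseteq> L"
  have C: "M \<in> L" if M: "M \<in> normC" "in_C M" for M
  proof -
    obtain a b where ab: "M = cmat a b"
      using in_C_cmat[OF M(2)] by blast
    obtain M' where "M ** M' = mat 1"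
      using M(1) by (auto simp: normC_def invertible_def)
    then have "det M * det M' = 1"
      by (metis det_I det_mul)
    then have "det M dvd 1"
      by (metis dvd_triv_left)
    then have "a\<^sup>2 + 2 * b\<^sup>2 dvd 1"
      by (simp add: det_2 ab power2_eq_square algebra_simps)
    then have "M \<in> cartan"
      unfolding cartan_def ab cmat_def by blast
    then show ?thesis using L(2) by blast
  qed
  show "normC \<subseteq> L"
  proof
    fix M assume M: "M \<in> normC"
    show "M \<in> L"
    proof (cases "in_C M")
      case True
      then show ?thesis using C M by blast
    next
      case False
      then have "in_A M"
        using not_in_C_and_A[OF M] by blast
      moreover have "in_A (c_mat 1)"
        by (simp add: in_A_def c_mat_def)
      ultimately have "M ** c_mat 1 \<in> L"
        using C[OF normC_mult[OF M c_mat_normC(1)]] in_C_A_mult(4) by blast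
      then have "(M ** c_mat 1) ** c_mat 1 \<in> L"
        using subgroup.m_closed[OF L(1), of "M ** c_mat 1" "c_mat 1"] L(2) by simp
      then show ?thesis
        using c_mat_squared(1) by (simp flip: matrix_mul_assoc)
    qed
  qed
qed (rule subgroup_normC limit_closed_normC)+

subsection \<open>Conjugacy classes\<close>

lemma conjugate_refl:
  assumes "H \<subseteq> carrier GL2_Z2"
  shows "H \<in> conjugacy_class H"
proof -
  have "(\<lambda>h. \<one>\<^bsub>GL2_Z2\<^esub> \<otimes>\<^bsub>GL2_Z2\<^esub> h \<otimes>\<^bsub>GL2_Z2\<^esub> inv\<^bsub>GL2_Z2\<^esub> \<one>\<^bsub>GL2_Z2\<^esub>) ` H = H"
    using assms by (simp only: GL2.inv_one) (auto simp: image_iff)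
  then show ?thesis
    unfolding conjugacy_class_def using GL2.one_closed by blast
qed

lemma conjugacy_class_eqI:
  assumes K: "K \<subseteq> carrier GL2_Z2" and H: "H \<in> conjugacy_class K"
  shows "conjugacy_class H = conjugacy_class K"
proof -
  have sub: "conjugacy_class H \<subseteq> conjugacy_class K"
    if K: "K \<subseteq> carrier GL2_Z2" and H: "H \<in> conjugacy_class K" for H K
  proof
    fix H' assume "H' \<in> conjugacy_class H"
    then obtain g where g: "g \<in> carrier GL2_Z2"
      "H' = (\<lambda>h. g \<otimes>\<^bsub>GL2_Z2\<^esub> h \<otimes>\<^bsub>GL2_Z2\<^esub> inv\<^bsub>GL2_Z2\<^esub> g) ` H"
      unfolding conjugacy_class_def by blast
    obtain k where k: "k \<in> carrier GL2_Z2"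
      "H = (\<lambda>h. k \<otimes>\<^bsub>GL2_Z2\<^esub> h \<otimes>\<^bsub>GL2_Z2\<^esub> inv\<^bsub>GL2_Z2\<^esub> k) ` K"
      using H unfolding conjugacy_class_def by blast
    have "H' = (\<lambda>h. (g \<otimes>\<^bsub>GL2_Z2\<^esub> k) \<otimes>\<^bsub>GL2_Z2\<^esub> h \<otimes>\<^bsub>GL2_Z2\<^esub> inv\<^bsub>GL2_Z2\<^esub> (g \<otimes>\<^bsub>GL2_Z2\<^esub> k)) ` K"
      unfolding g(2) k(2) image_image
      by (intro image_cong refl)
        (use g(1) k(1) K in \<open>simp only: GL2.inv_mult_group GL2.m_assoc GL2.m_closed GL2.inv_closed subsetD\<close>)
    then show "H' \<in> conjugacy_class K"
      unfolding conjugacy_class_def using GL2.m_closed[OF g(1) k(1)] by blast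
  qed
  obtain k where k: "k \<in> carrier GL2_Z2"
    "H = (\<lambda>h. k \<otimes>\<^bsub>GL2_Z2\<^esub> h \<otimes>\<^bsub>GL2_Z2\<^esub> inv\<^bsub>GL2_Z2\<^esub> k) ` K"
    using H unfolding conjugacy_class_def by blast
  have Hc: "H \<subseteq> carrier GL2_Z2"
    unfolding k(2) using K k(1) GL2.m_closed GL2.inv_closed by blast
  have "K = (\<lambda>h. inv\<^bsub>GL2_Z2\<^esub> k \<otimes>\<^bsub>GL2_Z2\<^esub> h \<otimes>\<^bsub>GL2_Z2\<^esub> inv\<^bsub>GL2_Z2\<^esub> (inv\<^bsub>GL2_Z2\<^esub> k)) ` H"
  proof -
    have "inv\<^bsub>GL2_Z2\<^esub> k \<otimes>\<^bsub>GL2_Z2\<^esub> (k \<otimes>\<^bsub>GL2_Z2\<^esub> h \<otimes>\<^bsub>GL2_Z2\<^esub> inv\<^bsub>GL2_Z2\<^esub> k) \<otimes>\<^bsub>GL2_Z2\<^esub>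
        inv\<^bsub>GL2_Z2\<^esub> (inv\<^bsub>GL2_Z2\<^esub> k) = h" if "h \<in> K" for h
    proof -
      have h: "h \<in> carrier GL2_Z2" using that K by blast
      have "inv\<^bsub>GL2_Z2\<^esub> k \<otimes>\<^bsub>GL2_Z2\<^esub> (k \<otimes>\<^bsub>GL2_Z2\<^esub> h \<otimes>\<^bsub>GL2_Z2\<^esub> inv\<^bsub>GL2_Z2\<^esub> k) \<otimes>\<^bsub>GL2_Z2\<^esub>
        inv\<^bsub>GL2_Z2\<^esub> (inv\<^bsub>GL2_Z2\<^esub> k) =
        (inv\<^bsub>GL2_Z2\<^esub> k \<otimes>\<^bsub>GL2_Z2\<^esub> k) \<otimes>\<^bsub>GL2_Z2\<^esub> h \<otimes>\<^bsub>GL2_Z2\<^esub> (inv\<^bsub>GL2_Z2\<^esub> k \<otimes>\<^bsub>GL2_Z2\<^esub> k)"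
        using h k(1) by (simp only: GL2.inv_inv GL2.m_assoc GL2.m_closed GL2.inv_closed)
      then show ?thesis
        using h k(1) by (simp only: GL2.l_inv GL2.l_one GL2.r_one)
    qed
    then show ?thesis
      unfolding k(2) image_image by (metis (no_types, lifting) image_cong image_ident)
  qed
  then have "K \<in> conjugacy_class H"
    unfolding conjugacy_class_def using GL2.inv_closed[OF k(1)] by blast
  then show ?thesis
    using sub[OF K H] sub[OF Hc] by blast
qed

text \<open>Conjugation preserves the trace \<open>2 e\<close> and the determinant 3. The nonzero
  trace excludes the anticommuting type and fixes the diagonal; the determinant then fixes
  \<open>b^2\<close>.\<close>

lemma conjugate_cmat:
  assumes M: "M \<in> normC" and g: "invertible g"
    and eq: "cmat e e = g ** M ** inv\<^bsub>GL2_Z2\<^esub> g" and e: "e * e = 1"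
  obtains b where "M = cmat e b" "b * b = 1"
proof -
  let ?I = "inv\<^bsub>GL2_Z2\<^esub> g"
  have "trace (cmat e e) = trace (?I ** (g ** M))"
    unfolding eq by (rule trace_mul_sym)
  also have "?I ** (g ** M) = M"
    using GL2_inv(2)[OF g] by (simp add: matrix_mul_assoc)
  finally have tr: "2 * e = M $ 1 $ 1 + M $ 2 $ 2"
    by (simp add: trace_def sum_2)
  have "det g * det ?I = 1"
    using GL2_inv(1)[OF g] by (metis det_I det_mul)
  then have "det (cmat e e) = det M"
    unfolding eq det_mul by (simp add: mult_ac)
  moreover have "det (cmat e e) = e * e + 2 * (e * e)"
    by (simp add: det_2 algebra_simps)
  ultimately have det: "3 = M $ 1 $ 1 * M $ 2 $ 2 - M $ 1 $ 2 * M $ 2 $ 1"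
    using e by (simp add: det_2)
  have "e \<noteq> 0"
    using e by auto
  have "in_C M"
  proof (rule ccontr)
    assume "\<not> in_C M"
    then have "2 * e = 0"
      using tr M by (auto simp: normC_def in_A_def)
    then show False
      using z2_double_eq_0 \<open>e \<noteq> 0\<close> by blast
  qed
  then have ab: "M = cmat (M $ 2 $ 2) (M $ 1 $ 2)"
    by (rule in_C_cmat)
  have "2 * (e - M $ 2 $ 2) = 0"
    using tr \<open>in_C M\<close> by (simp add: in_C_def algebra_simps)
  then have a: "M $ 2 $ 2 = e"
    using z2_double_eq_0 by fastforce
  have "2 * (M $ 1 $ 2 * M $ 1 $ 2 - 1) = 0"
    using det \<open>in_C M\<close> a e by (simp add: in_C_def algebra_simps)
  then have "M $ 1 $ 2 * M $ 1 $ 2 = 1"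
    using z2_double_eq_0 by fastforce
  then show ?thesis
    using that ab a by metis
qed

text \<open>The sign of \<open>e + e w\<close> in the group detects \<open>i\<close>, because a
  conjugate of it in the other group is \<open>e + w\<close> or \<open>e - w\<close>. The
  conjugating matrix then normalizes \<open>C\<close>, and under conjugation inside
  \<open>normC\<close> the character \<open>psi\<close> is invariant, so \<open>c_mat\<close>
  detects \<open>j\<close>.\<close>

lemma normC_index2_not_conjugate:
  assumes "normC_index2 i j \<in> conjugacy_class (normC_index2 i' j')"
  shows "i = i'" "j = j'"
proof -
  obtain g where "invertible g" and g':
    "normC_index2 i j = (\<lambda>h. g \<otimes>\<^bsub>GL2_Z2\<^esub> h \<otimes>\<^bsub>GL2_Z2\<^esub> inv\<^bsub>GL2_Z2\<^esub> g) ` normC_index2 i' j'"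
    using assms unfolding conjugacy_class_def by auto
  then have g: "invertible g" "normC_index2 i j = (\<lambda>h. g ** h ** inv\<^bsub>GL2_Z2\<^esub> g) ` normC_index2 i' j'"
    by simp_all
  define e :: z2 where "e = (if i then - 1 else 1)"
  have e: "e * e = 1"
    by (simp add: e_def)
  have in_i: "cmat e e \<in> normC_index2 i j"
    using generators_in_normC_index2(2,3)[of j] unfolding e_def cmat_def by simp
  then obtain M where M: "M \<in> normC_index2 i' j'" "cmat e e = g ** M ** inv\<^bsub>GL2_Z2\<^esub> g"
    using g(2) by blast
  have "M \<in> normC"
    using M(1) by (simp add: normC_index2_def)
  from conjugate_cmat[OF this g(1) M(2) e] obtain b where b: "M = cmat e b" "b * b = 1" .
  have b1: "b = 1 \<or> b = - 1"
    using z2_square_eq_1[OF b(2)] .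
  have psi: "psi i' j' (cmat e b) = (if i = i' then 1 else - 1)"
    using b1 by (auto simp: e_def psi_def chi_mat_def chi2_def chi_def beta_mat_def gamma_mat_def)
  then show "i = i'"
    using M(1) unfolding b(1) by (simp add: normC_index2_def split: if_splits)
  \<comment> \<open>After removal of the scalar \<open>e\<close> from both sides, \<open>g\<close>
    intertwines \<open>w\<close> with \<open>w\<close> or \<open>- w\<close>.\<close>
  have "g \<in> normC"
  proof -
    have "cmat e e ** g = g ** cmat e b ** (inv\<^bsub>GL2_Z2\<^esub> g ** g)"
      using M(2) unfolding b(1) by (simp add: matrix_mul_assoc)
    then have eq: "cmat e e ** g = g ** cmat e b"
      using GL2_inv(2)[OF g(1)] by simp
    have comp: "(cmat e e ** g) $ u $ v = (g ** cmat e b) $ u $ v" for u v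
      by (simp add: eq)
    have ee: "e = 1 \<or> e = - 1"
      by (simp add: e_def)
    have "e * g $ 2 $ 1 = - 2 * b * g $ 1 $ 2" "e * g $ 2 $ 2 = b * g $ 1 $ 1"
      using comp[of 1 1] comp[of 1 2] unfolding mat2_mult_component
      by (simp_all add: algebra_simps eq_neg_iff_add_eq_0)
    then have "g $ 2 $ 1 = e * (- 2 * b * g $ 1 $ 2)" "g $ 2 $ 2 = e * (b * g $ 1 $ 1)"
      using e by (metis mult.assoc mult_1)+
    then have "in_C g \<or> in_A g"
      using b1 ee unfolding in_C_def in_A_def by (elim disjE) simp_all
    then show ?thesis
      using g(1) by (simp add: normC_def)
  qed
  show "j = j'"
  proof (rule ccontr)
    assume j: "j \<noteq> j'"
    define c where "c = (if j then c_mat (- 1) else c_mat 1)"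
    have c: "c \<in> normC" "psi i j c = 1" "psi i' j' c = - 1"
      using c_mat_normC psi_c_mat j by (auto simp: c_def)
    have "c \<in> normC_index2 i j"
      using c(1,2) by (simp add: normC_index2_def)
    then obtain M where M: "M \<in> normC_index2 i' j'" "c = g ** M ** inv\<^bsub>GL2_Z2\<^esub> g"
      unfolding g(2) by (rule imageE)
    have Mn: "M \<in> normC" "psi i' j' M = 1"
      using M(1) by (simp_all add: normC_index2_def)
    have "psi i' j' c = psi i' j' g * psi i' j' M * psi i' j' (inv\<^bsub>GL2_Z2\<^esub> g)"
      unfolding M(2) using \<open>g \<in> normC\<close> Mn(1) normC_inv normC_mult by (simp add: psi_mult)
    also have "\<dots> = 1"
      using psi_inv[OF \<open>g \<in> normC\<close>, of i' j'] Mn(2) by simp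
    finally show False
      using c(3) by simp
  qed
qed

text \<open>The scalar \<open>-1\<close> is fixed by every conjugation; it lies in
  \<open>normC\<close>, but \<open>psi\<close> is \<open>-1\<close> there.\<close>

lemma normC_not_conjugate: "normC \<notin> conjugacy_class (normC_index2 i j)"
proof
  assume "normC \<in> conjugacy_class (normC_index2 i j)"
  then obtain g where "invertible g" and
    "normC = (\<lambda>h. g \<otimes>\<^bsub>GL2_Z2\<^esub> h \<otimes>\<^bsub>GL2_Z2\<^esub> inv\<^bsub>GL2_Z2\<^esub> g) ` normC_index2 i j"
    unfolding conjugacy_class_def by auto
  then have g: "invertible g" "normC = (\<lambda>h. g ** h ** inv\<^bsub>GL2_Z2\<^esub> g) ` normC_index2 i j"
    by simp_all
  have m1: "cmat (- 1) 0 ** cmat (- 1) 0 = mat 1"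
    unfolding cmat_mult by (simp add: cmat_1)
  then have "cmat (- 1) 0 \<in> normC"
    by (auto simp: normC_def invertible_def)
  then obtain M where M: "M \<in> normC_index2 i j" "cmat (- 1) 0 = g ** M ** inv\<^bsub>GL2_Z2\<^esub> g"
    using g(2) by blast
  have "cmat (- 1) 0 ** g = g ** M ** (inv\<^bsub>GL2_Z2\<^esub> g ** g)"
    using M(2) by (simp add: matrix_mul_assoc)
  then have "g ** M = cmat (- 1) 0 ** g"
    using GL2_inv(2)[OF g(1)] by simp
  also have "\<dots> = g ** cmat (- 1) 0"
    by (rule mat2_eqI) (simp_all add: mat2_mult_component)
  finally have "inv\<^bsub>GL2_Z2\<^esub> g ** (g ** M) = inv\<^bsub>GL2_Z2\<^esub> g ** (g ** cmat (- 1) 0)"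
    by simp
  then have "M = cmat (- 1) 0"
    using GL2_inv(2)[OF g(1)] by (simp add: matrix_mul_assoc)
  moreover have "psi i j (cmat (- 1) 0) = - 1"
    by (simp add: psi_def chi_mat_def chi2_def chi_def beta_mat_def gamma_mat_def)
  ultimately show False
    using M(1) by (simp add: normC_index2_def)
qed

section \<open>Galois action on square roots of rational numbers\<close>

lemma rat_square_int:
  fixes q :: rat
  assumes "q\<^sup>2 = of_int m"
  obtains n :: int where "m = n\<^sup>2"
proof -
  obtain a b where ab: "quotient_of q = (a, b)"
    by fastforce
  have b: "b > 0" "coprime a b" "q = of_int a / of_int b"
    using quotient_of_denom_pos[OF ab] quotient_of_coprime[OF ab] quotient_of_div[OF ab] .
  have "of_int (a\<^sup>2) = (of_int (m * b\<^sup>2) :: rat)"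
    using assms b(1) unfolding b(3) by (simp add: power_divide field_simps)
  then have eq: "a\<^sup>2 = m * b\<^sup>2"
    by (simp only: of_int_eq_iff)
  have "coprime (a\<^sup>2) (b\<^sup>2)"
    using b(2) by simp
  moreover have "b\<^sup>2 dvd a\<^sup>2"
    unfolding eq by simp
  ultimately have "is_unit (b\<^sup>2)"
    by (meson coprime_common_divisor dvd_refl)
  then have "b = 1"
    using b(1) by (auto simp: power2_eq_1_iff)
  then show ?thesis
    using eq that[of a] by simp
qed

lemma squarefree_square_multiple:
  fixes d :: int
  assumes "squarefree d" "d = c * m\<^sup>2"
  shows "d = c"
proof -
  have "is_unit m"
    using assms by (intro squarefreeD[OF assms(1)]) (simp add: power2_eq_square)
  then have "m\<^sup>2 = 1"
    by (auto simp: power2_eq_1_iff)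
  then show ?thesis
    using assms(2) by simp
qed

lemma int_square_mod_4: "(n :: int)\<^sup>2 mod 4 \<in> {0, 1}"
proof (cases "even n")
  case True
  then show ?thesis
    by (auto elim!: evenE simp: power2_eq_square)
next
  case False
  then obtain k where "n = 2 * k + 1"
    by (elim oddE)
  then have "n\<^sup>2 = 4 * (k * k + k) + 1"
    by (simp add: power2_eq_square algebra_simps)
  then have "n\<^sup>2 mod 4 = 1 mod 4"
    by (simp only: mod_mult_self4)
  then show ?thesis
    by simp
qed

lemma squarefree_generic:
  fixes d :: int
  assumes "squarefree d" "d \<notin> {1, - 1, 2, - 2}"
  shows "\<nexists>q::rat. q \<noteq> 0 \<and> (of_int d = q\<^sup>2 \<or> of_int d = - q\<^sup>2)"
    "\<nexists>q::rat. q \<noteq> 0 \<and> (of_int d = 2 * q\<^sup>2 \<or> of_int d = - (2 * q\<^sup>2))"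
proof -
  have 1: "d' = 1" if q: "of_int d' = q\<^sup>2" "squarefree d'" for d' and q :: rat
  proof -
    obtain n where "d' = n\<^sup>2"
      using rat_square_int[OF q(1)[symmetric]] .
    then show ?thesis
      using squarefree_square_multiple[OF q(2), of 1 n] by simp
  qed
  have 2: "d' = 2" if q: "of_int d' = 2 * q\<^sup>2" "squarefree d'" for d' and q :: rat
  proof -
    have "(2 * q)\<^sup>2 = of_int (2 * d')"
      using q(1) by (simp add: power_mult_distrib)
    then obtain n where n: "2 * d' = n\<^sup>2"
      by (rule rat_square_int)
    then have "even (n\<^sup>2)"
      by (metis dvd_triv_left)
    then obtain m where "n = 2 * m"
      by (auto elim!: evenE)
    then have "d' = 2 * m\<^sup>2"
      using n by (simp add: power_mult_distrib)
    then show ?thesis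
      using squarefree_square_multiple[OF q(2)] by blast
  qed
  have m: "squarefree (- d)"
    using assms(1) by simp
  have neg: "of_int d = - x \<longleftrightarrow> of_int (- d) = x" for x :: rat
    by auto
  show "\<nexists>q::rat. q \<noteq> 0 \<and> (of_int d = q\<^sup>2 \<or> of_int d = - q\<^sup>2)"
    unfolding neg using 1[OF _ assms(1)] 1[OF _ m] assms(2) by fastforce
  show "\<nexists>q::rat. q \<noteq> 0 \<and> (of_int d = 2 * q\<^sup>2 \<or> of_int d = - (2 * q\<^sup>2))"
    unfolding neg using 2[OF _ assms(1)] 2[OF _ m] assms(2) by fastforce
qed

lemma galoisD:
  assumes "\<sigma> \<in> absolute_galois"
  shows "\<sigma> (x + y) = \<sigma> x + \<sigma> y" "\<sigma> (x * y) = \<sigma> x * \<sigma> y" "\<sigma> (to_ac q) = to_ac q" "\<sigma> 0 = 0" "\<sigma> 1 = 1"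
    "\<sigma> (- x) = - \<sigma> x" "\<sigma> (x - y) = \<sigma> x - \<sigma> y" "\<sigma> (inverse x) = inverse (\<sigma> x)" "\<sigma> (x / y) = \<sigma> x / \<sigma> y"
    "\<sigma> (x ^ n) = \<sigma> x ^ n" "\<sigma> (numeral k) = numeral k" "\<sigma> (of_int m) = of_int m" "\<sigma> x = \<sigma> y \<longleftrightarrow> x = y"
proof -
  have h: "field_hom_on UNIV \<sigma>" and q: "\<And>q. \<sigma> (to_ac q) = to_ac q"
    using assms absolute_galois_iff by blast+
  have sub: "subfield_of (UNIV :: qbar set)"
    by (simp add: subfield_of_def)
  show add: "\<sigma> (x + y) = \<sigma> x + \<sigma> y" for x y
    using h by (simp add: field_hom_on_def)
  show mult: "\<sigma> (x * y) = \<sigma> x * \<sigma> y" for x y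
    using h by (simp add: field_hom_on_def)
  show "\<sigma> (to_ac q) = to_ac q"
    by (rule q)
  show one: "\<sigma> 1 = 1"
    using h by (simp add: field_hom_on_def)
  show "\<sigma> 0 = 0"
    using field_hom_on_0[OF sub h] .
  show minus: "\<sigma> (- x) = - \<sigma> x" for x
    using field_hom_on_minus[OF sub h] by simp
  show "\<sigma> (x - y) = \<sigma> x - \<sigma> y"
    using add[of x "- y"] minus[of y] by simp
  show inv: "\<sigma> (inverse x) = inverse (\<sigma> x)" for x
    using field_hom_on_inverse[OF sub h] by simp
  show "\<sigma> (x / y) = \<sigma> x / \<sigma> y"
    by (simp add: divide_inverse mult inv)
  show "\<sigma> (x ^ n) = \<sigma> x ^ n"
    by (induction n) (simp_all add: one mult)
  show "\<sigma> (numeral k) = numeral k"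
    using q[of "numeral k"] by simp
  show "\<sigma> (of_int m) = of_int m"
    using q[of "of_int m"] by simp
  show "\<sigma> x = \<sigma> y \<longleftrightarrow> x = y"
    using assms by (auto simp: absolute_galois_def bij_def inj_def)
qed

lemma galois_id: "(\<lambda>x. x) \<in> absolute_galois"
  by (simp add: absolute_galois_iff field_hom_on_def)

lemma galois_comp:
  assumes "\<sigma> \<in> absolute_galois" "\<tau> \<in> absolute_galois"
  shows "(\<lambda>x. \<sigma> (\<tau> x)) \<in> absolute_galois"
  unfolding absolute_galois_iff field_hom_on_def
  by (simp add: galoisD[OF assms(1)] galoisD[OF assms(2)])

lemma galois_inverse:
  assumes "\<sigma> \<in> absolute_galois"
  obtains \<tau> where "\<tau> \<in> absolute_galois" "\<And>x. \<sigma> (\<tau> x) = x" "\<And>x. \<tau> (\<sigma> x) = x"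
proof -
  have bij: "bij \<sigma>"
    using assms by (simp add: absolute_galois_def)
  define \<tau> where "\<tau> = inv_into UNIV \<sigma>"
  have s: "\<sigma> (\<tau> x) = x" "\<tau> (\<sigma> x) = x" for x
    using bij by (simp_all add: \<tau>_def bij_is_surj surj_f_inv_f bij_is_inj)
  have eq: "\<tau> y = x \<longleftrightarrow> y = \<sigma> x" for x y
    using s by metis
  have "\<tau> \<in> absolute_galois"
    unfolding absolute_galois_iff field_hom_on_def eq by (simp add: s galoisD[OF assms])
  then show ?thesis
    using that s by blast
qed

lemma rational_square_int:
  fixes x :: qbar
  assumes "x\<^sup>2 = of_int m" "x \<in> range to_ac"
  obtains q :: rat and n :: int where "q\<^sup>2 = of_int m" "m = n\<^sup>2"
proof -
  obtain q where "x = to_ac q"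
    using assms(2) by blast
  then have "to_ac (q\<^sup>2) = to_ac (of_int m)"
    using assms(1) by simp
  then have q: "q\<^sup>2 = of_int m"
    by (simp only: to_ac_eq_iff)
  then obtain n where "m = n\<^sup>2"
    by (rule rat_square_int)
  with q show ?thesis
    by (rule that)
qed

lemma int_square_notin: "(n :: int)\<^sup>2 \<notin> {2, - 2, - 4}"
proof
  assume "n\<^sup>2 \<in> {2, - 2, - 4}"
  then consider "n\<^sup>2 = 2" | "n\<^sup>2 < 0"
    by fastforce
  then show False
    using int_square_mod_4[of n] by cases simp_all
qed

lemma minus_eq_self_iff: "- x = x \<longleftrightarrow> x = 0" for x :: qbar
proof
  assume "- x = x"
  then have "2 * x = 0"
    by (metis add.right_inverse mult_2)
  then show "x = 0"
    by simp
qed simp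

section \<open>Automorphisms with prescribed signs on several square roots\<close>

definition is_quadratic :: "qbar \<Rightarrow> bool" where
  "is_quadratic \<alpha> \<longleftrightarrow> \<alpha>\<^sup>2 \<in> range to_ac"

lemma is_quadratic_mult: "is_quadratic \<alpha> \<Longrightarrow> is_quadratic \<beta> \<Longrightarrow> is_quadratic (\<alpha> * \<beta>)"
  unfolding is_quadratic_def power_mult_distrib by (auto simp flip: to_ac_mult)

lemma galois_quadratic:
  assumes "is_quadratic \<alpha>" "\<sigma> \<in> absolute_galois"
  shows "\<sigma> \<alpha> = \<alpha> \<or> \<sigma> \<alpha> = - \<alpha>"
proof -
  obtain q where "\<alpha>\<^sup>2 = to_ac q"
    using assms(1) by (auto simp: is_quadratic_def)
  then have "(\<sigma> \<alpha>)\<^sup>2 = \<alpha>\<^sup>2"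
    using galoisD(3,10)[OF assms(2)] by metis
  then show ?thesis
    by (simp add: power2_eq_iff)
qed

lemma galois_moves_quadratic:
  assumes "is_quadratic \<alpha>" "\<alpha> \<notin> range to_ac"
  obtains \<sigma> where "\<sigma> \<in> absolute_galois" "\<sigma> \<alpha> = - \<alpha>"
  using assms galois_moves_sqrt unfolding is_quadratic_def by (metis rangeE)

text \<open>Take \<open>s\<close> moving \<open>\<beta>\<close> and \<open>t\<close> moving
  \<open>\<alpha> * \<beta>\<close>: one of \<open>s\<close>, \<open>t\<close> and their composite
  has the required signs.\<close>

lemma galois_fix1_move1:
  assumes \<alpha>: "is_quadratic \<alpha>" and \<beta>: "is_quadratic \<beta>" "\<beta> \<notin> range to_ac" "\<alpha> * \<beta> \<notin> range to_ac"
  obtains \<sigma> where "\<sigma> \<in> absolute_galois" "\<sigma> \<alpha> = \<alpha>" "\<sigma> \<beta> = - \<beta>"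
proof -
  have nz: "\<alpha> \<noteq> 0" "\<beta> \<noteq> 0"
    using \<beta>(2,3) by (metis mult_zero_left range_eqI to_ac_0, metis range_eqI to_ac_0)
  obtain s where s: "s \<in> absolute_galois" "s \<beta> = - \<beta>"
    using galois_moves_quadratic[OF \<beta>(1,2)] .
  obtain t where t: "t \<in> absolute_galois" "t (\<alpha> * \<beta>) = - (\<alpha> * \<beta>)"
    using galois_moves_quadratic[OF is_quadratic_mult[OF \<alpha> \<beta>(1)] \<beta>(3)] .
  have "t \<alpha> * t \<beta> = - (\<alpha> * \<beta>)"
    using t galoisD(2) by metis
  then have "t \<alpha> = \<alpha> \<and> t \<beta> = - \<beta> \<or> t \<alpha> = - \<alpha> \<and> t \<beta> = \<beta>"
    using galois_quadratic[OF \<alpha> t(1)] galois_quadratic[OF \<beta>(1) t(1)] nz by auto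
  moreover have "s \<alpha> = \<alpha> \<or> s \<alpha> = - \<alpha>"
    by (rule galois_quadratic[OF \<alpha> s(1)])
  ultimately show ?thesis
    using that s t galois_comp[OF s(1) t(1)] galoisD(6)[OF s(1)] by (metis minus_minus)
qed

lemma galois_fix2_move1:
  assumes \<alpha>: "is_quadratic \<alpha>" and \<beta>: "is_quadratic \<beta>" and \<gamma>: "is_quadratic \<gamma>" "\<gamma> \<notin> range to_ac"
    "\<alpha> * \<gamma> \<notin> range to_ac" "\<beta> * \<gamma> \<notin> range to_ac" "\<alpha> * (\<beta> * \<gamma>) \<notin> range to_ac"
  obtains \<sigma> where "\<sigma> \<in> absolute_galois" "\<sigma> \<alpha> = \<alpha>" "\<sigma> \<beta> = \<beta>" "\<sigma> \<gamma> = - \<gamma>"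
proof -
  have nz: "\<beta> \<noteq> 0" "\<gamma> \<noteq> 0"
    using \<gamma>(2,4) by (metis mult_zero_left range_eqI to_ac_0, metis range_eqI to_ac_0)
  obtain s where s: "s \<in> absolute_galois" "s \<alpha> = \<alpha>" "s \<gamma> = - \<gamma>"
    using galois_fix1_move1[OF \<alpha> \<gamma>(1,2,3)] .
  obtain t where t: "t \<in> absolute_galois" "t \<alpha> = \<alpha>" "t (\<beta> * \<gamma>) = - (\<beta> * \<gamma>)"
    using galois_fix1_move1[OF \<alpha> is_quadratic_mult[OF \<beta> \<gamma>(1)] \<gamma>(4,5)] .
  have "t \<beta> * t \<gamma> = - (\<beta> * \<gamma>)"
    using t galoisD(2) by metis
  then have "t \<beta> = \<beta> \<and> t \<gamma> = - \<gamma> \<or> t \<beta> = - \<beta> \<and> t \<gamma> = \<gamma>"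
    using galois_quadratic[OF \<beta> t(1)] galois_quadratic[OF \<gamma>(1) t(1)] nz by auto
  moreover have "s \<beta> = \<beta> \<or> s \<beta> = - \<beta>"
    by (rule galois_quadratic[OF \<beta> s(1)])
  ultimately show ?thesis
    using that s t galois_comp[OF s(1) t(1)] galoisD(6)[OF s(1)] by (metis minus_minus)
qed

section \<open>The Galois image of the quadratic twists\<close>

locale Ed_curve =
  fixes d :: int and w :: qbar
  assumes d_nonzero: "d \<noteq> 0" and w_square: "w\<^sup>2 = - 2"

sublocale Ed_curve \<subseteq> cm_curve "of_int d" w
  by standard (simp_all add: d_nonzero w_square)

context Ed_curve
begin

lemma E_eq: "ec_qbar (Ed_A d) (Ed_B d) = E"
  by (simp add: Ed_A_def Ed_B_def EA_def EB_def)

lemma tate_module_eq: "tate_module (Ed_A d) (Ed_B d) = E.gtate"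
  unfolding tate_module_def E.gtate_def E_eq ..

lemma tate_comb_eq: "tate_comb (Ed_A d) (Ed_B d) = E.gcomb"
  unfolding tate_comb_def tate_add_def tate_scale_def E.gcomb_def E_eq ..

lemma Ed_basis_eq: "Ed_basis d e1 e2 = E.gbasis e1 e2"
  unfolding Ed_basis_def tate_basis_def E.gbasis_def tate_module_eq tate_comb_eq ..

lemma Ed_image_eq: "Ed_image d e1 e2 = {M. \<exists>\<sigma>\<in>absolute_galois. E.gmatrix e1 e2 (map_ec_point \<sigma>) M}"
  unfolding Ed_image_def galois_image_def galois_act_def E.gmatrix_def tate_comb_eq ..

lemma map_pt:
  assumes "\<sigma> \<in> absolute_galois"
  shows "map_ec_point \<sigma> (pt \<xi> \<eta>) = pt (\<sigma> \<xi>) (\<sigma> \<eta>)"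
  by (simp add: pt_def galoisD[OF assms])

lemma map_on_curve:
  assumes "\<sigma> \<in> absolute_galois" "on_curve P"
  shows "on_curve (map_ec_point \<sigma> P)"
proof (cases P)
  case (Affine x y)
  have "\<sigma> EA = EA" "\<sigma> EB = EB"
    by (simp_all add: EA_def EB_def galoisD[OF assms(1)])
  moreover have "\<sigma> (y\<^sup>2) = \<sigma> (x ^ 3 + EA * x + EB)"
    using assms(2) Affine by simp
  ultimately show ?thesis
    unfolding Affine by (simp add: galoisD(1,2,10)[OF assms(1)])
qed simp

lemma map_add:
  assumes "\<sigma> \<in> absolute_galois"
  shows "map_ec_point \<sigma> (add P Q) = add (map_ec_point \<sigma> P) (map_ec_point \<sigma> Q)"
proof (cases P; cases Q)
  fix x1 y1 x2 y2
  assume PQ: "P = Affine x1 y1" "Q = Affine x2 y2"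
  have "\<sigma> EA = EA"
    by (simp add: EA_def galoisD[OF assms])
  moreover have "\<sigma> x1 = \<sigma> x2 \<longleftrightarrow> x1 = x2" "\<sigma> y1 = - \<sigma> y2 \<longleftrightarrow> y1 = - y2"
    using galoisD(13)[OF assms, of x1 x2] galoisD(13)[OF assms, of y1 "- y2"] galoisD(6)[OF assms] by auto
  ultimately show ?thesis
    unfolding PQ by (simp add: ec_add.simps(3) Let_def galoisD(1-3,6-11)[OF assms])
qed simp_all

lemma map_hom: "\<sigma> \<in> absolute_galois \<Longrightarrow> map_ec_point \<sigma> \<in> hom E E"
  by (rule homI) (simp_all add: carrier_E map_on_curve map_add)

lemma is_quadratic_w: "is_quadratic w"
  unfolding is_quadratic_def w_square by (metis rangeI to_ac_minus to_ac_numeral)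

lemma map_phi:
  assumes \<sigma>: "\<sigma> \<in> absolute_galois"
  shows "map_ec_point \<sigma> (phi P) = (if \<sigma> w = w then phi (map_ec_point \<sigma> P) else neg (phi (map_ec_point \<sigma> P)))"
proof (cases P rule: pt_cases)
  case (2 \<xi> \<eta>)
  have "\<sigma> \<xi> = 0 \<longleftrightarrow> \<xi> = 0"
    using galoisD(13)[OF \<sigma>, of \<xi> 0] galoisD(4)[OF \<sigma>] by simp
  moreover have "\<sigma> w = w \<or> \<sigma> w = - w"
    by (rule galois_quadratic[OF is_quadratic_w \<sigma>])
  ultimately show ?thesis
    unfolding 2 by (auto simp: map_pt[OF \<sigma>] phi_pt galoisD[OF \<sigma>])
qed simp

lemma map_slope: "\<sigma> \<in> absolute_galois \<Longrightarrow> slope (map_ec_point \<sigma> P) = \<sigma> (slope P)"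
  by (cases P) (simp_all add: slope_def galoisD)

lemma map_xc: "\<sigma> \<in> absolute_galois \<Longrightarrow> xc (map_ec_point \<sigma> P) = \<sigma> (xc P)"
  by (cases P) (simp_all add: xc_def galoisD)

text \<open>\<open>kappa\<close> has rational coefficients: the sign with which
  \<open>\<sigma>\<close> commutes with \<open>phi\<close> disappears under
  \<open>xc\<close>.\<close>

lemma map_kappa:
  assumes \<sigma>: "\<sigma> \<in> absolute_galois"
  shows "kappa (map_ec_point \<sigma> P) = \<sigma> (kappa P)"
proof -
  have 1: "xc (phi (map_ec_point \<sigma> Q)) = \<sigma> (xc (phi Q))" for Q
    using map_xc[OF \<sigma>, of "phi Q"] map_phi[OF \<sigma>, of Q] by (simp split: if_splits)
  have "xc (phi (phi (map_ec_point \<sigma> P))) = xc (phi (map_ec_point \<sigma> (phi P)))"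
    using map_phi[OF \<sigma>, of P] phi_neg by (simp split: if_splits)
  then have 2: "xc (phi (phi (map_ec_point \<sigma> P))) = \<sigma> (xc (phi (phi P)))"
    using 1 by simp
  show ?thesis
    unfolding kappa_def 1 2 map_slope[OF \<sigma>] by (simp add: galoisD[OF \<sigma>])
qed

end

locale Ed_generator = Ed_curve +
  fixes Q :: "nat \<Rightarrow> qbar ec_point"
  assumes Q: "E.cyclic_generator Q"
begin

abbreviation "e1 \<equiv> \<lambda>n. phi (Q n)"

lemma basis: "E.gbasis e1 Q"
  by (rule E.cyclic_generator_gbasis[OF Q])

lemma Q_tate: "Q \<in> E.gtate"
  using Q by (simp add: E.cyclic_generator_def)

lemma Q_closed: "Q n \<in> carrier E"
  by (rule E.gtateD(1)[OF Q_tate])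

lemma comb_act: "E.gcomb e1 Q b a n = E.act (z2_residue a n) (z2_residue b n) (Q n)"
  using E.m_comm[OF E.int_pow_closed[OF E.\<phi>_closed[OF Q_closed]] E.int_pow_closed[OF Q_closed]]
  unfolding E.gcomb_int E.act_def .

lemma map_Q:
  assumes "E.gmatrix e1 Q (map_ec_point \<sigma>) M"
  shows "map_ec_point \<sigma> (Q n) = E.act (z2_residue (M $ 2 $ 2) n) (z2_residue (M $ 1 $ 2) n) (Q n)"
    "map_ec_point \<sigma> (phi (Q n)) = E.act (z2_residue (M $ 2 $ 1) n) (z2_residue (M $ 1 $ 1) n) (Q n)"
  using assms unfolding E.gmatrix_def comb_act[symmetric] by metis+

text \<open>Both parts compare the coordinates of \<open>\<sigma> (w Q)\<close> with those of
  \<open>w (\<sigma> Q)\<close>, which agree up to the sign of \<open>\<sigma>\<close> at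
  \<open>w\<close>.\<close>

lemma matrix_type:
  assumes \<sigma>: "\<sigma> \<in> absolute_galois" and M: "E.gmatrix e1 Q (map_ec_point \<sigma>) M"
  shows "\<sigma> w = w \<Longrightarrow> in_C M" "\<sigma> w \<noteq> w \<Longrightarrow> in_A M"
proof -
  have phi_act: "phi (E.act a b (Q n)) = E.act (- 2 * b) a (Q n)" for a b n
  proof -
    have "phi (Q n) = E.act 0 1 (Q n)"
      using Q_closed[of n] E.\<phi>_closed[OF Q_closed[of n]] by (simp add: E.act_def E.int_pow_1 del: mult_E one_E)
    then show ?thesis
      using E.\<phi>_act[OF Q_closed, of a b n] E.act_act[OF Q_closed, of a b 0 1 n] by simp
  qed
  show "in_C M" if "\<sigma> w = w"
  proof -
    have "E.act (z2_residue (M $ 2 $ 1) n) (z2_residue (M $ 1 $ 1) n) (Q n) =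
        E.act (- 2 * z2_residue (M $ 1 $ 2) n) (z2_residue (M $ 2 $ 2) n) (Q n)" for n
      using map_Q[OF M, of n] map_phi[OF \<sigma>, of "Q n"] that phi_act by simp
    then show ?thesis
      unfolding E.act_eq_iff[OF Q] in_C_def by (auto intro!: z2_eqI simp: mod_simps)
  qed
  show "in_A M" if "\<sigma> w \<noteq> w"
  proof -
    have "E.act (z2_residue (M $ 2 $ 1) n) (z2_residue (M $ 1 $ 1) n) (Q n) =
        E.act (- (- 2 * z2_residue (M $ 1 $ 2) n)) (- z2_residue (M $ 2 $ 2) n) (Q n)" for n
    proof -
      have "map_ec_point \<sigma> (phi (Q n)) = neg (E.act (- 2 * z2_residue (M $ 1 $ 2) n) (z2_residue (M $ 2 $ 2) n) (Q n))"
        using map_Q(1)[OF M, of n] map_phi[OF \<sigma>, of "Q n"] that phi_act by simp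
      moreover have "on_curve (E.act a b (Q n))" for a b
        using E.act_closed[OF Q_closed] carrier_E by blast
      ultimately show ?thesis
        using map_Q(2)[OF M, of n] unfolding E.act_inverse[OF Q_closed] by (simp add: inv_E)
    qed
    then show ?thesis
      unfolding E.act_eq_iff[OF Q] in_A_def by (auto intro!: z2_eqI simp: mod_simps)
  qed
qed

section \<open>The image in the basis \<open>(w Q, Q)\<close> as a closed subgroup\<close>

definition image :: "(z2^2^2) set" where
  "image = {M. \<exists>\<sigma>\<in>absolute_galois. E.gmatrix e1 Q (map_ec_point \<sigma>) M}"

lemma matrix_exists:
  assumes "\<sigma> \<in> absolute_galois"
  obtains M where "E.gmatrix e1 Q (map_ec_point \<sigma>) M" "M \<in> image"
  using E.gmatrix_exists[OF basis map_hom[OF assms]] assms unfolding image_def by blast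

lemma map_map:
  assumes "\<And>x. \<sigma> (\<tau> x) = \<rho> x"
  shows "map_ec_point \<sigma> (map_ec_point \<tau> P) = map_ec_point \<rho> P"
  using assms by (cases P) simp_all

lemma matrix_comp:
  assumes "\<sigma> \<in> absolute_galois" "E.gmatrix e1 Q (map_ec_point \<sigma>) M" "E.gmatrix e1 Q (map_ec_point \<tau>) N"
  shows "E.gmatrix e1 Q (map_ec_point (\<lambda>x. \<sigma> (\<tau> x))) (M ** N)"
  using E.gmatrix_comp[OF basis map_hom[OF assms(1)] assms(2,3)] map_map[of \<sigma> \<tau> "\<lambda>x. \<sigma> (\<tau> x)"]
  by (simp add: fun_eq_iff)

lemma matrix_id: "E.gmatrix e1 Q (map_ec_point (\<lambda>x. x)) (mat 1)"
proof -
  have "map_ec_point (\<lambda>x. x) = (\<lambda>x :: qbar ec_point. x)"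
    by (rule ext) (simp add: ec_point.map_ident)
  then show ?thesis
    using E.gmatrix_id[OF basis] by simp
qed

lemma image_inverse:
  assumes "M \<in> image"
  obtains N where "N \<in> image" "M ** N = mat 1" "N ** M = mat 1"
proof -
  obtain \<sigma> where \<sigma>: "\<sigma> \<in> absolute_galois" "E.gmatrix e1 Q (map_ec_point \<sigma>) M"
    using assms by (auto simp: image_def)
  obtain \<tau> where \<tau>: "\<tau> \<in> absolute_galois" "\<And>x. \<sigma> (\<tau> x) = x" "\<And>x. \<tau> (\<sigma> x) = x"
    using galois_inverse[OF \<sigma>(1)] by metis
  obtain N where N: "E.gmatrix e1 Q (map_ec_point \<tau>) N" "N \<in> image"
    using matrix_exists[OF \<tau>(1)] .
  have "M ** N = mat 1"
    using matrix_comp[OF \<sigma> N(1)] unfolding \<tau>(2) by (rule E.gmatrix_unique[OF basis _ matrix_id])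
  moreover have "N ** M = mat 1"
    using matrix_comp[OF \<tau>(1) N(1) \<sigma>(2)] unfolding \<tau>(3) by (rule E.gmatrix_unique[OF basis _ matrix_id])
  ultimately show ?thesis
    using that N(2) by blast
qed

lemma image_normC: "image \<subseteq> normC"
proof
  fix M assume M: "M \<in> image"
  have "invertible M"
    using image_inverse[OF M] unfolding invertible_def by metis
  then show "M \<in> normC"
    using M matrix_type unfolding image_def normC_def by blast
qed

lemma subgroup_image: "subgroup image GL2_Z2"
proof
  show "image \<subseteq> carrier GL2_Z2"
    using image_normC by (auto simp: normC_def)
  show "\<one>\<^bsub>GL2_Z2\<^esub> \<in> image"
    using matrix_id galois_id by (auto simp: image_def)
  show "M \<otimes>\<^bsub>GL2_Z2\<^esub> N \<in> image" if "M \<in> image" "N \<in> image" for M N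
    using that matrix_comp galois_comp unfolding image_def by (simp, blast)
  show "inv\<^bsub>GL2_Z2\<^esub> M \<in> image" if M: "M \<in> image" for M
  proof -
    obtain N where N: "N \<in> image" "M ** N = mat 1" "N ** M = mat 1"
      using image_inverse[OF M] .
    then have "inv\<^bsub>GL2_Z2\<^esub> M = N"
      using group.inv_equality[OF group_GL2_Z2, of N M] by (auto simp: invertible_def)
    then show ?thesis using N(1) by simp
  qed
qed

text \<open>Choose automorphisms realizing better and better approximations of \<open>M\<close>; a
  cluster point of them realizes \<open>M\<close>.\<close>

lemma limit_closed_image: "limit_closed image"
  unfolding limit_closed_def
proof (intro conjI ballI impI)
  show "image \<subseteq> carrier GL2_Z2"
    by (rule subgroup.subset[OF subgroup_image])
  fix M assume lim: "\<forall>k. \<exists>N\<in>image. mat_cong k M N"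
  then obtain N where N: "\<And>k. N k \<in> image" "\<And>k. mat_cong k M (N k)"
    by metis
  then obtain \<sigma> where \<sigma>: "\<And>k. \<sigma> k \<in> absolute_galois" "\<And>k. E.gmatrix e1 Q (map_ec_point (\<sigma> k)) (N k)"
    unfolding image_def by (simp, metis)
  obtain \<tau> where \<tau>: "\<tau> \<in> absolute_galois" "\<And>Z m. finite Z \<Longrightarrow> \<exists>n\<ge>m. \<forall>x\<in>Z. \<sigma> n x = \<tau> x"
    using absolute_galois_cluster[of \<sigma>] \<sigma>(1) by metis
  have fin: "finite (set_ec_point P)" for P :: "qbar ec_point"
    by (cases P) simp_all
  have "map_ec_point \<tau> (e1 k) = E.gcomb e1 Q (M $ 1 $ 1) (M $ 2 $ 1) k \<and>
      map_ec_point \<tau> (Q k) = E.gcomb e1 Q (M $ 1 $ 2) (M $ 2 $ 2) k" for k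
  proof -
    \<comment> \<open>Level \<open>k\<close> involves finitely many coordinates, on which
      \<open>\<tau>\<close> agrees with some \<open>\<sigma> n\<close>; \<open>n \<ge> k\<close>
      makes \<open>N n\<close> congruent to \<open>M\<close> modulo \<open>2^k\<close> as
      well.\<close>
    obtain n where n: "n \<ge> k" "\<forall>x\<in>set_ec_point (e1 k) \<union> set_ec_point (Q k). \<sigma> n x = \<tau> x"
      using \<tau>(2)[of "set_ec_point (e1 k) \<union> set_ec_point (Q k)" k] fin by auto
    have "map_ec_point \<tau> (e1 k) = map_ec_point (\<sigma> n) (e1 k)" "map_ec_point \<tau> (Q k) = map_ec_point (\<sigma> n) (Q k)"
      using n(2) by (auto intro!: ec_point.map_cong0)
    moreover have "z2_residue (N n $ i $ j) k = z2_residue (M $ i $ j) k" for i j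
      using mat_cong_le[OF n(1) N(2)[of n]] by (simp add: mat_cong_def)
    ultimately show ?thesis
      using map_Q[OF \<sigma>(2)[of n], of k] unfolding comb_act by simp
  qed
  then have "E.gmatrix e1 Q (map_ec_point \<tau>) M"
    by (simp add: E.gmatrix_def fun_eq_iff)
  then show "M \<in> image"
    using \<tau>(1) by (auto simp: image_def)
qed

text \<open>\<open>r\<close> is read off from \<open>Q 1\<close> and \<open>k\<close> is
  \<open>kappa\<close> at \<open>w (Q 3)\<close>. The factor \<open>gamma_mat\<close> in the action
  on \<open>k\<close> comes from that \<open>w\<close>: \<open>\<sigma>\<close> sends
  \<open>w (Q 3)\<close> to \<open>w (\<sigma> (Q 3))\<close> up to this sign.\<close>

lemma characters:
  obtains r k where "r\<^sup>2 = 2" "k\<^sup>2 = 2 * of_int d"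
    "\<And>\<sigma> M. \<sigma> \<in> absolute_galois \<Longrightarrow> E.gmatrix e1 Q (map_ec_point \<sigma>) M \<Longrightarrow>
       \<sigma> w = of_int (gamma_mat M) * w \<and> \<sigma> r = of_int (beta_mat M) * r \<and>
       \<sigma> k = of_int (chi_mat M * gamma_mat M) * k"
proof -
  have T1: "on_curve (Q 1)" "phi (Q 1) = pt 0 0"
    using Q Q_closed[of 1] carrier_E by (auto simp: E.cyclic_generator_def)
  obtain r where r: "r\<^sup>2 = 2" "Q 1 = pt (- of_int d * (2 + r)) 0"
    using level2_coords[OF T1] .
  \<comment> \<open>\<open>Q 3\<close> has annihilator \<open>w^6\<close>, because four applications
    of \<open>phi\<close> give \<open>Q 1\<close> and a fifth gives \<open>pt 0 0\<close>; so
    \<open>P\<close> is of level 5.\<close>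
  define P where "P = phi (Q 3)"
  have P: "level5 P"
  proof -
    have "phi (phi (phi (phi (Q 3)))) = (Q 3 [^]\<^bsub>E\<^esub> (- 2 :: int)) [^]\<^bsub>E\<^esub> (- 2 :: int)"
      using Q_closed[of 3] by (simp only: E.\<phi>_\<phi> E.\<phi>_closed E.int_pow_closed)
    also have "\<dots> = (Q 3 [^]\<^bsub>E\<^esub> (2 :: int)) [^]\<^bsub>E\<^esub> (2 :: int)"
      using Q_closed[of 3] by (simp add: E.int_pow_pow)
    also have "\<dots> = Q 1"
      using E.gtateD(3)[OF Q_tate, of 2] E.gtateD(3)[OF Q_tate, of 1]
      by (simp add: numeral_3_eq_3 numeral_2_eq_2)
    finally have "phi (phi (phi (phi P))) = pt 0 0"
      unfolding P_def T1(2)[symmetric] by simp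
    then show ?thesis
      using Q_closed[of 3] on_curve_phi carrier_E by (simp add: level5_def P_def)
  qed
  have k2: "(kappa P)\<^sup>2 = 2 * of_int d"
    by (rule kappa_square[OF P])
  have k0: "kappa P \<noteq> 0"
    using k2 d_nonzero by auto
  show ?thesis
  proof (rule that[OF r(1) k2], intro conjI)
    fix \<sigma> M
    assume \<sigma>: "\<sigma> \<in> absolute_galois" and M: "E.gmatrix e1 Q (map_ec_point \<sigma>) M"
    have Mn: "M \<in> normC"
      using image_normC \<sigma> M by (auto simp: image_def)
    define a b where "a = M $ 2 $ 2" "b = M $ 1 $ 2"
    have a: "z2_odd a"
      using normC_odd[OF Mn] by (simp add: a_b_def)
    have w: "\<sigma> w = w \<or> \<sigma> w = - w"
      by (rule galois_quadratic[OF is_quadratic_w \<sigma>])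
    have gamma: "gamma_mat M = (if \<sigma> w = w then 1 else - 1)"
      using matrix_type[OF \<sigma> M] not_in_C_and_A[OF Mn] by (auto simp: gamma_mat_def)
    then show "\<sigma> w = of_int (gamma_mat M) * w"
      using w by auto
    show "\<sigma> r = of_int (beta_mat M) * r"
    proof -
      have "is_quadratic r"
        unfolding is_quadratic_def r(1) by (metis rangeI to_ac_numeral)
      then have "\<sigma> r = r \<or> \<sigma> r = - r"
        using galois_quadratic \<sigma> by blast
      moreover have "\<sigma> r = r \<longleftrightarrow> beta_mat M = 1"
      proof -
        have "\<sigma> r = r \<longleftrightarrow> map_ec_point \<sigma> (Q 1) = Q 1"
          unfolding r(2) map_pt[OF \<sigma>] using d_nonzero by (simp add: galoisD[OF \<sigma>])
        also have "\<dots> \<longleftrightarrow> E.act (z2_residue a 1) (z2_residue b 1) (Q 1) = E.act 1 0 (Q 1)"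
          unfolding map_Q(1)[OF M] a_b_def using Q_closed[of 1] by (simp add: E.act_def del: mult_E one_E)
        also have "\<dots> \<longleftrightarrow> beta_mat M = 1"
          unfolding E.act_eq_iff[OF Q] using a z2_residue_range[of b 1] by (auto simp: beta_mat_def a_b_def)
        finally show ?thesis .
      qed
      ultimately show ?thesis
        by (auto simp: beta_mat_def)
    qed
    have "\<sigma> (kappa P) = kappa (map_ec_point \<sigma> P)"
      by (simp add: map_kappa[OF \<sigma>])
    also have "map_ec_point \<sigma> P = (if \<sigma> w = w then phi (map_ec_point \<sigma> (Q 3)) else neg (phi (map_ec_point \<sigma> (Q 3))))"
      unfolding P_def by (rule map_phi[OF \<sigma>])
    also have "phi (map_ec_point \<sigma> (Q 3)) = E.act (z2_residue a 3) (z2_residue b 3) P"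
      unfolding map_Q(1)[OF M] a_b_def P_def by (rule E.\<phi>_act[OF Q_closed])
    also have "kappa (if \<sigma> w = w then E.act (z2_residue a 3) (z2_residue b 3) P
        else neg (E.act (z2_residue a 3) (z2_residue b 3) P)) =
        of_int (gamma_mat M) * kappa (E.act (z2_residue a 3) (z2_residue b 3) P)"
      unfolding gamma by (simp add: kappa_neg)
    also have "kappa (E.act (z2_residue a 3) (z2_residue b 3) P) = of_int (chi_mat M) * kappa P"
      using kappa_act[OF P odd_residue[OF a, of 3]] by (simp add: chi_mat_def chi2_eq a_b_def)
    finally show "\<sigma> (kappa P) = of_int (chi_mat M * gamma_mat M) * kappa P"
      by (simp add: mult_ac)
  qed
qed

lemma odd_of_moves:
  fixes r :: qbar
  assumes "r\<^sup>2 = 2" "\<sigma> r = of_int (beta_mat M) * r" "\<sigma> r = - r"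
  shows "z2_odd (M $ 1 $ 2)"
proof (rule ccontr)
  assume "\<not> z2_odd (M $ 1 $ 2)"
  then have "- r = r"
    using assms(2,3) by (simp add: beta_mat_def)
  then have "r = 0"
    by (simp only: minus_eq_self_iff)
  then show False
    using assms(1) by simp
qed

text \<open>Generators come from an automorphism fixing \<open>w\<close> and moving
  \<open>r\<close>, and one moving \<open>w\<close>. They exist because \<open>w\<close>,
  \<open>r\<close> and \<open>w r\<close> are irrational, whatever \<open>d\<close> is.\<close>

lemma image_eq_index2:
  assumes "image \<subseteq> normC_index2 i j"
  shows "image = normC_index2 i j"
proof -
  obtain r k where rk: "r\<^sup>2 = 2" "k\<^sup>2 = 2 * of_int d"
    "\<And>\<sigma> M. \<sigma> \<in> absolute_galois \<Longrightarrow> E.gmatrix e1 Q (map_ec_point \<sigma>) M \<Longrightarrow>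
       \<sigma> w = of_int (gamma_mat M) * w \<and> \<sigma> r = of_int (beta_mat M) * r \<and>
       \<sigma> k = of_int (chi_mat M * gamma_mat M) * k"
    by (rule characters, rule that; blast)
  have irr: "x \<notin> range to_ac" if "x\<^sup>2 = of_int m" "m \<in> {2, - 2, - 4}" for x :: qbar and m
    using rational_square_int[OF that(1)] that(2) int_square_notin by metis
  have w: "w \<notin> range to_ac" "r \<notin> range to_ac" "w * r \<notin> range to_ac"
    using irr[of w "- 2"] irr[of r 2] irr[of "w * r" "- 4"] rk(1) w_square by (simp_all add: power_mult_distrib)
  have qr: "is_quadratic r"
    unfolding is_quadratic_def rk(1) by (metis rangeI to_ac_numeral)
  obtain \<sigma> where \<sigma>: "\<sigma> \<in> absolute_galois" "\<sigma> w = w" "\<sigma> r = - r"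
    using galois_fix1_move1[OF is_quadratic_w qr w(2,3)] .
  obtain \<tau> where \<tau>: "\<tau> \<in> absolute_galois" "\<tau> w = - w"
    using galois_moves_quadratic[OF is_quadratic_w w(1)] .
  obtain M where M: "E.gmatrix e1 Q (map_ec_point \<sigma>) M" "M \<in> image"
    using matrix_exists[OF \<sigma>(1)] .
  obtain N where N: "E.gmatrix e1 Q (map_ec_point \<tau>) N" "N \<in> image"
    using matrix_exists[OF \<tau>(1)] .
  have nz: "w \<noteq> 0" "r \<noteq> 0"
    using w_square rk(1) by auto
  have MC: "in_C M"
    by (rule matrix_type(1)[OF \<sigma>(1) M(1) \<sigma>(2)])
  have beta: "z2_odd (M $ 1 $ 2)"
    using odd_of_moves[where \<sigma> = \<sigma>, OF rk(1) _ \<sigma>(3)] rk(3)[OF \<sigma>(1) M(1)] by blast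
  have "N \<in> normC"
    using image_normC N(2) by blast
  moreover have "in_A N"
    using matrix_type(2)[OF \<tau>(1) N(1)] \<tau>(2) nz(1) minus_eq_self_iff by simp
  ultimately have NA: "\<not> in_C N"
    using not_in_C_and_A by blast
  have "cmat (M $ 2 $ 2) (M $ 1 $ 2) \<in> image" "cmat (M $ 2 $ 2) (M $ 1 $ 2) \<in> normC_index2 i j"
    using in_C_cmat[OF MC] M(2) assms by auto
  then show ?thesis
    using topological_generators[OF subgroup_image limit_closed_image _ _ beta N(2) _ NA] N(2) assms by blast
qed

lemma image_special:
  assumes "d \<in> {2, 1, - 1, - 2}"
  shows "image = normC_index2 (d \<in> {1, - 2}) (d < 0)"
proof (rule image_eq_index2, rule subsetI)
  obtain r k where rk: "r\<^sup>2 = 2" "k\<^sup>2 = 2 * of_int d"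
    "\<And>\<sigma> M. \<sigma> \<in> absolute_galois \<Longrightarrow> E.gmatrix e1 Q (map_ec_point \<sigma>) M \<Longrightarrow>
       \<sigma> w = of_int (gamma_mat M) * w \<and> \<sigma> r = of_int (beta_mat M) * r \<and>
       \<sigma> k = of_int (chi_mat M * gamma_mat M) * k"
    by (rule characters, rule that; blast)
  fix M assume M: "M \<in> image"
  then obtain \<sigma> where \<sigma>: "\<sigma> \<in> absolute_galois" "E.gmatrix e1 Q (map_ec_point \<sigma>) M"
    by (auto simp: image_def)
  note act = rk(3)[OF \<sigma>]
  \<comment> \<open>A square root of \<open>2 d\<close> in each case: \<open>2\<close>,
    \<open>r\<close>, \<open>w\<close>, \<open>w r\<close> for
    \<open>d = 2, 1, -1, -2\<close>.\<close>
  define z where "z = (if d \<in> {1, - 2} then r else 1) * (if d < 0 then w else 1) * (if d = 2 then 2 else 1)"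
  define c where "c = (if d \<in> {1, - 2} then beta_mat M else 1) * (if d < 0 then gamma_mat M else 1)"
  have "z\<^sup>2 = 2 * of_int d"
    using assms rk(1) w_square by (auto simp: z_def power_mult_distrib)
  then have "k\<^sup>2 = z\<^sup>2"
    using rk(2) by simp
  then have kz: "k = z \<or> k = - z"
    by (simp add: power2_eq_iff)
  have "\<sigma> z = of_int c * z"
    using act by (simp add: z_def c_def galoisD[OF \<sigma>(1)])
  then have "\<sigma> k = of_int c * k"
    using kz galoisD(6)[OF \<sigma>(1)] by auto
  then have "of_int (chi_mat M * gamma_mat M) * k = of_int c * k"
    using act by simp
  moreover have "k \<noteq> 0"
    using rk(2) d_nonzero by auto
  ultimately have "of_int (chi_mat M * gamma_mat M) = (of_int c :: qbar)"
    by simp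
  then have "chi_mat M * gamma_mat M = c"
    by (simp only: of_int_eq_iff)
  then have "psi (d \<in> {1, - 2}) (d < 0) M = c * c"
    unfolding psi_def c_def by simp
  also have "\<dots> = 1"
    by (simp add: c_def beta_mat_def gamma_mat_def)
  finally show "M \<in> normC_index2 (d \<in> {1, - 2}) (d < 0)"
    using M image_normC by (auto simp: normC_index2_def)
qed

text \<open>\<open>psi False False\<close> describes the action on \<open>k\<close>. Automorphisms
  fixing \<open>k\<close> provide generators of its kernel as before; one that moves only
  \<open>k\<close> lies outside and fills the remaining coset.\<close>

lemma image_generic:
  assumes gen: "\<nexists>q::rat. q \<noteq> 0 \<and> (of_int d = q\<^sup>2 \<or> of_int d = - q\<^sup>2)"
    "\<nexists>q::rat. q \<noteq> 0 \<and> (of_int d = 2 * q\<^sup>2 \<or> of_int d = - (2 * q\<^sup>2))"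
  shows "image = normC"
proof -
  obtain r k where rk: "r\<^sup>2 = 2" "k\<^sup>2 = 2 * of_int d"
    "\<And>\<sigma> M. \<sigma> \<in> absolute_galois \<Longrightarrow> E.gmatrix e1 Q (map_ec_point \<sigma>) M \<Longrightarrow>
       \<sigma> w = of_int (gamma_mat M) * w \<and> \<sigma> r = of_int (beta_mat M) * r \<and>
       \<sigma> k = of_int (chi_mat M * gamma_mat M) * k"
    by (rule characters, rule that; blast)
  have irr: "x \<notin> range to_ac" if sq: "x\<^sup>2 = of_int m" "m \<in> {2, - 2, - 4, 2 * d, 4 * d, - 4 * d, - 8 * d}" for x :: qbar and m
  proof
    assume x: "x \<in> range to_ac"
    obtain q :: rat and n where q: "q\<^sup>2 = of_int m" and n: "m = n\<^sup>2"
      using rational_square_int[OF sq(1) x] .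
    have q0: "q \<noteq> 0" if "m \<noteq> 0"
      using q that by auto
    have "m \<noteq> 2" "m \<noteq> - 2" "m \<noteq> - 4"
      using int_square_notin[of n] n by auto
    then consider "m = 2 * d" | "m = 4 * d" | "m = - 4 * d" | "m = - 8 * d"
      using sq(2) by auto
    then show False
    proof cases
      case 1
      then have "of_int d = 2 * (q / 2)\<^sup>2" "q / 2 \<noteq> 0"
        using q q0 d_nonzero by (simp_all add: power_divide)
      then show False using gen(2) by blast
    next
      case 2
      then have "of_int d = (q / 2)\<^sup>2" "q / 2 \<noteq> 0"
        using q q0 d_nonzero by (simp_all add: power_divide)
      then show False using gen(1) by blast
    next
      case 3
      then have "of_int d = - (q / 2)\<^sup>2" "q / 2 \<noteq> 0"
        using q q0 d_nonzero by (simp_all add: power_divide)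
      then show False using gen(1) by blast
    next
      case 4
      then have "of_int d = - (2 * (q / 4)\<^sup>2)" "q / 4 \<noteq> 0"
        using q q0 d_nonzero by (simp_all add: power_divide)
      then show False using gen(2) by blast
    qed
  qed
  have nr: "w \<notin> range to_ac" "r \<notin> range to_ac" "w * r \<notin> range to_ac" "k \<notin> range to_ac"
    "k * r \<notin> range to_ac" "k * w \<notin> range to_ac" "w * (k * r) \<notin> range to_ac"
    using irr[of w "- 2"] irr[of r 2] irr[of "w * r" "- 4"] irr[of k "2 * d"] irr[of "k * r" "4 * d"]
      irr[of "k * w" "- 4 * d"] irr[of "w * (k * r)" "- 8 * d"] rk(1,2) w_square
    by (simp_all add: power_mult_distrib)
  have qr: "is_quadratic r"
    unfolding is_quadratic_def rk(1) by (metis rangeI to_ac_numeral)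
  have qk: "is_quadratic k"
    unfolding is_quadratic_def rk(2) by (metis rangeI to_ac_mult to_ac_numeral to_ac_of_int)
  have nz: "w \<noteq> 0" "r \<noteq> 0" "k \<noteq> 0"
    using w_square rk(1,2) d_nonzero by auto
  have psi_image: "psi False False M = 1 \<longleftrightarrow> \<sigma> k = k"
    if "\<sigma> \<in> absolute_galois" "E.gmatrix e1 Q (map_ec_point \<sigma>) M" for \<sigma> M
  proof -
    have "psi False False M = 1 \<or> psi False False M = - 1"
      by (rule psi_values)
    moreover have "\<sigma> k = of_int (psi False False M) * k"
      using rk(3)[OF that] by (simp add: psi_def)
    ultimately show ?thesis
      using minus_eq_self_iff[of k] nz(3) by auto
  qed
  obtain \<sigma> where \<sigma>: "\<sigma> \<in> absolute_galois" "\<sigma> w = w" "\<sigma> k = k" "\<sigma> r = - r"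
    using galois_fix2_move1[OF is_quadratic_w qk qr nr(2,3,5,7)] .
  obtain \<tau> where \<tau>: "\<tau> \<in> absolute_galois" "\<tau> k = k" "\<tau> w = - w"
    using galois_fix1_move1[OF qk is_quadratic_w nr(1,6)] .
  have nr': "w * k \<notin> range to_ac" "r * k \<notin> range to_ac" "w * (r * k) \<notin> range to_ac"
    using nr(5,6,7) by (simp_all add: mult_ac)
  obtain \<rho> where \<rho>: "\<rho> \<in> absolute_galois" "\<rho> w = w" "\<rho> r = r" "\<rho> k = - k"
    using galois_fix2_move1[OF is_quadratic_w qr qk nr(4) nr'] .
  obtain M where M: "E.gmatrix e1 Q (map_ec_point \<sigma>) M" "M \<in> image"
    using matrix_exists[OF \<sigma>(1)] .
  obtain N where N: "E.gmatrix e1 Q (map_ec_point \<tau>) N" "N \<in> image"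
    using matrix_exists[OF \<tau>(1)] .
  obtain R where R: "E.gmatrix e1 Q (map_ec_point \<rho>) R" "R \<in> image"
    using matrix_exists[OF \<rho>(1)] .
  have norm: "M \<in> normC" "N \<in> normC" "R \<in> normC"
    using image_normC M(2) N(2) R(2) by blast+
  have MC: "in_C M"
    by (rule matrix_type(1)[OF \<sigma>(1) M(1) \<sigma>(2)])
  have beta: "z2_odd (M $ 1 $ 2)"
    using odd_of_moves[where \<sigma> = \<sigma>, OF rk(1) _ \<sigma>(4)] rk(3)[OF \<sigma>(1) M(1)] by blast
  have "in_A N"
    using matrix_type(2)[OF \<tau>(1) N(1)] \<tau>(3) nz(1) minus_eq_self_iff by simp
  then have NA: "\<not> in_C N"
    using not_in_C_and_A[OF norm(2)] by blast
  have "cmat (M $ 2 $ 2) (M $ 1 $ 2) \<in> image" "cmat (M $ 2 $ 2) (M $ 1 $ 2) \<in> normC_index2 False False"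
    using in_C_cmat[OF MC] M(2) norm(1) psi_image[OF \<sigma>(1) M(1)] \<sigma>(3) by (auto simp: normC_index2_def)
  moreover have "N \<in> normC_index2 False False"
    using norm(2) psi_image[OF \<tau>(1) N(1)] \<tau>(2) by (simp add: normC_index2_def)
  ultimately have K: "normC_index2 False False \<subseteq> image"
    using topological_generators[OF subgroup_image limit_closed_image _ _ beta N(2) _ NA] by blast
  have "psi False False R \<noteq> 1"
    using psi_image[OF \<rho>(1) R(1)] \<rho>(4) nz(3) minus_eq_self_iff by simp
  then have "psi False False R = - 1"
    using psi_values[of False False R] by blast
  then show ?thesis
    using normC_index2_maximal[OF subgroup_image K R(2) norm(3)] image_normC by blast
qed

lemma Ed_image_conjugate:
  assumes "Ed_basis d f1 f2"
  shows "Ed_image d f1 f2 \<in> conjugacy_class image"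
proof -
  have f: "E.gbasis f1 f2"
    using assms by (simp add: Ed_basis_eq)
  obtain P where P: "invertible P"
    "\<And>s M N. s \<in> hom E E \<Longrightarrow> E.gmatrix e1 Q s M \<Longrightarrow> E.gmatrix f1 f2 s N \<Longrightarrow> M ** P = P ** N"
    by (rule E.gbasis_change[OF basis f], rule that; blast)
  define g where "g = inv\<^bsub>GL2_Z2\<^esub> P"
  have g: "invertible g" "g ** P = mat 1" "inv\<^bsub>GL2_Z2\<^esub> g = P"
    using GL2_inv(2,3)[OF P(1)] group.inv_inv[OF group_GL2_Z2, of P] P(1) by (simp_all add: g_def)
  have NM: "N = g ** M ** P"
    if "\<sigma> \<in> absolute_galois" "E.gmatrix e1 Q (map_ec_point \<sigma>) M" "E.gmatrix f1 f2 (map_ec_point \<sigma>) N" for \<sigma> M N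
  proof -
    have "g ** (M ** P) = g ** (P ** N)"
      using P(2)[OF map_hom[OF that(1)] that(2,3)] by simp
    then show ?thesis
      using g(2) by (simp add: matrix_mul_assoc)
  qed
  have "Ed_image d f1 f2 = (\<lambda>h. g ** h ** P) ` image"
  proof
    show "Ed_image d f1 f2 \<subseteq> (\<lambda>h. g ** h ** P) ` image"
    proof
      fix N assume "N \<in> Ed_image d f1 f2"
      then obtain \<sigma> where \<sigma>: "\<sigma> \<in> absolute_galois" "E.gmatrix f1 f2 (map_ec_point \<sigma>) N"
        by (auto simp: Ed_image_eq)
      obtain M where "E.gmatrix e1 Q (map_ec_point \<sigma>) M" "M \<in> image"
        using matrix_exists[OF \<sigma>(1)] .
      then show "N \<in> (\<lambda>h. g ** h ** P) ` image"
        using NM[OF \<sigma>(1) _ \<sigma>(2)] by blast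
    qed
    show "(\<lambda>h. g ** h ** P) ` image \<subseteq> Ed_image d f1 f2"
    proof (rule image_subsetI)
      fix M assume "M \<in> image"
      then obtain \<sigma> where \<sigma>: "\<sigma> \<in> absolute_galois" "E.gmatrix e1 Q (map_ec_point \<sigma>) M"
        by (auto simp: image_def)
      obtain N where N: "E.gmatrix f1 f2 (map_ec_point \<sigma>) N"
        using E.gmatrix_exists[OF f map_hom[OF \<sigma>(1)]] .
      then show "g ** M ** P \<in> Ed_image d f1 f2"
        using NM[OF \<sigma> N] \<sigma>(1) by (auto simp: Ed_image_eq)
    qed
  qed
  then show ?thesis
    using g(1,3) unfolding conjugacy_class_def by (auto intro!: exI[of _ g])
qed

end

section \<open>Arbitrary bases and the count of conjugacy classes\<close>

lemma Ed_generator_exists: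
  assumes "d \<noteq> 0"
  obtains w Q where "Ed_generator d w Q"
proof -
  obtain w :: qbar where w: "w\<^sup>2 = - 2"
    using nth_root_exists[of 2 "- 2 :: qbar"] by auto
  interpret Ed_curve d w
    by standard (use assms w in auto)
  obtain Q where "E.cyclic_generator Q"
    using E.cyclic_generator_exists .
  then have "Ed_generator d w Q"
    by unfold_locales
  then show ?thesis
    by (rule that)
qed

lemma Ed_basis_exists:
  assumes "d \<noteq> 0"
  shows "\<exists>e1 e2. Ed_basis d e1 e2"
proof -
  obtain w Q where "Ed_generator d w Q"
    using Ed_generator_exists[OF assms] .
  then interpret Ed_generator d w Q .
  show ?thesis
    using basis Ed_basis_eq by blast
qed

lemma Ed_image_special:
  assumes "d \<in> {2, 1, - 1, - 2}" "Ed_basis d e1 e2"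
  shows "Ed_image d e1 e2 \<in> conjugacy_class (normC_index2 (d \<in> {1, - 2}) (d < 0))"
proof -
  have "d \<noteq> 0"
    using assms(1) by auto
  then obtain w Q where "Ed_generator d w Q"
    using Ed_generator_exists by metis
  then interpret Ed_generator d w Q .
  show ?thesis
    using Ed_image_conjugate[OF assms(2)] image_special[OF assms(1)] by simp
qed

lemma Ed_image_generic:
  assumes "d \<noteq> 0" "Ed_basis d e1 e2"
    and "\<nexists>q::rat. q \<noteq> 0 \<and> (of_int d = q\<^sup>2 \<or> of_int d = - q\<^sup>2)"
    "\<nexists>q::rat. q \<noteq> 0 \<and> (of_int d = 2 * q\<^sup>2 \<or> of_int d = - (2 * q\<^sup>2))"
  shows "Ed_image d e1 e2 \<in> conjugacy_class normC"
proof -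
  obtain w Q where "Ed_generator d w Q"
    using Ed_generator_exists[OF assms(1)] .
  then interpret Ed_generator d w Q .
  show ?thesis
    using Ed_image_conjugate[OF assms(2)] image_generic[OF assms(3,4)] by simp
qed

lemma Ed_discriminant_j:
  assumes "d \<noteq> 0"
  shows "ec_discriminant (Ed_A d) (Ed_B d) \<noteq> 0" "ec_j_invariant (Ed_A d) (Ed_B d) = 8000"
proof -
  have D: "ec_discriminant (Ed_A d) (Ed_B d) = 1114512556032 * of_int d ^ 6"
    unfolding ec_discriminant_def Ed_A_def Ed_B_def discriminant_Ed by simp
  then show "ec_discriminant (Ed_A d) (Ed_B d) \<noteq> 0"
    using assms by simp
  have "(4 * Ed_A d) ^ 3 = - 5159780352000 * of_int d ^ 6"
    unfolding Ed_A_def by (simp add: power_mult_distrib flip: power_mult)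
  then show "ec_j_invariant (Ed_A d) (Ed_B d) = 8000"
    unfolding ec_j_invariant_def D using assms by simp
qed

lemma card_conjugacy_classes:
  "card (insert (conjugacy_class normC) (range (\<lambda>(i, j). conjugacy_class (normC_index2 i j)))) = 5"
proof -
  have c: "normC \<subseteq> carrier GL2_Z2" "normC_index2 i j \<subseteq> carrier GL2_Z2" for i j
    by (auto simp: normC_def normC_index2_def)
  have "inj (\<lambda>(i, j). conjugacy_class (normC_index2 i j))"
  proof (rule injI)
    fix p q :: "bool \<times> bool"
    assume eq: "(\<lambda>(i, j). conjugacy_class (normC_index2 i j)) p = (\<lambda>(i, j). conjugacy_class (normC_index2 i j)) q"
    obtain i j i' j' where pq: "p = (i, j)" "q = (i', j')"
      by (cases p; cases q)
    have "normC_index2 i j \<in> conjugacy_class (normC_index2 i' j')"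
      using conjugate_refl[OF c(2), of i j] eq unfolding pq by simp
    then show "p = q"
      unfolding pq using normC_index2_not_conjugate by blast
  qed
  then have "card (range (\<lambda>(i, j). conjugacy_class (normC_index2 i j))) = card (UNIV :: (bool \<times> bool) set)"
    by (rule card_image)
  moreover have "conjugacy_class normC \<notin> range (\<lambda>(i, j). conjugacy_class (normC_index2 i j))"
    using normC_not_conjugate conjugate_refl[OF c(1)] by auto
  ultimately show ?thesis
    by (simp add: card_insert_if)
qed

theorem theorem3p9:
  shows
    "(\<forall>d::int. d \<noteq> 0 \<and> squarefree d \<longrightarrow>
        ec_discriminant (Ed_A d) (Ed_B d) \<noteq> 0 \<and>
        ec_j_invariant (Ed_A d) (Ed_B d) = 8000 \<and>
        (\<exists>e1 e2. Ed_basis d e1 e2) \<and>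
        (\<forall>e1 e2. Ed_basis d e1 e2 \<longrightarrow>
           (d = 2 \<longrightarrow>
              conjugate_in_GL2 (Ed_image d e1 e2)
                (closed_subgroup_generated (G23 \<union> {c_mat 1}))) \<and>
           (d = 1 \<longrightarrow>
              conjugate_in_GL2 (Ed_image d e1 e2)
                (closed_subgroup_generated (G24 \<union> {c_mat 1}))) \<and>
           (d = - 1 \<longrightarrow>
              conjugate_in_GL2 (Ed_image d e1 e2)
                (closed_subgroup_generated (G23 \<union> {c_mat (- 1)}))) \<and>
           (d = - 2 \<longrightarrow>
              conjugate_in_GL2 (Ed_image d e1 e2)
                (closed_subgroup_generated (G24 \<union> {c_mat (- 1)}))) \<and>
           ((\<nexists>q::rat. q \<noteq> 0 \<and> (of_int d = q\<^sup>2 \<or> of_int d = - q\<^sup>2)) \<and>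
            (\<nexists>q::rat. q \<noteq> 0 \<and> (of_int d = 2 * q\<^sup>2 \<or> of_int d = - (2 * q\<^sup>2))) \<longrightarrow>
              conjugate_in_GL2 (Ed_image d e1 e2) normalizer_cartan))) \<and>
     card {conjugacy_class (Ed_image d e1 e2) | d e1 e2.
             d \<noteq> 0 \<and> squarefree d \<and> Ed_basis d e1 e2} = 5"
proof (intro conjI allI impI; (elim conjE)?)
  fix d :: int
  assume d: "d \<noteq> 0"
  show "ec_discriminant (Ed_A d) (Ed_B d) \<noteq> 0" "ec_j_invariant (Ed_A d) (Ed_B d) = 8000"
    by (fact Ed_discriminant_j[OF d])+
  show "\<exists>e1 e2. Ed_basis d e1 e2"
    by (rule Ed_basis_exists[OF d])
  fix e1 e2 assume b: "Ed_basis d e1 e2"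
  show "conjugate_in_GL2 (Ed_image d e1 e2) (closed_subgroup_generated (G23 \<union> {c_mat 1}))" if "d = 2"
    using Ed_image_special[of d e1 e2] b that unfolding conjugate_in_GL2_def index2_groups by simp
  show "conjugate_in_GL2 (Ed_image d e1 e2) (closed_subgroup_generated (G24 \<union> {c_mat 1}))" if "d = 1"
    using Ed_image_special[of d e1 e2] b that unfolding conjugate_in_GL2_def index2_groups by simp
  show "conjugate_in_GL2 (Ed_image d e1 e2) (closed_subgroup_generated (G23 \<union> {c_mat (- 1)}))" if "d = - 1"
    using Ed_image_special[of d e1 e2] b that unfolding conjugate_in_GL2_def index2_groups by simp
  show "conjugate_in_GL2 (Ed_image d e1 e2) (closed_subgroup_generated (G24 \<union> {c_mat (- 1)}))" if "d = - 2"
    using Ed_image_special[of d e1 e2] b that unfolding conjugate_in_GL2_def index2_groups by simp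
  show "conjugate_in_GL2 (Ed_image d e1 e2) normalizer_cartan"
    if "\<nexists>q::rat. q \<noteq> 0 \<and> (of_int d = q\<^sup>2 \<or> of_int d = - q\<^sup>2)"
      "\<nexists>q::rat. q \<noteq> 0 \<and> (of_int d = 2 * q\<^sup>2 \<or> of_int d = - (2 * q\<^sup>2))"
    using Ed_image_generic[OF d b that] unfolding conjugate_in_GL2_def normalizer_cartan_eq .
next
  let ?S = "{conjugacy_class (Ed_image d e1 e2) | d e1 e2. d \<noteq> 0 \<and> squarefree d \<and> Ed_basis d e1 e2}"
  let ?f = "\<lambda>(i, j). conjugacy_class (normC_index2 i j)"
  have c: "normC \<subseteq> carrier GL2_Z2" "normC_index2 i j \<subseteq> carrier GL2_Z2" for i j
    by (auto simp: normC_def normC_index2_def)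
  have special: "conjugacy_class (Ed_image d e1 e2) = ?f (d \<in> {1, - 2}, d < 0)"
    if "d \<in> {2, 1, - 1, - 2}" "Ed_basis d e1 e2" for d e1 e2
    using conjugacy_class_eqI[OF c(2) Ed_image_special[OF that]] by simp
  have generic: "conjugacy_class (Ed_image d e1 e2) = conjugacy_class normC"
    if "d \<noteq> 0" "squarefree d" "d \<notin> {1, - 1, 2, - 2}" "Ed_basis d e1 e2" for d e1 e2
    by (rule conjugacy_class_eqI[OF c(1) Ed_image_generic[OF that(1,4) squarefree_generic[OF that(2,3)]]])
  have "?S = insert (conjugacy_class normC) (range ?f)"
  proof (intro subset_antisym subsetI)
    fix C assume "C \<in> ?S"
    then obtain d e1 e2 where d: "C = conjugacy_class (Ed_image d e1 e2)" "d \<noteq> 0" "squarefree d" "Ed_basis d e1 e2"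
      by blast
    show "C \<in> insert (conjugacy_class normC) (range ?f)"
    proof (cases "d \<in> {1, - 1, 2, - 2}")
      case True
      then have "d \<in> {2, 1, - 1, - 2}" by auto
      then show ?thesis
        using special[OF _ d(4)] d(1) by blast
    next
      case False
      then show ?thesis
        using generic[OF d(2,3) _ d(4)] d(1) by blast
    qed
  next
    fix C assume C: "C \<in> insert (conjugacy_class normC) (range ?f)"
    have mem: "conjugacy_class (Ed_image d e1 e2) \<in> ?S" if "d \<noteq> 0" "squarefree d" "Ed_basis d e1 e2" for d e1 e2
      using that by blast
    consider "C = conjugacy_class normC" | i j where "C = ?f (i, j)"
      using C by auto
    then show "C \<in> ?S"
    proof cases
      case 1
      \<comment> \<open>The twist by 3 realizes the generic class.\<close>
      have "squarefree (3 :: int)"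
        by (rule squarefree_prime) simp
      moreover obtain e1 e2 where "Ed_basis 3 e1 e2"
        using Ed_basis_exists[of 3] by auto
      ultimately show ?thesis
        using mem[of 3 e1 e2] generic[of 3 e1 e2] 1 by simp
    next
      case (2 i j)
      \<comment> \<open>The inverse of the assignment of \<open>(d \<in> {1, - 2}, d < 0)\<close> to
        the four special values of \<open>d\<close>.\<close>
      define d :: int where "d = (if i then if j then - 2 else 1 else if j then - 1 else 2)"
      have d: "d \<noteq> 0" "d \<in> {2, 1, - 1, - 2}" "(d \<in> {1, - 2}) = i" "(d < 0) = j"
        by (auto simp: d_def)
      have "squarefree (2 :: int)"
        by (rule squarefree_prime) simp
      then have "squarefree d"
        by (simp add: d_def)
      moreover obtain e1 e2 where "Ed_basis d e1 e2"
        using Ed_basis_exists[OF d(1)] by auto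
      ultimately show ?thesis
        using mem[of d e1 e2] special[OF d(2), of e1 e2] d(1) unfolding d(3,4) 2 by simp
    qed
  qed
  then show "card ?S = 5"
    using card_conjugacy_classes by simp
qed

end
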